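(* There exist absolute constants $a,b>0$ such that for every $n\ge 2$, every non-identity subgroup $H\le S_n$ and every real number $c$: if $D_H\ge n^{-c}$, then $m(H)\le a c+b$. In particular, every distinguishable family of non-identity subgroups of symmetric groups has bounded minimal degree.
   Context: For a finite group $G$, $\mathrm{Irr}(G)$ is the set of complex irreducible representations of $G$ up to equivalence; for $\rho\in \mathrm{Irr}(G)$, $d_\rho$ is its dimension and $\chi_\rho$ its character. For a subgroup $H\le G$, $$D_H=\frac{1}{|G|}\sum_{\rho\in \mathrm{Irr}(G)} d_\rho\Big|\sum_{h\in H,\,h\ne 1}\chi_\rho(h)\Big|.$$ Here $G=S_n$. A family of subgroups $H\le S_n$ (with $n$ varying) is distinguishable if there is a constant $c$, independent of the member of the family, such that $D_H\ge n^{-c}$ for all members of the family. The minimal degree of $1\ne H\le S_n$ is $m(H)=\min\{|\mathrm{supp}(h)| : 1\ne h\in H\}$, where $\mathrm{supp}(h)=\{i : h(i)\ne i\}$. *)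

theory Defs
  imports
    "HOL-Algebra.Sym_Groups"
    "Jordan_Normal_Form.VS_Connect"
begin

definition mat_trace :: "'a::comm_monoid_add mat \<Rightarrow> 'a" where
  "mat_trace A = (\<Sum>i<dim_row A. A $$ (i, i))"

abbreviation GL :: "nat \<Rightarrow> complex mat monoid" where
  "GL d \<equiv> units_of (ring_mat TYPE(complex) d ())"

type_synonym 'a mat_rep = "nat \<times> ('a \<Rightarrow> complex mat)"

definition mat_reps :: "('a, 'b) monoid_scheme \<Rightarrow> 'a mat_rep set" where
  "mat_reps G = {(d, \<rho>). \<rho> \<in> hom G (GL d)}"

definition irreducible_reps :: "('a, 'b) monoid_scheme \<Rightarrow> 'a mat_rep set" where
  "irreducible_reps G =
     {(d, \<rho>) \<in> mat_reps G. 0 < d \<and>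
        (\<forall>W. subspace class_ring W (module_vec TYPE(complex) d) \<longrightarrow>
             (\<forall>g\<in>carrier G. \<forall>v\<in>W. \<rho> g *\<^sub>v v \<in> W) \<longrightarrow>
             W = {0\<^sub>v d} \<or> W = carrier_vec d)}"

text \<open>
  A member of \<^const>\<open>hom\<close> is unconstrained outside the carrier. The relation below only looks at
  the carrier, so representations that differ elsewhere are identified.
\<close>

definition irr_equiv :: "('a, 'b) monoid_scheme \<Rightarrow> ('a mat_rep \<times> 'a mat_rep) set" where
  "irr_equiv G =
     {((d, \<rho>), (d', \<sigma>)). (d, \<rho>) \<in> irreducible_reps G \<and> (d', \<sigma>) \<in> irreducible_reps G \<and> d = d' \<and>
        (\<exists>P \<in> carrier (GL d). \<forall>g\<in>carrier G. P * \<rho> g = \<sigma> g * P)}"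

definition Irr :: "('a, 'b) monoid_scheme \<Rightarrow> 'a mat_rep set set" where
  "Irr G = irreducible_reps G // irr_equiv G"

text \<open>
  The dimension and the character of a class are read off from a representative; the lemmas
  \<open>irr_dim_eq\<close> and \<open>irr_char_eq\<close> below show that its choice does not matter.
\<close>

definition irr_dim :: "'a mat_rep set \<Rightarrow> nat" where
  "irr_dim C = fst (SOME r. r \<in> C)"

definition irr_char :: "'a mat_rep set \<Rightarrow> 'a \<Rightarrow> complex" where
  "irr_char C g = mat_trace (snd (SOME r. r \<in> C) g)"

definition D_sub :: "('a, 'b) monoid_scheme \<Rightarrow> 'a set \<Rightarrow> real" where
  "D_sub G H =
     1 / real (Coset.order G) *
       (\<Sum>C\<in>Irr G. real (irr_dim C) * cmod (\<Sum>h\<in>H - {\<one>\<^bsub>G\<^esub>}. irr_char C h))"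

definition perm_supp :: "(nat \<Rightarrow> nat) \<Rightarrow> nat set" where
  "perm_supp h = {i. h i \<noteq> i}"

definition min_degree :: "(nat \<Rightarrow> nat) set \<Rightarrow> nat" where
  "min_degree H = Min {card (perm_supp h) | h. h \<in> H \<and> h \<noteq> id}"

text \<open>A family of subgroups of symmetric groups is a set of pairs \<open>(n, H)\<close> with \<open>H\<close> a subgroup of \<^term>\<open>sym_group n\<close>.\<close>

definition subgroup_family :: "(nat \<times> (nat \<Rightarrow> nat) set) set \<Rightarrow> bool" where
  "subgroup_family F \<longleftrightarrow> (\<forall>(n, H)\<in>F. subgroup H (sym_group n))"

definition distinguishable :: "(nat \<times> (nat \<Rightarrow> nat) set) set \<Rightarrow> bool" where
  "distinguishable F \<longleftrightarrow>
     subgroup_family F \<and> (\<exists>c::real. \<forall>(n, H)\<in>F. D_sub (sym_group n) H \<ge> real n powr (- c))"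

lemma GL_carrier_iff:
  "P \<in> carrier (GL d) \<longleftrightarrow>
     P \<in> carrier_mat d d \<and> (\<exists>Q\<in>carrier_mat d d. P * Q = 1\<^sub>m d \<and> Q * P = 1\<^sub>m d)"
  by (auto simp: units_of_def Units_def ring_mat_def)

lemma mat_trace_comm:
  fixes A B :: "complex mat"
  assumes "A \<in> carrier_mat n m" "B \<in> carrier_mat m n"
  shows "mat_trace (A * B) = mat_trace (B * A)"
proof -
  have "mat_trace (A * B) = (\<Sum>i<n. \<Sum>j<m. A $$ (i, j) * B $$ (j, i))"
    using assms by (auto simp: mat_trace_def scalar_prod_def atLeast0LessThan intro!: sum.cong)
  also have "\<dots> = (\<Sum>j<m. \<Sum>i<n. B $$ (j, i) * A $$ (i, j))"
    by (subst sum.swap) (simp add: mult.commute)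
  also have "\<dots> = mat_trace (B * A)"
    using assms by (auto simp: mat_trace_def scalar_prod_def atLeast0LessThan intro!: sum.cong)
  finally show ?thesis .
qed

lemma rep_carrier:
  assumes "(d, \<rho>) \<in> irreducible_reps G" "g \<in> carrier G"
  shows "\<rho> g \<in> carrier_mat d d"
  using assms GL_carrier_iff[of "\<rho> g" d]
  by (auto simp: irreducible_reps_def mat_reps_def hom_def)

lemma equiv_irr_equiv: "equiv (irreducible_reps G) (irr_equiv G)"
proof (rule equivI)
  show "irr_equiv G \<subseteq> irreducible_reps G \<times> irreducible_reps G"
    by (auto simp: irr_equiv_def)
  show "refl_on (irreducible_reps G) (irr_equiv G)"
  proof (rule refl_onI)
    fix x assume x: "x \<in> irreducible_reps G"
    obtain d \<rho> where [simp]: "x = (d, \<rho>)" by (cases x)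
    have "1\<^sub>m d \<in> carrier (GL d)"
      unfolding GL_carrier_iff by (auto intro!: bexI[of _ "1\<^sub>m d"])
    moreover have "\<forall>g\<in>carrier G. 1\<^sub>m d * \<rho> g = \<rho> g * 1\<^sub>m d"
      proof
      fix g assume "g \<in> carrier G"
      then have "\<rho> g \<in> carrier_mat d d" using rep_carrier x by auto
      then show "1\<^sub>m d * \<rho> g = \<rho> g * 1\<^sub>m d" by simp
    qed
    ultimately show "(x, x) \<in> irr_equiv G" using x by (auto simp: irr_equiv_def)
  qed
  show "sym (irr_equiv G)"
  proof (rule symI)
    fix x y assume "(x, y) \<in> irr_equiv G"
    then obtain d \<rho> \<sigma> P where xy: "x = (d, \<rho>)" "y = (d, \<sigma>)"
      and irr: "(d, \<rho>) \<in> irreducible_reps G" "(d, \<sigma>) \<in> irreducible_reps G"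
      and P: "P \<in> carrier (GL d)" and eq: "\<And>g. g \<in> carrier G \<Longrightarrow> P * \<rho> g = \<sigma> g * P"
      by (auto simp: irr_equiv_def)
    from P obtain Q where c: "P \<in> carrier_mat d d" "Q \<in> carrier_mat d d"
      and PQ: "P * Q = 1\<^sub>m d" "Q * P = 1\<^sub>m d" by (auto simp: GL_carrier_iff)
    have "Q * \<sigma> g = \<rho> g * Q" if g: "g \<in> carrier G" for g
    proof -
      note r = rep_carrier[OF irr(1) g] and s = rep_carrier[OF irr(2) g]
      have "Q * \<sigma> g = Q * (\<sigma> g * (P * Q))" using PQ s by simp
      also have "\<dots> = Q * ((\<sigma> g * P) * Q)" using c s by (simp add: assoc_mult_mat[of _ d d _ d _ d])
      also have "\<dots> = Q * ((P * \<rho> g) * Q)" using eq[OF g] by simp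
      also have "\<dots> = (Q * P) * (\<rho> g * Q)" using c r by (simp add: assoc_mult_mat[of _ d d _ d _ d])
      also have "\<dots> = \<rho> g * Q" using PQ c r by simp
      finally show ?thesis .
    qed
    moreover have "Q \<in> carrier (GL d)" using c PQ by (auto simp: GL_carrier_iff)
    ultimately show "(y, x) \<in> irr_equiv G" using irr xy by (auto simp: irr_equiv_def)
  qed
  show "trans (irr_equiv G)"
  proof (rule transI)
    fix x y z assume "(x, y) \<in> irr_equiv G" "(y, z) \<in> irr_equiv G"
    then obtain d \<rho> \<sigma> \<tau> P P' where xyz: "x = (d, \<rho>)" "z = (d, \<tau>)"
      and irr: "(d, \<rho>) \<in> irreducible_reps G" "(d, \<sigma>) \<in> irreducible_reps G"
        "(d, \<tau>) \<in> irreducible_reps G"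
      and P: "P \<in> carrier (GL d)" "P' \<in> carrier (GL d)"
      and eq: "\<And>g. g \<in> carrier G \<Longrightarrow> P * \<rho> g = \<sigma> g * P"
        "\<And>g. g \<in> carrier G \<Longrightarrow> P' * \<sigma> g = \<tau> g * P'"
      by (auto simp: irr_equiv_def)
    have c: "P \<in> carrier_mat d d" "P' \<in> carrier_mat d d" using P by (auto simp: GL_carrier_iff)
    have "(P' * P) * \<rho> g = \<tau> g * (P' * P)" if g: "g \<in> carrier G" for g
    proof -
      note r = rep_carrier[OF irr(1) g] and s = rep_carrier[OF irr(2) g]
        and t = rep_carrier[OF irr(3) g]
      have "(P' * P) * \<rho> g = P' * (\<sigma> g * P)"
        using c r eq(1)[OF g] by (simp add: assoc_mult_mat[of _ d d _ d _ d])
      also have "\<dots> = (P' * \<sigma> g) * P" using c s by (simp add: assoc_mult_mat[of _ d d _ d _ d])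
      also have "\<dots> = \<tau> g * (P' * P)"
        using c t eq(2)[OF g] by (simp add: assoc_mult_mat[of _ d d _ d _ d])
      finally show ?thesis .
    qed
    moreover have "P' * P \<in> carrier (GL d)"
    proof -
      from P obtain Q Q' where q: "Q \<in> carrier_mat d d" "Q' \<in> carrier_mat d d"
        "P * Q = 1\<^sub>m d" "Q * P = 1\<^sub>m d" "P' * Q' = 1\<^sub>m d" "Q' * P' = 1\<^sub>m d"
        by (auto simp: GL_carrier_iff)
      have "(P' * P) * (Q * Q') = P' * ((P * Q) * Q')"
        using c q(1,2) by (simp add: assoc_mult_mat[of _ d d _ d _ d])
      also have "\<dots> = 1\<^sub>m d" using q by simp
      finally have 1: "(P' * P) * (Q * Q') = 1\<^sub>m d" .
      have "(Q * Q') * (P' * P) = Q * ((Q' * P') * P)"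
        using c q(1,2) by (simp add: assoc_mult_mat[of _ d d _ d _ d])
      also have "\<dots> = 1\<^sub>m d" using c q by simp
      finally have 2: "(Q * Q') * (P' * P) = 1\<^sub>m d" .
      show ?thesis
        unfolding GL_carrier_iff using 1 2 mult_carrier_mat[OF c(2,1)] mult_carrier_mat[OF q(1,2)]
        by blast
    qed
    ultimately show "(x, z) \<in> irr_equiv G" using irr xyz by (auto simp: irr_equiv_def)
  qed
qed

lemma irr_class_rep:
  assumes "C \<in> Irr G" "r \<in> C"
  shows "(r, SOME r. r \<in> C) \<in> irr_equiv G"
  using assms someI[of "\<lambda>r. r \<in> C" r] quotient_eq_iff[OF equiv_irr_equiv, of C G C]
  by (auto simp: Irr_def)

lemma irr_dim_eq:
  assumes "C \<in> Irr G" "(d, \<rho>) \<in> C"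
  shows "irr_dim C = d"
  using irr_class_rep[OF assms] by (auto simp: irr_dim_def irr_equiv_def)

lemma irr_char_eq:
  assumes "C \<in> Irr G" "(d, \<rho>) \<in> C" "g \<in> carrier G"
  shows "irr_char C g = mat_trace (\<rho> g)"
proof -
  from irr_class_rep[OF assms(1,2)] obtain \<sigma> P
    where some: "(SOME r. r \<in> C) = (d, \<sigma>)"
      and irr: "(d, \<rho>) \<in> irreducible_reps G" "(d, \<sigma>) \<in> irreducible_reps G"
      and P: "P \<in> carrier (GL d)" and eq: "P * \<rho> g = \<sigma> g * P"
    using assms(3) by (auto simp: irr_equiv_def)
  from P obtain Q where c: "P \<in> carrier_mat d d" "Q \<in> carrier_mat d d"
    and PQ: "P * Q = 1\<^sub>m d" "Q * P = 1\<^sub>m d" by (auto simp: GL_carrier_iff)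
  note r = rep_carrier[OF irr(1) assms(3)] and s = rep_carrier[OF irr(2) assms(3)]
  have "mat_trace (\<sigma> g) = mat_trace (\<sigma> g * (P * Q))" using PQ s by simp
  also have "\<sigma> g * (P * Q) = (P * \<rho> g) * Q"
    using c s eq by (simp add: assoc_mult_mat[of _ d d _ d _ d])
  also have "mat_trace \<dots> = mat_trace (Q * (P * \<rho> g))"
    by (rule mat_trace_comm[of _ d d]) (use c r in auto)
  also have "Q * (P * \<rho> g) = \<rho> g"
    using c r PQ assoc_mult_mat[OF c(2,1) r] by simp
  finally show ?thesis by (simp add: irr_char_def some)
qed

end

theory Submission
  imports Defs "HOL-Algebra.Multiplicative_Group" "Jordan_Normal_Form.Spectral_Radius"
begin

text \<open>
  The characters of \<open>G\<close> satisfy a Bessel inequality. Applied to the indicator functions of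
  \<open>{1}\<close>, of \<open>H\<close> and of a conjugacy class it gives \<open>D\<^sub>H \<le> 2\<close> and
  \<open>D\<^sub>H \<le> (\<Sum>h\<in>H - {1}. 1 / sqrt \<bar>h\<^sup>G\<bar>)\<close>. An element of \<open>S\<^sub>n\<close> with support of size \<open>k\<close> and \<open>c\<close> nontrivial
  cycles has a centraliser of order at most \<open>k\<^sup>c (n - k)!\<close>, so it remains to show that a group of minimal
  degree \<open>m\<close> has few elements for given \<open>k\<close> and \<open>c\<close>: few enough to make its contribution to the
  sum at most \<open>n\<close> to the power \<open>-m/40\<close>. As there are at most \<open>n\<^sup>2\<close> pairs \<open>(k, c)\<close>, the theorem follows.

  The elements are counted by an injective code. Colour the points at random with \<open>s\<close> colours, \<open>s\<close> a
  tiny power of \<open>k\<close>, constant on short segments of the cycles of \<open>h\<close>. Since nontrivial elements have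
  large support, for almost all colourings no point of the support of \<open>h\<close> has a large orbit under the elements that preserve the
  colouring and act on few colours only. Up to cheap data \<open>h\<close> lies in a fixed coset of the stabiliser
  \<open>K\<close> of the colouring. Where the orbits of \<open>K\<close> are small, the value of \<open>h\<close> costs a bounded number of
  bits of size \<open>log s\<close>. Elsewhere commutators of the difference of two elements with \<open>K\<close> act on fewer colours,
  so one value of \<open>h\<close> determines it, up to few choices, on a whole orbit. Along a cycle all
  values but the first are then cheap. Finally cycles covering about \<open>m/4\<close> points
  may be left out of the code: two elements with the same code differ in fewer than \<open>m\<close> points and hence coincide.
\<close>

subsection \<open>Supports of commutators\<close>


text \<open>The centraliser bound makes the weight of an element exp(O(k)) n^(-k/2) k^(c/2), so the
  elements counted may number hardly more than n^(k/2) k^(-c/2). The tight case is a product of k/2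
  transpositions: naming one point of each already costs (n choose k/2), about n^(k/2) k^(-k/2), and
  exhausts the power of n. Hence everything else must cost a tiny power of k per point, paid by the
  remaining k^(-k/4), and the factor n^(-m/40) can only come from leaving cycles out. Cuts and
  explicit values cost n^2 each; segments of 40 points and a fraction 1/250 of explicit values keep
  the other points below n^(1/2) each. The obstacle is circularity: a rule that derives a value of
  \<open>h\<close> from its value at another point of an orbit presupposes that two elements with
  the same code agree on some colours. The set \<open>B\<close> breaks the circle. Points with
  colours in \<open>B\<close> are never omitted and never use this rule, so they are decoded first;
  the rule is applied only where \<open>link u\<close> contains a colour of
  \<open>B\<close>.\<close>

locale perm_group =
  fixes \<Omega> :: "nat set" and H :: "(nat \<Rightarrow> nat) set"
  assumes fin: "finite \<Omega>"
    and permutes: "h \<in> H \<Longrightarrow> h permutes \<Omega>"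
    and id_in: "id \<in> H"
    and comp_in: "g \<in> H \<Longrightarrow> h \<in> H \<Longrightarrow> g \<circ> h \<in> H"
    and inv_in: "h \<in> H \<Longrightarrow> inv' h \<in> H"
begin

lemma finite_H: "finite H"
  by (rule finite_subset[OF _ finite_permutations[OF fin]]) (auto dest: permutes)

lemma bij_H: "h \<in> H \<Longrightarrow> bij h"
  using permutes permutes_bij by blast

lemma supp_subset: "h \<in> H \<Longrightarrow> perm_supp h \<subseteq> \<Omega>"
  using permutes by (auto simp: perm_supp_def permutes_def)

lemma finite_supp: "h \<in> H \<Longrightarrow> finite (perm_supp h)"
  using supp_subset fin finite_subset by blast

lemma inv_f: "h \<in> H \<Longrightarrow> inv' h (h x) = x"
  using bij_H bij_is_inj inv_f_f by metis

lemma f_inv: "h \<in> H \<Longrightarrow> h (inv' h x) = x"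
  using bij_H bij_is_surj surj_f_inv_f by metis

lemma inj_H: "h \<in> H \<Longrightarrow> h x = h y \<longleftrightarrow> x = y"
  using inv_f by metis

lemma in_Omega: "h \<in> H \<Longrightarrow> h x \<in> \<Omega> \<longleftrightarrow> x \<in> \<Omega>"
  using permutes permutes_in_image by metis

end

definition orb :: "(nat \<Rightarrow> nat) set \<Rightarrow> nat \<Rightarrow> nat set" where
  "orb K x = (\<lambda>k. k x) ` K"

lemma orbI: "k \<in> K \<Longrightarrow> w = k x \<Longrightarrow> w \<in> orb K x"
  unfolding orb_def by (rule image_eqI)

lemma orbE: "w \<in> orb K x \<Longrightarrow> (\<And>k. k \<in> K \<Longrightarrow> w = k x \<Longrightarrow> P) \<Longrightarrow> P"
  unfolding orb_def by blast

lemma orb_mono: "K \<subseteq> K' \<Longrightarrow> orb K x \<subseteq> orb K' x"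
  unfolding orb_def by blast

context perm_group begin

lemma orb_self: "x \<in> orb H x"
  unfolding orb_def by (rule image_eqI[of _ _ id]) (auto simp: id_in)

lemma finite_orb: "finite (orb H x)"
  by (simp add: orb_def finite_H)

lemma orb_eq: "y \<in> orb H x \<Longrightarrow> orb H y = orb H x"
proof -
  assume "y \<in> orb H x"
  then obtain k where k: "k \<in> H" "y = k x" by (auto simp: orb_def)
  have "h y \<in> orb H x" if "h \<in> H" for h
    unfolding orb_def k(2) by (rule image_eqI[of _ _ "h \<circ> k"]) (auto intro: comp_in that k)
  moreover have "h x \<in> orb H y" if "h \<in> H" for h
    unfolding orb_def k(2)
    by (rule image_eqI[of _ _ "h \<circ> inv' k"]) (auto intro: comp_in inv_in that k simp: inv_f k)
  ultimately show ?thesis by (auto simp: orb_def)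
qed

lemma orb_sym: "y \<in> orb H x \<Longrightarrow> x \<in> orb H y"
  using orb_eq orb_self by metis

text \<open>Where the supports do not meet, the two elements commute. If the commutator moves
  \<open>w\<close>, then \<open>w\<close>, \<open>f w\<close> or \<open>inv' g w\<close> lies in the
  common support.\<close>

lemma card_supp_commutator:
  assumes "f \<in> H" "g \<in> H"
  shows "card (perm_supp (g \<circ> inv' f \<circ> inv' g \<circ> f)) \<le> 3 * card (perm_supp f \<inter> perm_supp g)"
proof -
  let ?I = "perm_supp f \<inter> perm_supp g"
  have "perm_supp (g \<circ> inv' f \<circ> inv' g \<circ> f) \<subseteq> ?I \<union> inv' f ` ?I \<union> g ` ?I"
  proof
    fix w assume "w \<in> perm_supp (g \<circ> inv' f \<circ> inv' g \<circ> f)"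
    then have w: "g (inv' f (inv' g (f w))) \<noteq> w" by (simp add: perm_supp_def)
    show "w \<in> ?I \<union> inv' f ` ?I \<union> g ` ?I"
    proof (cases "f w = w")
      case True
      define v where "v = inv' g w"
      have gv: "g v = w" using f_inv[OF assms(2)] by (simp add: v_def)
      have "f v \<noteq> v"
      proof
        assume "f v = v"
        then have "inv' f v = v" using inv_f[OF assms(1)] by metis
        then show False using w True gv by (simp add: v_def)
      qed
      moreover have "g v \<noteq> v" using \<open>f v \<noteq> v\<close> True gv by auto
      ultimately have "v \<in> ?I" by (simp add: perm_supp_def)
      then show ?thesis using gv by blast
    next
      case False
      then have fw: "f (f w) \<noteq> f w" using inj_H[OF assms(1)] by metis
      show ?thesis
      proof (cases "g (f w) = f w")
        case True
        then have "inv' g (f w) = f w" using inv_f[OF assms(2)] by metis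
        then have "g w \<noteq> w" using w inv_f[OF assms(1)] by simp
        then show ?thesis using False by (simp add: perm_supp_def)
      next
        case gf: False
        then have "f w \<in> ?I" using fw by (simp add: perm_supp_def)
        then have "inv' f (f w) \<in> inv' f ` ?I" by blast
        then show ?thesis using inv_f[OF assms(1)] by simp
      qed
    qed
  qed
  moreover have fI: "finite ?I" using finite_supp assms by blast
  ultimately have "card (perm_supp (g \<circ> inv' f \<circ> inv' g \<circ> f)) \<le> card (?I \<union> inv' f ` ?I \<union> g ` ?I)"
    by (intro card_mono) auto
  also have "\<dots> \<le> card ?I + card (inv' f ` ?I) + card (g ` ?I)"
    by (meson add_mono card_Un_le le_trans order_refl)
  also have "\<dots> \<le> 3 * card ?I"
    using card_image_le[OF fI, of "inv' f"] card_image_le[OF fI, of g] by simp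
  finally show ?thesis .
qed

text \<open>
  The points of \<open>Y\<close> are images \<open>f x\<close>, where \<open>f\<close> has minimal support among the elements that move \<open>x\<close> outside
  \<open>x\<close> and the points chosen before. If \<open>g\<close> moves \<open>x\<close> outside \<open>insert x Y\<close> and fixes \<open>f x\<close>, then the
  commutator \<open>g f\<^sup>-\<^sup>1 g\<^sup>-\<^sup>1 f\<close> also maps \<open>x\<close> to \<open>g x\<close>, so by minimality its support is not smaller than that of \<open>f\<close>.
\<close>

lemma escaping_element_trap:
  "\<exists>Y F. finite Y \<and> x \<notin> Y \<and> (card Y = t \<or> card Y \<le> t \<and> orb H x \<subseteq> insert x Y) \<and>
     (\<forall>y\<in>Y. F y \<in> H \<and> F y \<noteq> id \<and>
       (\<forall>g R. g \<in> H \<longrightarrow> (\<forall>u. u \<notin> R \<longrightarrow> g u = u) \<longrightarrow> g x \<notin> insert x Y \<longrightarrow>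
          y \<in> R \<or> card (perm_supp (F y)) \<le> 3 * card (perm_supp (F y) \<inter> R)))"
proof (induction t)
  case 0
  show ?case by (rule exI[of _ "{}"]) simp
next
  case (Suc t)
  then obtain Y F where Y: "finite Y" "x \<notin> Y" "card Y = t \<or> card Y \<le> t \<and> orb H x \<subseteq> insert x Y"
    and F: "\<And>y. y \<in> Y \<Longrightarrow> F y \<in> H \<and> F y \<noteq> id"
    and FR: "\<And>y g R. y \<in> Y \<Longrightarrow> g \<in> H \<Longrightarrow> (\<forall>u. u \<notin> R \<longrightarrow> g u = u) \<Longrightarrow> g x \<notin> insert x Y \<Longrightarrow>
          y \<in> R \<or> card (perm_supp (F y)) \<le> 3 * card (perm_supp (F y) \<inter> R)"
    by metis
  show ?case
  proof (cases "orb H x \<subseteq> insert x Y")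
    case True
    show ?thesis
    proof (intro exI[of _ Y] exI[of _ F] conjI ballI allI impI)
      fix y assume y: "y \<in> Y"
      show "F y \<in> H" "F y \<noteq> id" using F[OF y] by auto
      fix g R assume "g \<in> H" "\<forall>u. u \<notin> R \<longrightarrow> g u = u" "g x \<notin> insert x Y"
      then show "y \<in> R \<or> card (perm_supp (F y)) \<le> 3 * card (perm_supp (F y) \<inter> R)"
        using FR y by blast
    qed (use Y True in auto)
  next
    case False
    then have cY: "card Y = t" using Y by blast
    let ?P = "\<lambda>f. f \<in> H \<and> f x \<notin> insert x Y"
    obtain f0 where "?P f0" using False by (auto simp: orb_def)
    then obtain f where f: "?P f" and fmin: "\<And>c. ?P c \<Longrightarrow> card (perm_supp f) \<le> card (perm_supp c)"
      using ex_has_least_nat[of ?P f0 "\<lambda>f. card (perm_supp f)"] by auto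
    define y where "y = f x"
    have y: "y \<notin> insert x Y" using f by (simp add: y_def)
    have key: "y \<in> R \<or> card (perm_supp f) \<le> 3 * card (perm_supp f \<inter> R)"
      if g: "g \<in> H" and gR: "\<forall>u. u \<notin> R \<longrightarrow> g u = u" and gx: "g x \<notin> insert x Y" for g R
    proof (cases "y \<in> R")
      case False
      have "inv' g y = y" using gR False inv_f[OF g] by metis
      then have "(g \<circ> inv' f \<circ> inv' g \<circ> f) x = g x"
        using inv_f f by (simp add: y_def)
      moreover have "g \<circ> inv' f \<circ> inv' g \<circ> f \<in> H"
        using f g by (intro comp_in inv_in) auto
      ultimately have "card (perm_supp f) \<le> card (perm_supp (g \<circ> inv' f \<circ> inv' g \<circ> f))"
        using gx by (intro fmin) auto
      also have "\<dots> \<le> 3 * card (perm_supp f \<inter> perm_supp g)"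
        using card_supp_commutator f g by blast
      also have "card (perm_supp f \<inter> perm_supp g) \<le> card (perm_supp f \<inter> R)"
        using gR f finite_supp by (intro card_mono) (auto simp: perm_supp_def)
      finally show ?thesis by simp
    qed simp
    show ?thesis
    proof (intro exI[of _ "insert y Y"] exI[of _ "F(y := f)"] conjI ballI allI impI)
      fix y' assume "y' \<in> insert y Y"
      then show "(F(y := f)) y' \<in> H" "(F(y := f)) y' \<noteq> id" using f F y by auto
      fix g R assume g: "g \<in> H" "\<forall>u. u \<notin> R \<longrightarrow> g u = u" "g x \<notin> insert x (insert y Y)"
      show "y' \<in> R \<or> card (perm_supp ((F(y := f)) y')) \<le> 3 * card (perm_supp ((F(y := f)) y') \<inter> R)"
        using key[of g R] FR[of y' g R] g \<open>y' \<in> insert y Y\<close> by auto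
    qed (use Y y cY in auto)
  qed
qed

end

subsection \<open>Cycles and their segments\<close>


definition cyc :: "(nat \<Rightarrow> nat) \<Rightarrow> nat \<Rightarrow> nat set" where
  "cyc h u = range (\<lambda>a. (h ^^ a) u)"

locale finite_perm =
  fixes \<Omega> :: "nat set" and h :: "nat \<Rightarrow> nat"
  assumes fin: "finite \<Omega>" and perm: "h permutes \<Omega>"
begin

lemma inj_h: "inj h" using perm permutes_inj by blast

lemma inj_funpow: "(h ^^ a) x = (h ^^ a) y \<longleftrightarrow> x = y"
  using inj_fn[OF inj_h] by (metis inj_eq)

lemma cyc_subset: "cyc h u \<subseteq> insert u \<Omega>"
proof -
  have "(h ^^ a) u \<in> insert u \<Omega>" for a
  proof (induction a)
    case (Suc a)
    then show ?case using perm by (cases "u \<in> \<Omega>") (auto simp: permutes_in_image permutes_not_in)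
  qed simp
  then show ?thesis by (auto simp: cyc_def)
qed

lemma finite_cyc: "finite (cyc h u)"
  using cyc_subset fin finite_subset by blast

lemma cyc_self: "u \<in> cyc h u"
  unfolding cyc_def by (rule image_eqI[of _ _ 0]) auto

lemma cyc_nonempty: "0 < card (cyc h u)"
  using finite_cyc cyc_self by (metis card_gt_0_iff empty_iff)

lemma period_ex: "\<exists>p>0. p \<le> card (cyc h u) \<and> (h ^^ p) u = u"
proof -
  let ?n = "card (cyc h u)"
  have "(\<lambda>a. (h ^^ a) u) ` {..?n} \<subseteq> cyc h u" by (auto simp: cyc_def)
  then have "card ((\<lambda>a. (h ^^ a) u) ` {..?n}) \<le> ?n" by (rule card_mono[OF finite_cyc])
  then have "\<not> inj_on (\<lambda>a. (h ^^ a) u) {..?n}" using card_image by fastforce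
  then obtain a b where "a \<noteq> b" "a \<le> ?n" "b \<le> ?n" "(h ^^ a) u = (h ^^ b) u"
    by (auto simp: inj_on_def)
  then obtain a b where ab: "a < b" "b \<le> ?n" "(h ^^ a) u = (h ^^ b) u"
    by (metis linorder_neqE_nat)
  have "(h ^^ a) ((h ^^ (b - a)) u) = (h ^^ (a + (b - a))) u"
    unfolding funpow_add comp_apply ..
  then have "(h ^^ a) u = (h ^^ a) ((h ^^ (b - a)) u)" using ab by simp
  then have "(h ^^ (b - a)) u = u" using inj_funpow by metis
  then show ?thesis using ab by (intro exI[of _ "b - a"]) auto
qed

lemma funpow_mod_period: "(h ^^ p) u = u \<Longrightarrow> (h ^^ a) u = (h ^^ (a mod p)) u"
proof -
  assume p: "(h ^^ p) u = u"
  have "(h ^^ (p * q)) u = u" for q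
    by (induction q) (simp_all add: funpow_add p)
  then have "(h ^^ (a mod p + p * (a div p))) u = (h ^^ (a mod p)) u"
    unfolding funpow_add comp_apply by metis
  then show ?thesis by (metis mod_mult_div_eq)
qed

lemma cyc_eq_image: "cyc h u = (\<lambda>a. (h ^^ a) u) ` {..<card (cyc h u)}"
proof -
  obtain p where p: "0 < p" "p \<le> card (cyc h u)" "(h ^^ p) u = u" using period_ex by blast
  have "(h ^^ a) u \<in> (\<lambda>a. (h ^^ a) u) ` {..<card (cyc h u)}" for a
  proof (rule image_eqI[of _ _ "a mod p"])
    show "(h ^^ a) u = (h ^^ (a mod p)) u" by (rule funpow_mod_period[OF p(3)])
    have "a mod p < p" using p(1) by simp
    then show "a mod p \<in> {..<card (cyc h u)}" using p(2) by simp
  qed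
  then show ?thesis by (auto simp: cyc_def)
qed

lemma cyc_inj: "inj_on (\<lambda>a. (h ^^ a) u) {..<card (cyc h u)}"
  using cyc_eq_image[of u] by (intro eq_card_imp_inj_on) (simp_all)

lemma cyc_obtain:
  assumes "w \<in> cyc h u"
  obtains a where "a < card (cyc h u)" "w = (h ^^ a) u"
  using assms cyc_eq_image[of u] by auto

lemma funpow_card_cyc: "(h ^^ card (cyc h u)) u = u"
proof -
  obtain p where p: "0 < p" "p \<le> card (cyc h u)" "(h ^^ p) u = u" using period_ex by blast
  have "p = card (cyc h u)"
  proof (rule ccontr)
    assume "p \<noteq> card (cyc h u)"
    then have "p \<in> {..<card (cyc h u)}" "0 \<in> {..<card (cyc h u)}" using p by auto
    then have "p = 0" using inj_onD[OF cyc_inj[of u], of p 0] p by auto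
    then show False using p by simp
  qed
  then show ?thesis using p by simp
qed

lemma cyc_eq: "w \<in> cyc h u \<Longrightarrow> cyc h w = cyc h u"
proof -
  assume "w \<in> cyc h u"
  then obtain a where a: "a < card (cyc h u)" "w = (h ^^ a) u" by (rule cyc_obtain)
  have 1: "(h ^^ b) w \<in> cyc h u" for b
    unfolding cyc_def by (rule image_eqI[of _ _ "b + a"]) (simp_all only: a(2) funpow_add comp_apply UNIV_I)
  have "(h ^^ (card (cyc h u) - a)) w = (h ^^ (card (cyc h u) - a + a)) u"
    unfolding a(2) funpow_add comp_apply ..
  then have "(h ^^ (card (cyc h u) - a)) w = u" using a funpow_card_cyc[of u] by simp
  then have "(h ^^ b) u = (h ^^ (b + (card (cyc h u) - a))) w" for b
    unfolding funpow_add comp_apply by simp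
  then have 2: "(h ^^ b) u \<in> cyc h w" for b
    unfolding cyc_def by blast
  show ?thesis using 1 2 by (auto simp: cyc_def)
qed

lemma cyc_step: "cyc h (h u) = cyc h u"
proof (rule cyc_eq)
  show "h u \<in> cyc h u" unfolding cyc_def by (rule image_eqI[of _ _ 1]) auto
qed

lemma cyc_funpow: "(h ^^ a) u \<in> cyc h u"
  by (auto simp: cyc_def)

lemma cyc_supp: "u \<in> perm_supp h \<Longrightarrow> cyc h u \<subseteq> perm_supp h"
proof
  fix w assume u: "u \<in> perm_supp h" and w: "w \<in> cyc h u"
  show "w \<in> perm_supp h"
  proof (rule ccontr)
    assume "w \<notin> perm_supp h"
    then have "h w = w" by (simp add: perm_supp_def)
    then have "(h ^^ a) w = w" for a by (induction a) auto
    then have "cyc h w = {w}" by (auto simp: cyc_def)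
    then have "u = w" using cyc_eq[OF w] cyc_self[of u] by auto
    then show False using u \<open>w \<notin> perm_supp h\<close> by simp
  qed
qed

lemma card_cyc_ge2: "u \<in> perm_supp h \<Longrightarrow> 2 \<le> card (cyc h u)"
proof -
  assume u: "u \<in> perm_supp h"
  have "{u, h u} \<subseteq> cyc h u" using cyc_self cyc_funpow[of 1 u] by auto
  then have "card {u, h u} \<le> card (cyc h u)" by (rule card_mono[OF finite_cyc])
  then show ?thesis using u by (simp add: perm_supp_def)
qed

definition base :: "nat \<Rightarrow> nat" where "base u = Min (cyc h u)"

lemma base_in: "base u \<in> cyc h u"
  unfolding base_def by (rule Min_in[OF finite_cyc]) (use cyc_self in blast)

lemma base_cong: "w \<in> cyc h u \<Longrightarrow> base w = base u"
  unfolding base_def using cyc_eq by metis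

lemma cyc_base: "cyc h (base u) = cyc h u"
  by (rule cyc_eq[OF base_in])

lemma in_cyc_base: "u \<in> cyc h (base u)"
  using cyc_base cyc_self by metis

lemma base_base: "base (base u) = base u"
  by (rule base_cong[OF base_in])

definition cpos :: "nat \<Rightarrow> nat" where "cpos u = (LEAST a. (h ^^ a) (base u) = u)"

lemma cpos: "(h ^^ cpos u) (base u) = u" "cpos u < card (cyc h u)"
proof -
  obtain a where a: "a < card (cyc h u)" "(h ^^ a) (base u) = u"
    using cyc_obtain[OF in_cyc_base[of u]] cyc_base[of u] by metis
  show "(h ^^ cpos u) (base u) = u" unfolding cpos_def using a(2) by (rule LeastI)
  have "cpos u \<le> a" unfolding cpos_def using a(2) by (rule Least_le)
  then show "cpos u < card (cyc h u)" using a(1) by simp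
qed

lemma cpos_unique: "a < card (cyc h u) \<Longrightarrow> (h ^^ a) (base u) = u \<Longrightarrow> a = cpos u"
  using cpos[of u] inj_onD[OF cyc_inj[of "base u"], of a "cpos u"] cyc_base[of u] by simp

lemma cpos_step: "cpos (h u) = (if Suc (cpos u) = card (cyc h u) then 0 else Suc (cpos u))"
proof -
  have b: "base (h u) = base u" using base_cong[of "h u" u] cyc_step cyc_self by metis
  show ?thesis
  proof (cases "Suc (cpos u) = card (cyc h u)")
    case True
    have "h u = (h ^^ Suc (cpos u)) (base u)" using cpos(1)[of u] by simp
    also have "\<dots> = base u" using funpow_card_cyc[of "base u"] cyc_base True by simp
    finally have "(h ^^ 0) (base (h u)) = h u" using b by simp
    then have "0 = cpos (h u)" by (intro cpos_unique) (use cyc_nonempty in auto)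
    then show ?thesis using True by simp
  next
    case False
    then have "Suc (cpos u) < card (cyc h (h u))" using cpos(2)[of u] cyc_step by simp
    moreover have "(h ^^ Suc (cpos u)) (base (h u)) = h u" using cpos(1)[of u] b by simp
    ultimately have "Suc (cpos u) = cpos (h u)" by (rule cpos_unique)
    then show ?thesis using False by simp
  qed
qed

end

locale cut_perm = finite_perm +
  fixes l :: nat
  assumes l_pos: "0 < l"
begin

text \<open>
  A cycle of length at most \<open>l\<close> is a single segment. A longer one is cut, starting at its base point, into
  segments of length \<open>l\<close> and a last one that may be shorter; \<open>seg u\<close> is the first point of the segment of \<open>u\<close>.
  The points of \<open>cuts\<close> are those which \<open>h\<close> maps to the beginning of a segment of a long cycle.
\<close>

definition long :: "nat set" where "long = {u \<in> \<Omega>. l < card (cyc h u)}"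

definition seg :: "nat \<Rightarrow> nat" where
  "seg u = (if card (cyc h u) \<le> l then base u else (h ^^ (l * (cpos u div l))) (base u))"

definition cuts :: "nat set" where "cuts = {u \<in> long. seg (h u) = h u}"

lemma seg_in_cyc: "seg u \<in> cyc h u"
  using base_in cyc_funpow[of _ "base u"] cyc_base[of u] by (auto simp: seg_def)

lemma cyc_seg: "cyc h (seg u) = cyc h u" by (rule cyc_eq[OF seg_in_cyc])

lemma base_seg: "base (seg u) = base u" by (rule base_cong[OF seg_in_cyc])

lemma cpos_walk: "a < card (cyc h u) \<Longrightarrow> cpos ((h ^^ a) (base u)) = a"
proof -
  assume a: "a < card (cyc h u)"
  have "cyc h ((h ^^ a) (base u)) = cyc h u" "base ((h ^^ a) (base u)) = base u"
    using cyc_eq[OF cyc_funpow[of a "base u"]] base_cong[OF cyc_funpow[of a "base u"]]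
    by (simp_all add: cyc_base base_base)
  then show ?thesis using a by (intro cpos_unique[symmetric]) simp_all
qed

lemma cpos_seg: "l < card (cyc h u) \<Longrightarrow> cpos (seg u) = l * (cpos u div l)"
proof -
  assume l: "l < card (cyc h u)"
  have "l * (cpos u div l) \<le> cpos u" by simp
  also have "\<dots> < card (cyc h u)" by (rule cpos(2))
  finally show ?thesis using l cpos_walk by (simp add: seg_def)
qed

lemma seg_seg: "seg (seg u) = seg u"
proof (cases "card (cyc h u) \<le> l")
  case True
  then show ?thesis using base_seg[of u] cyc_seg[of u] by (simp add: seg_def[of "seg u"]) (simp add: seg_def)
next
  case False
  have "seg (seg u) = (h ^^ (l * (cpos (seg u) div l))) (base (seg u))"
    using False cyc_seg[of u] by (simp add: seg_def[of "seg u"])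
  also have "\<dots> = seg u" using False cpos_seg[of u] base_seg[of u] l_pos by (simp add: seg_def)
  finally show ?thesis .
qed

lemma base_h: "base (h u) = base u"
  by (rule base_cong) (use cyc_funpow[of 1 u] in simp)

lemma seg_short_cong: "card (cyc h u) \<le> l \<Longrightarrow> w \<in> cyc h u \<Longrightarrow> seg w = seg u"
  using base_cong cyc_eq by (simp add: seg_def)

lemma seg_step:
  assumes "u \<notin> cuts"
  shows "seg (h u) = seg u"
proof (cases "card (cyc h u) \<le> l")
  case True
  then show ?thesis using seg_short_cong cyc_funpow[of 1 u] by simp
next
  case False
  have u: "u \<in> \<Omega>"
  proof (rule ccontr)
    assume "u \<notin> \<Omega>"
    then have "h u = u" using perm permutes_not_in by metis
    then have "(h ^^ a) u = u" for a by (induction a) auto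
    then have "cyc h u = {u}" by (auto simp: cyc_def)
    then show False using False l_pos by simp
  qed
  have ne: "seg (h u) \<noteq> h u" using assms False u by (auto simp: cuts_def long_def)
  have long': "l < card (cyc h (h u))" using False cyc_step by simp
  have "cpos (h u) mod l \<noteq> 0"
  proof
    assume "cpos (h u) mod l = 0"
    then have "l * (cpos (h u) div l) = cpos (h u)" by (metis add_0 mod_mult_div_eq)
    then have "seg (h u) = h u" using long' cpos(1)[of "h u"] by (simp add: seg_def)
    then show False using ne by simp
  qed
  then have d: "cpos (h u) = Suc (cpos u)" "Suc (cpos u) mod l \<noteq> 0"
    using cpos_step[of u] by (auto split: if_splits)
  then have "Suc (cpos u) div l = cpos u div l" by (auto simp: div_Suc)
  then show ?thesis using False long' d base_h by (simp add: seg_def)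
qed

text \<open>The decoder reaches every point from the start of its segment. The second clause keeps
  the walk inside one segment, hence inside one colour, as \<open>agree_B\<close> requires.\<close>

lemma seg_walk: "\<exists>a<l. (h ^^ a) (seg u) = u \<and> (\<forall>b\<le>a. seg ((h ^^ b) (seg u)) = seg u)"
proof (cases "card (cyc h u) \<le> l")
  case True
  have "seg ((h ^^ b) (seg u)) = seg u" for b
    using seg_short_cong[of "seg u" "(h ^^ b) (seg u)"] cyc_funpow[of b "seg u"] True cyc_seg[of u]
      seg_seg by simp
  moreover have "(h ^^ cpos u) (seg u) = u" using cpos(1) True by (simp add: seg_def)
  ultimately show ?thesis using cpos(2)[of u] True by (intro exI[of _ "cpos u"]) auto
next
  case False
  let ?q = "cpos u div l" and ?a = "cpos u mod l"
  have w: "(h ^^ b) (seg u) = (h ^^ (l * ?q + b)) (base u)" for b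
    using False by (simp add: seg_def add.commute[of _ b] funpow_add)
  have "seg ((h ^^ b) (seg u)) = seg u" if "b \<le> ?a" for b
  proof -
    have bl: "b < l" using that l_pos by (meson le_less_trans mod_less_divisor)
    have "l * ?q + b \<le> cpos u" using that by (metis add_left_mono mult_div_mod_eq)
    then have lt: "l * ?q + b < card (cyc h u)" using cpos(2)[of u] by simp
    then have "cpos ((h ^^ b) (seg u)) = l * ?q + b" using w cpos_walk by simp
    then have "cpos ((h ^^ b) (seg u)) div l = ?q" using bl by simp
    moreover have "cyc h ((h ^^ b) (seg u)) = cyc h u" "base ((h ^^ b) (seg u)) = base u"
      using cyc_eq[OF cyc_funpow[of b "seg u"]] base_cong[OF cyc_funpow[of b "seg u"]]
      by (simp_all add: cyc_seg base_seg)
    ultimately show ?thesis using False by (simp add: seg_def)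
  qed
  moreover have "(h ^^ ?a) (seg u) = u" using w[of ?a] cpos(1)[of u] by simp
  ultimately show ?thesis using l_pos by (intro exI[of _ ?a]) auto
qed

lemma card_seg_fibre: "card {u. seg u = v} \<le> l" "finite {u. seg u = v}"
proof -
  have sub: "{u. seg u = v} \<subseteq> (\<lambda>a. (h ^^ a) v) ` {..<l}"
  proof
    fix u assume "u \<in> {u. seg u = v}"
    then obtain a where "a < l" "(h ^^ a) v = u" using seg_walk[of u] by auto
    then show "u \<in> (\<lambda>a. (h ^^ a) v) ` {..<l}" by blast
  qed
  then show "finite {u. seg u = v}" by (rule finite_subset) simp
  have "card {u. seg u = v} \<le> card ((\<lambda>a. (h ^^ a) v) ` {..<l})" by (rule card_mono[OF _ sub]) simp
  also have "\<dots> \<le> l" using card_image_le[of "{..<l}" "\<lambda>a. (h ^^ a) v"] by simp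
  finally show "card {u. seg u = v} \<le> l" .
qed

lemma card_le_seg_image: "finite Y \<Longrightarrow> card Y \<le> l * card (seg ` Y)"
proof -
  assume Y: "finite Y"
  have "Y = (\<Union>v\<in>seg ` Y. {u \<in> Y. seg u = v})" by auto
  then have "card Y \<le> (\<Sum>v\<in>seg ` Y. card {u \<in> Y. seg u = v})"
    using card_UN_le[of "seg ` Y" "\<lambda>v. {u \<in> Y. seg u = v}"] Y by simp
  also have "\<dots> \<le> (\<Sum>v\<in>seg ` Y. l)"
    by (intro sum_mono le_trans[OF card_mono[OF card_seg_fibre(2)] card_seg_fibre(1)]) auto
  finally show ?thesis by (simp add: mult.commute)
qed

lemma seg_notin: "u \<notin> perm_supp h \<Longrightarrow> seg u = u"
proof -
  assume "u \<notin> perm_supp h"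
  then have "(h ^^ a) u = u" for a by (induction a) (auto simp: perm_supp_def)
  then have "cyc h u = {u}" by (auto simp: cyc_def)
  then show ?thesis using seg_in_cyc[of u] by simp
qed

lemma long_supp: "long \<subseteq> perm_supp h"
proof
  fix u assume u: "u \<in> long"
  show "u \<in> perm_supp h"
  proof (rule ccontr)
    assume "u \<notin> perm_supp h"
    then have "(h ^^ a) u = u" for a by (induction a) (auto simp: perm_supp_def)
    then have "cyc h u = {u}" by (auto simp: cyc_def)
    then show False using u l_pos by (simp add: long_def)
  qed
qed

lemma in_Omega_h: "h u \<in> \<Omega> \<longleftrightarrow> u \<in> \<Omega>"
  using perm permutes_in_image by metis

lemma cyc_Omega: "u \<in> \<Omega> \<Longrightarrow> cyc h u \<subseteq> \<Omega>"
  using cyc_subset by blast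

text \<open>The step that closes a long cycle counts as a cut, so the first segment of the cycle is
  covered as well. Knowing \<open>h\<close> on the cuts therefore gives all starting points for
  decoding the long cycles.\<close>

lemma seg_long:
  assumes "u \<in> long"
  shows "seg u \<in> h ` cuts"
proof -
  have "bij h" using perm permutes_bij by blast
  then obtain v where v: "h v = seg u" by (metis bij_pointE)
  have "cyc h v = cyc h u" using cyc_step[of v] v cyc_seg[of u] by simp
  moreover have "v \<in> \<Omega>" using assms in_Omega_h[of v] cyc_Omega[of u] seg_in_cyc[of u] v by (auto simp: long_def)
  ultimately have "v \<in> cuts" using assms v seg_seg[of u] by (auto simp: cuts_def long_def)
  then show ?thesis using v by force
qed

lemma cuts_subset: "cuts \<subseteq> long" by (auto simp: cuts_def)

lemma finite_long: "finite long" using fin by (simp add: long_def)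

lemma long_cong: "w \<in> cyc h u \<Longrightarrow> u \<in> long \<Longrightarrow> w \<in> long"
  using cyc_eq[of w u] cyc_Omega[of u] by (auto simp: long_def)

text \<open>Cuts correspond to starts of segments. The starts in \<open>?F\<close> begin full
  segments, which are disjoint sets of \<open>l\<close> points. The other starts begin the
  incomplete last segments; there is at most one in each cycle, and \<open>base\<close> sends it to
  the full segment with which a long cycle begins.\<close>

lemma card_cuts: "l * card cuts \<le> 2 * card long"
proof -
  let ?S = "{v \<in> long. seg v = v}"
  let ?F = "{v \<in> ?S. cpos v + l \<le> card (cyc h v)}"
  have finS: "finite ?S" using finite_long by simp
  have finF: "finite ?F" by (rule finite_subset[OF _ finS]) blast
  have dv: "\<exists>q. cpos v = l * q" if "v \<in> ?S" for v
    using that cpos_seg[of v] by (intro exI[of _ "cpos v div l"]) (simp add: long_def)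
  have walkF: "seg ((h ^^ a) v) = v" if "v \<in> ?F" "a < l" for v a
  proof -
    have v: "v \<in> long" "seg v = v" "cpos v + l \<le> card (cyc h v)" using that by auto
    have "(h ^^ a) ((h ^^ cpos v) (base v)) = (h ^^ (a + cpos v)) (base v)"
      unfolding funpow_add comp_apply ..
    then have "(h ^^ a) v = (h ^^ (cpos v + a)) (base v)"
      unfolding cpos(1) by (simp add: add.commute)
    moreover have "cpos v + a < card (cyc h v)" using v that by simp
    ultimately have d: "cpos ((h ^^ a) v) = cpos v + a" using cpos_walk by simp
    obtain q where "cpos v = l * q" using dv[of v] v by auto
    then have "(cpos v + a) div l = cpos v div l" using that(2) by simp
    moreover have "cyc h ((h ^^ a) v) = cyc h v" "base ((h ^^ a) v) = base v"
      using cyc_eq[OF cyc_funpow[of a v]] base_cong[OF cyc_funpow[of a v]] by simp_all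
    ultimately have "seg ((h ^^ a) v) = seg v" using v d by (simp add: seg_def long_def)
    then show ?thesis using v by simp
  qed
  have "inj_on (\<lambda>(v, a). (h ^^ a) v) (?F \<times> {..<l})"
  proof (rule inj_onI, clarify)
    fix v a v' a'
    assume *: "(h ^^ a) v = (h ^^ a') v'" "a < l" "a' < l" and
      v: "v \<in> long" "seg v = v" "cpos v + l \<le> card (cyc h v)"
      "v' \<in> long" "seg v' = v'" "cpos v' + l \<le> card (cyc h v')"
    have vv: "v = v'" using walkF[of v a] walkF[of v' a'] * v by auto
    then have "a = a'" using * v inj_onD[OF cyc_inj[of v], of a a'] by (auto simp: long_def)
    then show "v = v' \<and> a = a'" using vv by simp
  qed
  moreover have "(\<lambda>(v, a). (h ^^ a) v) ` (?F \<times> {..<l}) \<subseteq> long"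
    using long_cong cyc_funpow by auto
  ultimately have "card (?F \<times> {..<l}) \<le> card long"
    by (rule card_inj_on_le[OF _ _ finite_long])
  then have F: "card ?F * l \<le> card long" by (simp add: card_cartesian_product)
  have "base ` (?S - ?F) \<subseteq> ?F"
  proof
    fix x assume "x \<in> base ` (?S - ?F)"
    then obtain v where v: "v \<in> ?S - ?F" "x = base v" by blast
    have d: "cpos (base v) = 0" using cpos_walk[of 0 v] cyc_nonempty[of v] by simp
    have "base v \<in> long" using v long_cong[OF base_in] by auto
    moreover have "seg (base v) = base v"
      using d by (simp add: seg_def base_base)
    ultimately show "x \<in> ?F" using d v(2) by (auto simp: long_def)
  qed
  moreover have "inj_on base (?S - ?F)"
  proof (rule inj_onI)
    fix v w assume v: "v \<in> ?S - ?F" and w: "w \<in> ?S - ?F" and b: "base v = base w"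
    have c: "cyc h v = cyc h w" using b cyc_base by metis
    have "cpos v = cpos w"
    proof (rule ccontr)
      assume ne: "cpos v \<noteq> cpos w"
      have "card (cyc h v) < cpos v + l" "card (cyc h v) < cpos w + l"
        using v w c by auto
      then have "cpos w < cpos v + l" "cpos v < cpos w + l"
        using cpos(2)[of v] cpos(2)[of w] c by auto
      moreover obtain q q' where "cpos v = l * q" "cpos w = l * q'"
        using dv v w by blast
      ultimately have "l * q' < l * Suc q" "l * q < l * Suc q'" by simp_all
      then have "q = q'" unfolding mult_less_cancel1 by linarith
      then show False using ne \<open>cpos v = l * q\<close> \<open>cpos w = l * q'\<close> by simp
    qed
    then show "v = w" using cpos(1)[of v] cpos(1)[of w] b by metis
  qed
  ultimately have "card (?S - ?F) \<le> card ?F"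
    by (intro card_inj_on_le[OF _ _ finF])
  moreover have "card ?S = card (?S - ?F) + card ?F"
  proof -
    have "card ((?S - ?F) \<union> ?F) = card (?S - ?F) + card ?F"
      by (rule card_Un_disjoint) (use finS finF in auto)
    moreover have "(?S - ?F) \<union> ?F = ?S" by blast
    ultimately show ?thesis by simp
  qed
  ultimately have S: "card ?S \<le> 2 * card ?F" by simp
  have "h ` cuts \<subseteq> ?S"
    using cyc_step by (auto simp: cuts_def long_def in_Omega_h)
  then have "card (h ` cuts) \<le> card ?S" by (rule card_mono[OF finS])
  then have "card cuts \<le> card ?S" by (simp add: card_image inj_on_subset[OF inj_h])
  then have "card cuts * l \<le> 2 * card ?F * l" using S by (intro mult_le_mono1) simp
  also have "\<dots> = 2 * (card ?F * l)" by simp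
  also have "\<dots> \<le> 2 * card long" using F by (intro mult_le_mono2)
  finally show ?thesis by (simp only: mult.commute)
qed

end

subsection \<open>Colourings with small orbits\<close>


lemma card_PiE_constrained:
  assumes "finite A" "W \<subseteq> A" "finite B" "Z \<subseteq> B"
  shows "card {c \<in> A \<rightarrow>\<^sub>E B. \<forall>w\<in>W. c w \<in> Z} = card Z ^ card W * card B ^ (card A - card W)"
proof -
  have "c \<in> A \<rightarrow>\<^sub>E B \<and> (\<forall>w\<in>W. c w \<in> Z) \<longleftrightarrow> c \<in> PiE A (\<lambda>w. if w \<in> W then Z else B)"
    (is "?L \<longleftrightarrow> ?R") for c
  proof
    assume ?L then show ?R by (simp add: PiE_iff)
  next
    assume R: ?R
    have "c w \<in> Z" if "w \<in> W" for w
      using PiE_mem[OF R, of w] assms(2) that by auto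
    moreover have "c w \<in> B" if "w \<in> A" for w
      using PiE_mem[OF R, of w] assms(4) that by (auto split: if_splits)
    ultimately show ?L using R by (simp add: PiE_iff)
  qed
  then have "{c \<in> A \<rightarrow>\<^sub>E B. \<forall>w\<in>W. c w \<in> Z} = PiE A (\<lambda>w. if w \<in> W then Z else B)"
    by blast
  then have "card {c \<in> A \<rightarrow>\<^sub>E B. \<forall>w\<in>W. c w \<in> Z} = (\<Prod>w\<in>A. card (if w \<in> W then Z else B))"
    by (simp add: card_PiE assms(1))
  also have "\<dots> = (\<Prod>w\<in>W. card Z) * (\<Prod>w\<in>A - W. card B)"
    by (subst prod.subset_diff[OF assms(2,1)]) (simp add: mult.commute)
  also have "\<dots> = card Z ^ card W * card B ^ (card A - card W)"
    using assms(1,2) by (simp add: card_Diff_subset finite_subset)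
  finally show ?thesis .
qed

lemma card_PiE_constrained_real:
  assumes "finite A" "W \<subseteq> A" "finite B" "Z \<subseteq> B" "0 < card B"
  shows "real (card {c \<in> A \<rightarrow>\<^sub>E B. \<forall>w\<in>W. c w \<in> Z}) =
    real (card B) ^ card A * (real (card Z) / real (card B)) ^ card W"
proof -
  have "card W \<le> card A" using assms(1,2) by (rule card_mono)
  then have "real (card B) ^ (card A - card W) = real (card B) ^ card A / real (card B) ^ card W"
    using assms(5) by (simp add: power_diff)
  then show ?thesis using card_PiE_constrained[OF assms(1-4)] by (simp add: power_divide)
qed

context perm_group begin

text \<open>
  All the groups \<open>Nc \<chi> T\<close> are normal in the stabiliser \<open>Nc \<chi> {..<s}\<close> of a colouring with colours below \<open>s\<close>.
\<close>

definition Nc :: "(nat \<Rightarrow> nat) \<Rightarrow> nat set \<Rightarrow> (nat \<Rightarrow> nat) set" where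
  "Nc \<chi> T = {g \<in> H. (\<forall>u. \<chi> (g u) = \<chi> u) \<and> (\<forall>u\<in>\<Omega>. \<chi> u \<notin> T \<longrightarrow> g u = u)}"

lemma Nc_H: "g \<in> Nc \<chi> T \<Longrightarrow> g \<in> H" by (simp add: Nc_def)

lemma Nc_colour: "g \<in> Nc \<chi> T \<Longrightarrow> \<chi> (g u) = \<chi> u" by (simp add: Nc_def)

lemma Nc_fix: "g \<in> Nc \<chi> T \<Longrightarrow> \<chi> u \<notin> T \<Longrightarrow> g u = u"
  using permutes_not_in[OF permutes[OF Nc_H], of g \<chi> T u] by (cases "u \<in> \<Omega>") (simp_all add: Nc_def)

lemma Nc_group: "perm_group \<Omega> (Nc \<chi> T)"
proof
  fix g h assume g: "g \<in> Nc \<chi> T" and h: "h \<in> Nc \<chi> T"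
  show "g \<circ> h \<in> Nc \<chi> T" using g h comp_in by (auto simp: Nc_def)
next
  fix h assume h: "h \<in> Nc \<chi> T"
  have "\<chi> (inv' h u) = \<chi> u" for u
    using Nc_colour[OF h, of "inv' h u"] f_inv[OF Nc_H[OF h]] by simp
  moreover have "inv' h u = u" if "\<chi> u \<notin> T" for u
    using Nc_fix[OF h that] inv_f[OF Nc_H[OF h], of u] by simp
  ultimately show "inv' h \<in> Nc \<chi> T" using inv_in[OF Nc_H[OF h]] by (simp add: Nc_def)
next
  show "finite \<Omega>" by (rule fin)
  show "id \<in> Nc \<chi> T" by (simp add: Nc_def id_in)
  show "\<And>h. h \<in> Nc \<chi> T \<Longrightarrow> h permutes \<Omega>" by (rule permutes[OF Nc_H])
qed

lemma Nc_mono: "T \<subseteq> T' \<Longrightarrow> Nc \<chi> T \<subseteq> Nc \<chi> T'"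
  by (auto simp: Nc_def)

text \<open>At a good point every set of colours whose group has a large orbit has more than
  \<open>z\<close> members. This applies to \<open>link\<close>, so a random set \<open>B\<close> of
  colours most likely meets it.\<close>

definition good :: "nat \<Rightarrow> nat \<Rightarrow> nat \<Rightarrow> (nat \<Rightarrow> nat) \<Rightarrow> nat \<Rightarrow> bool" where
  "good s z L \<chi> x \<longleftrightarrow> (\<forall>Z. Z \<subseteq> {..<s} \<longrightarrow> card Z \<le> z \<longrightarrow> card (orb (Nc \<chi> Z) x) \<le> L)"

definition min_deg :: "nat \<Rightarrow> bool" where
  "min_deg m \<longleftrightarrow> (\<forall>h\<in>H. h \<noteq> id \<longrightarrow> m \<le> card (perm_supp h))"

text \<open>A union bound over the sets \<open>Z\<close> of \<open>z\<close> colours. An orbit with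
  more than \<open>Suc (l * a)\<close> points leaves the trap \<open>insert x Y\<close>, so by
  \<open>escaping_element_trap\<close> either all of \<open>Y\<close> or a third of the support of
  some \<open>F y\<close> has colours in \<open>Z\<close>. As the fibres of \<open>r\<close> have at
  most \<open>l\<close> points and supports at least \<open>m\<close>, either event forces the
  colours of at least \<open>a\<close> values of \<open>r\<close> into \<open>Z\<close>, which has
  probability at most \<open>(z / s) ^ a\<close>.\<close>

lemma card_bad_colourings:
  assumes md: "min_deg m" and x: "x \<in> \<Omega>"
    and r: "\<And>u. u \<in> \<Omega> \<Longrightarrow> r u \<in> \<Omega>" and l: "0 < l" and a: "0 < a"
    and fib: "\<And>Y. finite Y \<Longrightarrow> card Y \<le> l * card (r ` Y)"
    and z: "z \<le> s" "0 < z" and m: "3 * l * a \<le> m"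
    and \<kappa>: "8 ^ l * real z / real s \<le> 1"
  shows "real (card {c \<in> r ` \<Omega> \<rightarrow>\<^sub>E {..<s}. \<not> good s z (Suc (l * a)) (restrict (c \<circ> r) \<Omega>) x})
    \<le> real s ^ card (r ` \<Omega>) * (real s ^ z * real (Suc (l * a)) * (8 ^ l * real z / real s) ^ a)"
proof -
  define \<kappa> where "\<kappa> = 8 ^ l * real z / real s"
  define R where "R = r ` \<Omega>"
  define C where "C = R \<rightarrow>\<^sub>E {..<s}"
  have s: "0 < s" using z by simp
  have finR: "finite R" using fin by (simp add: R_def)
  have finC: "finite C" by (simp add: C_def finite_PiE finR)
  have "real z * 1 \<le> real z * 8 ^ l" by (intro mult_left_mono one_le_power) auto
  then have zs: "real z / real s \<le> \<kappa>" "0 \<le> real z / real s" "0 \<le> \<kappa>" "\<kappa> \<le> 1"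
    using \<kappa> by (simp_all add: \<kappa>_def divide_right_mono mult.commute)
  obtain Y F where Y: "finite Y" "x \<notin> Y" "card Y = l * a \<or> card Y \<le> l * a \<and> orb H x \<subseteq> insert x Y"
    and F: "\<And>y. y \<in> Y \<Longrightarrow> F y \<in> H \<and> F y \<noteq> id"
    and FR: "\<And>y g Q. y \<in> Y \<Longrightarrow> g \<in> H \<Longrightarrow> (\<forall>u. u \<notin> Q \<longrightarrow> g u = u) \<Longrightarrow> g x \<notin> insert x Y \<Longrightarrow>
          y \<in> Q \<or> card (perm_supp (F y)) \<le> 3 * card (perm_supp (F y) \<inter> Q)"
    using escaping_element_trap[of x "l * a"] by metis
  define \<Z> where "\<Z> = {Z. Z \<subseteq> {..<s} \<and> card Z = z}"
  define \<W> where "\<W> y = {W. W \<subseteq> r ` perm_supp (F y) \<and> card (perm_supp (F y)) \<le> 3 * l * card W}" for y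
  define E where "E W Z = {c \<in> C. \<forall>w\<in>W. c w \<in> Z}" for W Z
  define G where "G Z = (if card Y = l * a \<and> Y \<subseteq> \<Omega> then E (r ` Y) Z else {})" for Z
  define U where "U Z = (\<Union>y\<in>Y. \<Union>W\<in>\<W> y. E W Z)" for Z
  have finW: "finite (\<W> y)" if "y \<in> Y" for y
    using finite_supp[of "F y"] F[OF that] by (auto simp: \<W>_def)
  have finZ: "finite \<Z>" by (simp add: \<Z>_def)
  have finE: "finite (E W Z)" for W Z using finC by (simp add: E_def)
  have sub: "{c \<in> C. \<not> good s z (Suc (l * a)) (restrict (c \<circ> r) \<Omega>) x}
    \<subseteq> (\<Union>Z\<in>\<Z>. G Z \<union> U Z)"
  proof
    fix c assume "c \<in> {c \<in> C. \<not> good s z (Suc (l * a)) (restrict (c \<circ> r) \<Omega>) x}"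
    then have c: "c \<in> C" and bad: "\<not> good s z (Suc (l * a)) (restrict (c \<circ> r) \<Omega>) x" by auto
    define \<chi> where "\<chi> = restrict (c \<circ> r) \<Omega>"
    obtain Z0 where Z0: "Z0 \<subseteq> {..<s}" "card Z0 \<le> z" "Suc (l * a) < card (orb (Nc \<chi> Z0) x)"
      using bad by (auto simp: good_def \<chi>_def)
    \<comment> \<open>Enlarging \<open>Z0\<close> to exactly \<open>z\<close> colours only enlarges
      its group, and it lets one probability serve for all sets.\<close>
    obtain Z where Z: "Z0 \<subseteq> Z" "Z \<subseteq> {..<s}" "card Z = z"
      using exists_subset_between[of Z0 z "{..<s}"] Z0 z by auto
    then have Z\<Z>: "Z \<in> \<Z>" by (simp add: \<Z>_def)
    have "card Y \<le> l * a" using Y(3) by auto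
    then have "card (insert x Y) < card (orb (Nc \<chi> Z0) x)" using Z0(3) Y(1,2) by simp
    then have "\<not> orb (Nc \<chi> Z0) x \<subseteq> insert x Y"
      using card_mono[of "insert x Y" "orb (Nc \<chi> Z0) x"] Y(1) by auto
    then obtain g where g: "g \<in> Nc \<chi> Z0" "g x \<notin> insert x Y" by (auto simp: orb_def)
    then have gZ: "g \<in> Nc \<chi> Z" using Nc_mono[OF Z(1)] by blast
    define Q where "Q = {u \<in> \<Omega>. \<chi> u \<in> Z}"
    have gQ: "\<forall>u. u \<notin> Q \<longrightarrow> g u = u"
      using Nc_fix[OF gZ] permutes[OF Nc_H[OF gZ]] permutes_not_in by (auto simp: Q_def)
    have "\<not> orb H x \<subseteq> insert x Y" using g Nc_H[OF gZ] by (auto simp: orb_def)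
    then have cY: "card Y = l * a" using Y(3) by blast
    show "c \<in> (\<Union>Z\<in>\<Z>. G Z \<union> U Z)"
    proof (cases "Y \<subseteq> Q")
      case True
      then have "Y \<subseteq> \<Omega>" by (auto simp: Q_def)
      moreover have "c \<in> E (r ` Y) Z" using c True by (auto simp: E_def Q_def \<chi>_def)
      ultimately have "c \<in> G Z" using cY by (simp add: G_def)
      then show ?thesis using Z\<Z> by blast
    next
      case False
      then obtain y where y: "y \<in> Y" "y \<notin> Q" by blast
      let ?S = "perm_supp (F y)"
      have S: "card ?S \<le> 3 * card (?S \<inter> Q)" using FR[OF y(1) Nc_H[OF gZ] gQ g(2)] y(2) by blast
      have "card (?S \<inter> Q) \<le> l * card (r ` (?S \<inter> Q))"
        using fib finite_supp F[OF y(1)] by blast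
      then have "card ?S \<le> 3 * (l * card (r ` (?S \<inter> Q)))" using S by linarith
      then have "r ` (?S \<inter> Q) \<in> \<W> y" by (auto simp: \<W>_def)
      moreover have "c \<in> E (r ` (?S \<inter> Q)) Z" using c by (auto simp: E_def Q_def \<chi>_def)
      ultimately have "c \<in> U Z" using y(1) by (auto simp: U_def)
      then show ?thesis using Z\<Z> by blast
    qed
  qed
  have cE: "real (card (E W Z)) = real s ^ card R * (real z / real s) ^ card W"
    if "Z \<in> \<Z>" "W \<subseteq> R" for W Z
    using card_PiE_constrained_real[OF finR that(2), of "{..<s}" Z] that(1) s
    by (simp add: E_def C_def \<Z>_def)
  have first: "real (card (G Z)) \<le> real s ^ card R * \<kappa> ^ a"
    if Z: "Z \<in> \<Z>" for Z
  proof (cases "card Y = l * a \<and> Y \<subseteq> \<Omega>")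
    case True
    then have "l * a \<le> l * card (r ` Y)" using fib[OF Y(1)] by simp
    then have a': "a \<le> card (r ` Y)" using l by simp
    have "(real z / real s) ^ card (r ` Y) \<le> \<kappa> ^ card (r ` Y)" using zs by (intro power_mono)
    also have "\<dots> \<le> \<kappa> ^ a" using zs a' by (intro power_decreasing)
    finally have "real s ^ card R * (real z / real s) ^ card (r ` Y) \<le> real s ^ card R * \<kappa> ^ a"
      by (intro mult_left_mono) auto
    moreover have "r ` Y \<subseteq> R" using True by (auto simp: R_def)
    ultimately show ?thesis using True cE[OF Z, of "r ` Y"] by (simp add: G_def)
  next
    case False
    then show ?thesis using zs by (auto simp: G_def)
  qed
  have second: "(\<Sum>W\<in>\<W> y. real (card (E W Z))) \<le> real s ^ card R * \<kappa> ^ a"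
    if Z: "Z \<in> \<Z>" and y: "y \<in> Y" for Z y
  proof -
    let ?S = "perm_supp (F y)"
    have finS: "finite ?S" using finite_supp F[OF y] by blast
    have mS: "m \<le> card ?S" using md F[OF y] by (auto simp: min_deg_def)
    have each: "real (card (E W Z)) \<le> real s ^ card R * \<kappa> ^ a / 2 ^ card ?S" if W: "W \<in> \<W> y" for W
    proof -
      have W': "W \<subseteq> R" using W supp_subset F[OF y] by (fastforce simp: \<W>_def R_def)
      have cW: "card ?S \<le> 3 * l * card W" using W by (simp add: \<W>_def)
      then have "3 * l * a \<le> 3 * l * card W" using m mS by linarith
      then have aW: "a \<le> card W" using l by simp
      \<comment> \<open>The union bound has up to \<open>2 ^ card ?S\<close> choices of
        \<open>W\<close>. Since \<open>card ?S\<close> is at most \<open>3 * l * card W\<close>, a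
        factor \<open>8 ^ l\<close> for each point of \<open>W\<close> pays for them; this is the
        origin of \<kappa>.\<close>
      have "(2::real) ^ card ?S \<le> 2 ^ (3 * l * card W)" by (rule power_increasing[OF cW]) simp
      also have "\<dots> = ((2 ^ 3) ^ l) ^ card W" by (simp only: power_mult)
      also have "\<dots> = (8 ^ l) ^ card W" by simp
      finally have two: "(2::real) ^ card ?S \<le> (8 ^ l) ^ card W" .
      have "2 ^ card ?S * (real z / real s) ^ card W \<le> (8 ^ l) ^ card W * (real z / real s) ^ card W"
        by (rule mult_right_mono[OF two]) simp
      also have "\<dots> = \<kappa> ^ card W" by (simp add: \<kappa>_def power_mult_distrib power_divide)
      also have "\<dots> \<le> \<kappa> ^ a" using zs aW by (intro power_decreasing)
      finally have "(real z / real s) ^ card W \<le> \<kappa> ^ a / 2 ^ card ?S"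
        by (simp add: pos_le_divide_eq mult.commute)
      then have "real s ^ card R * (real z / real s) ^ card W \<le> real s ^ card R * (\<kappa> ^ a / 2 ^ card ?S)"
        by (intro mult_left_mono) auto
      then show ?thesis using cE[OF Z W'] by simp
    qed
    have "\<W> y \<subseteq> Pow (r ` ?S)" by (auto simp: \<W>_def)
    then have "card (\<W> y) \<le> card (Pow (r ` ?S))" using finS by (intro card_mono) auto
    also have "\<dots> = 2 ^ card (r ` ?S)" using finS by (simp add: card_Pow)
    also have "\<dots> \<le> 2 ^ card ?S" by (intro power_increasing card_image_le finS) simp
    finally have "real (card (\<W> y)) \<le> real (2 ^ card ?S)" by (rule of_nat_mono)
    then have "real (card (\<W> y)) \<le> 2 ^ card ?S" by simp
    then have "real (card (\<W> y)) * (real s ^ card R * \<kappa> ^ a / 2 ^ card ?S)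
      \<le> 2 ^ card ?S * (real s ^ card R * \<kappa> ^ a / 2 ^ card ?S)"
      by (rule mult_right_mono) (use zs in simp)
    moreover have "(\<Sum>W\<in>\<W> y. real (card (E W Z))) \<le> real (card (\<W> y)) * (real s ^ card R * \<kappa> ^ a / 2 ^ card ?S)"
      by (rule sum_bounded_above) (rule each)
    ultimately show ?thesis by simp
  qed
  have Zsum: "real (card (G Z \<union> U Z))
    \<le> real (Suc (l * a)) * (real s ^ card R * \<kappa> ^ a)" if Z: "Z \<in> \<Z>" for Z
  proof -
    have "card (U Z) \<le> (\<Sum>y\<in>Y. card (\<Union>W\<in>\<W> y. E W Z))"
      using card_UN_le[OF Y(1), of "\<lambda>y. \<Union>W\<in>\<W> y. E W Z"] unfolding U_def .
    also have "\<dots> \<le> (\<Sum>y\<in>Y. \<Sum>W\<in>\<W> y. card (E W Z))"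
    proof (rule sum_mono)
      fix y assume "y \<in> Y"
      then show "card (\<Union>W\<in>\<W> y. E W Z) \<le> (\<Sum>W\<in>\<W> y. card (E W Z))"
        using card_UN_le[OF finW, of y "\<lambda>W. E W Z"] by simp
    qed
    finally have "real (card (U Z)) \<le> real (\<Sum>y\<in>Y. \<Sum>W\<in>\<W> y. card (E W Z))"
      by (rule of_nat_mono)
    also have "\<dots> = (\<Sum>y\<in>Y. \<Sum>W\<in>\<W> y. real (card (E W Z)))" by simp
    also have "\<dots> \<le> (\<Sum>y\<in>Y. real s ^ card R * \<kappa> ^ a)"
      by (intro sum_mono second Z)
    also have "\<dots> = real (card Y) * (real s ^ card R * \<kappa> ^ a)" by simp
    also have "\<dots> \<le> real (l * a) * (real s ^ card R * \<kappa> ^ a)"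
    proof (intro mult_right_mono)
      show "real (card Y) \<le> real (l * a)" using Y(3) by (intro of_nat_mono) auto
    qed (use zs in auto)
    finally have "real (card (U Z)) \<le> real (l * a) * (real s ^ card R * \<kappa> ^ a)" .
    moreover have "real (card (G Z \<union> U Z))
      \<le> real (card (G Z)) + real (card (U Z))"
      unfolding of_nat_add[symmetric] by (rule of_nat_mono[OF card_Un_le])
    ultimately have "real (card (G Z \<union> U Z)) \<le> 1 * (real s ^ card R * \<kappa> ^ a) + real (l * a) * (real s ^ card R * \<kappa> ^ a)"
      using first[OF Z] by linarith
    then show ?thesis unfolding distrib_right[symmetric] by simp
  qed
  have "card {c \<in> C. \<not> good s z (Suc (l * a)) (restrict (c \<circ> r) \<Omega>) x}
    \<le> card (\<Union>Z\<in>\<Z>. G Z \<union> U Z)"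
    by (rule card_mono[OF _ sub]) (use finZ finE Y(1) finW in \<open>auto simp: G_def U_def\<close>)
  also have "\<dots> \<le> (\<Sum>Z\<in>\<Z>. card (G Z \<union> U Z))"
    by (rule card_UN_le[OF finZ])
  finally have "real (card {c \<in> C. \<not> good s z (Suc (l * a)) (restrict (c \<circ> r) \<Omega>) x})
    \<le> (\<Sum>Z\<in>\<Z>. real (card (G Z \<union> U Z)))"
    unfolding of_nat_sum[symmetric] by (rule of_nat_mono)
  also have "\<dots> \<le> real (card \<Z>) * (real (Suc (l * a)) * (real s ^ card R * \<kappa> ^ a))"
    by (rule sum_bounded_above) (rule Zsum)
  also have "\<dots> \<le> real s ^ z * (real (Suc (l * a)) * (real s ^ card R * \<kappa> ^ a))"
  proof (rule mult_right_mono)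
    have "card \<Z> = s choose z" using n_subsets[of "{..<s}" z] by (simp add: \<Z>_def)
    also have "\<dots> \<le> s ^ z" by (rule binomial_le_pow[OF z(1)])
    finally show "real (card \<Z>) \<le> real s ^ z" unfolding of_nat_power[symmetric] by (rule of_nat_mono)
  qed (use zs in auto)
  finally show ?thesis by (simp add: C_def R_def \<kappa>_def ac_simps)
qed

end

subsection \<open>Coding the elements of a coset\<close>


context perm_group begin

lemma Nc_normal:
  assumes "k \<in> Nc \<chi> T'" "g \<in> Nc \<chi> T"
  shows "k \<circ> g \<circ> inv' k \<in> Nc \<chi> T"
proof -
  note k = Nc_H[OF assms(1)] and g = Nc_H[OF assms(2)]
  have c: "\<chi> (inv' k u) = \<chi> u" for u
    using Nc_colour[OF assms(1), of "inv' k u"] f_inv[OF k] by simp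
  have "k (g (inv' k u)) = u" if "\<chi> u \<notin> T" for u
    using Nc_fix[OF assms(2), of "inv' k u"] that c f_inv[OF k] by simp
  then show ?thesis
    using k g c Nc_colour[OF assms(1)] Nc_colour[OF assms(2)]
    by (simp add: Nc_def comp_in inv_in)
qed

lemma orb_Nc_image:
  assumes "k \<in> Nc \<chi> T'"
  shows "orb (Nc \<chi> T) (k u) = k ` orb (Nc \<chi> T) u"
proof
  note k = Nc_H[OF assms]
  interpret N': perm_group \<Omega> "Nc \<chi> T'" by (rule Nc_group)
  show "orb (Nc \<chi> T) (k u) \<subseteq> k ` orb (Nc \<chi> T) u"
  proof
    fix w assume "w \<in> orb (Nc \<chi> T) (k u)"
    then obtain g where g: "g \<in> Nc \<chi> T" "w = g (k u)" by (auto simp: orb_def)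
    have "inv' k \<circ> g \<circ> inv' (inv' k) \<in> Nc \<chi> T"
      by (rule Nc_normal[OF N'.inv_in[OF assms] g(1)])
    moreover have "inv' (inv' k) = k" using bij_H[OF k] by (rule inv_inv_eq)
    ultimately have "inv' k (g (k u)) \<in> orb (Nc \<chi> T) u"
      by (intro orbI[of "inv' k \<circ> g \<circ> k"]) auto
    then show "w \<in> k ` orb (Nc \<chi> T) u" using f_inv[OF k] g(2) by (metis imageI)
  qed
  show "k ` orb (Nc \<chi> T) u \<subseteq> orb (Nc \<chi> T) (k u)"
  proof
    fix w assume "w \<in> k ` orb (Nc \<chi> T) u"
    then obtain g where g: "g \<in> Nc \<chi> T" "w = k (g u)" by (auto simp: orb_def)
    then have "w = (k \<circ> g \<circ> inv' k) (k u)" using inv_f[OF k] by simp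
    then show "w \<in> orb (Nc \<chi> T) (k u)"
      by (rule orbI[OF Nc_normal[OF assms g(1)]])
  qed
qed

lemma card_orb_Nc:
  assumes "k \<in> Nc \<chi> T'"
  shows "card (orb (Nc \<chi> T) (k u)) = card (orb (Nc \<chi> T) u)"
  unfolding orb_Nc_image[OF assms]
  by (rule card_image) (simp add: inj_on_def inj_H[OF Nc_H[OF assms]])

end

text \<open>
  Here \<open>Om\<close> is the part of the support that the code omits and \<open>B\<close> is a random set of colours. For an
  active point \<open>u\<close> the set \<open>link u\<close> is a minimal set of colours whose group has a large orbit at \<open>u\<close>.
  The orbits for \<open>link u\<close> with one colour removed are small, and \<open>star u\<close> collects the few images of \<open>u\<close>
  which lie in one of them. The code lists the values of \<open>h\<close> at the few rough points where \<open>h u\<close> is outside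
  \<open>star u\<close> (\<open>FX\<close>) and at those representatives of blocks of smooth points which \<open>h\<close> moves to a new orbit (\<open>Sig\<close>).
  Every other value is described by its rank in a small set \<open>cand h u\<close>.
\<close>

locale coset_code = perm_group \<Omega> H for \<Omega> H +
  fixes m s L l :: nat and \<chi> :: "nat \<Rightarrow> nat" and a :: "nat \<Rightarrow> nat" and Q :: "nat set"
    and \<A> :: "(nat \<Rightarrow> nat) set" and B :: "nat set" and rep :: "nat set \<Rightarrow> nat"
    and Om :: "(nat \<Rightarrow> nat) \<Rightarrow> nat set"
  assumes l_pos: "0 < l"
    and colours: "u \<in> \<Omega> \<Longrightarrow> \<chi> u < s"
    and a_H: "a \<in> H"
    and \<A>_coset: "h \<in> \<A> \<Longrightarrow> \<exists>g\<in>Nc \<chi> {..<s}. h = a \<circ> g"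
    and B_sub: "B \<subseteq> {..<s}"
    and rep_in: "D \<noteq> {} \<Longrightarrow> rep D \<in> D"
begin

abbreviation "K \<equiv> Nc \<chi> {..<s}"

sublocale K: perm_group \<Omega> K by (rule Nc_group)

lemma K_H: "g \<in> K \<Longrightarrow> g \<in> H" by (rule Nc_H)

lemma \<A>_H: "h \<in> \<A> \<Longrightarrow> h \<in> H"
  using \<A>_coset a_H K_H comp_in by blast

definition active :: "nat \<Rightarrow> bool" where "active u \<longleftrightarrow> L < card (orb K u)"

definition link :: "nat \<Rightarrow> nat set" where
  "link u = (SOME Z. Z \<subseteq> {..<s} \<and> L < card (orb (Nc \<chi> Z) u) \<and>
     (\<forall>i\<in>Z. card (orb (Nc \<chi> (Z - {i})) u) \<le> L))"

lemma link:
  assumes "active u"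
  shows "link u \<subseteq> {..<s}" "L < card (orb (Nc \<chi> (link u)) u)"
    "i \<in> link u \<Longrightarrow> card (orb (Nc \<chi> (link u - {i})) u) \<le> L"
proof -
  let ?P = "\<lambda>Z. Z \<subseteq> {..<s} \<and> L < card (orb (Nc \<chi> Z) u)"
  obtain Z where Z: "?P Z" and min: "\<And>Z'. ?P Z' \<Longrightarrow> card Z \<le> card Z'"
    using ex_has_least_nat[of ?P "{..<s}" card] assms by (auto simp: active_def)
  have "card (orb (Nc \<chi> (Z - {i})) u) \<le> L" if "i \<in> Z" for i
  proof (rule ccontr)
    assume "\<not> card (orb (Nc \<chi> (Z - {i})) u) \<le> L"
    then have "card Z \<le> card (Z - {i})" using Z by (intro min) auto
    moreover have "finite Z" using Z finite_subset by blast
    ultimately show False using that by (metis card_Diff1_less not_less)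
  qed
  then have "\<exists>Z. Z \<subseteq> {..<s} \<and> L < card (orb (Nc \<chi> Z) u) \<and>
     (\<forall>i\<in>Z. card (orb (Nc \<chi> (Z - {i})) u) \<le> L)" using Z by blast
  then have "link u \<subseteq> {..<s} \<and> L < card (orb (Nc \<chi> (link u)) u) \<and>
     (\<forall>i\<in>link u. card (orb (Nc \<chi> (link u - {i})) u) \<le> L)"
    unfolding link_def by (rule someI_ex)
  then show "link u \<subseteq> {..<s}" "L < card (orb (Nc \<chi> (link u)) u)"
    "i \<in> link u \<Longrightarrow> card (orb (Nc \<chi> (link u - {i})) u) \<le> L" by blast+
qed

lemma active_K: "k \<in> K \<Longrightarrow> active (k u) = active u"
  by (simp add: active_def card_orb_Nc)

text \<open>The condition inside the choice speaks of orbit sizes only, and these are constant along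
  a \<open>K\<close>-orbit; so the chosen set is literally the same.\<close>

lemma link_K: "k \<in> K \<Longrightarrow> link (k u) = link u"
  by (simp add: link_def card_orb_Nc)

lemma Nc_link_K: "active u \<Longrightarrow> T \<subseteq> link u \<Longrightarrow> g \<in> Nc \<chi> T \<Longrightarrow> g \<in> K"
  using link(1) Nc_mono by blast

text \<open>The point \<open>u\<close> is added so that every point with \<open>h u\<close> outside
  \<open>star u\<close> is moved by \<open>h\<close>; see \<open>Y_supp\<close>.\<close>

definition star :: "nat \<Rightarrow> nat set" where
  "star u = insert u (\<Union>i\<in>link u. a ` orb K u \<inter> a ` orb (Nc \<chi> (link u - {i})) (inv' a u))"

lemma finite_orb_Nc: "finite (orb (Nc \<chi> T) u)"
  using perm_group.finite_orb[OF Nc_group] .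

text \<open>The orbit of \<open>inv' a u\<close> is known to be small only if
  \<open>inv' a u\<close> lies in \<open>orb K u\<close>. Otherwise its translate is disjoint from
  that of \<open>orb K u\<close> and contributes nothing to \<open>star u\<close>.\<close>

lemma card_star: "active u \<Longrightarrow> card (star u) \<le> Suc (s * L)" "active u \<Longrightarrow> finite (star u)"
proof -
  assume u: "active u"
  have fl: "finite (link u)" and cl: "card (link u) \<le> s"
    using link(1)[OF u] finite_subset[of _ "{..<s}"] card_mono[of "{..<s}"] by auto
  let ?S = "\<lambda>i. a ` orb K u \<inter> a ` orb (Nc \<chi> (link u - {i})) (inv' a u)"
  show fin_star: "finite (star u)"
    using fl by (auto simp: star_def K.finite_orb)
  have each: "card (?S i) \<le> L" if i: "i \<in> link u" for i
  proof (cases "?S i = {}")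
    case False
    then obtain w where w: "w \<in> orb K u" "w \<in> orb (Nc \<chi> (link u - {i})) (inv' a u)"
      using inj_H[OF a_H] by (auto simp: image_iff)
    interpret N: perm_group \<Omega> "Nc \<chi> (link u - {i})" by (rule Nc_group)
    have "inv' a u \<in> orb (Nc \<chi> (link u - {i})) w" using w(2) by (rule N.orb_sym)
    moreover have "orb (Nc \<chi> (link u - {i})) w \<subseteq> orb K w"
      using Nc_link_K[OF u] by (intro orb_mono) blast
    ultimately have "inv' a u \<in> orb K w" by blast
    then have "inv' a u \<in> orb K u" using w(1) K.orb_eq by metis
    then obtain k where "k \<in> K" "inv' a u = k u" by (rule orbE)
    then have "card (orb (Nc \<chi> (link u - {i})) (inv' a u)) \<le> L"
      using link(3)[OF u i] card_orb_Nc by simp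
    then have "card (a ` orb (Nc \<chi> (link u - {i})) (inv' a u)) \<le> L"
      using card_image_le[OF finite_orb_Nc] le_trans by blast
    then show ?thesis
      by (meson card_mono finite_imageI finite_orb_Nc inf_le2 le_trans)
  qed simp
  have "card (star u) \<le> Suc (card (\<Union>i\<in>link u. ?S i))"
    unfolding star_def by (rule card_insert_le_m1) simp_all
  also have "card (\<Union>i\<in>link u. ?S i) \<le> (\<Sum>i\<in>link u. card (?S i))"
    using card_UN_le[OF fl, of ?S] .
  also have "\<dots> \<le> card (link u) * L" using sum_bounded_above[of "link u" "\<lambda>i. card (?S i)" L] each by simp
  also have "\<dots> \<le> s * L" using cl by simp
  finally show "card (star u) \<le> Suc (s * L)" by simp
qed

text \<open>Active points with colours in \<open>B\<close> count as rough even if their link meets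
  \<open>B\<close>: their values have to be decoded before the rule for smooth points, which relies
  on agreement on \<open>B\<close>, is available.\<close>

definition rough :: "nat \<Rightarrow> bool" where
  "rough u \<longleftrightarrow> active u \<and> (\<chi> u \<in> B \<or> link u \<inter> B = {})"

definition smooth :: "nat \<Rightarrow> bool" where
  "smooth u \<longleftrightarrow> active u \<and> \<chi> u \<notin> B \<and> link u \<inter> B \<noteq> {}"

definition guide :: "nat \<Rightarrow> nat" where "guide u = (SOME i. i \<in> link u \<inter> B)"

lemma guide: "smooth u \<Longrightarrow> guide u \<in> link u" "smooth u \<Longrightarrow> guide u \<in> B"
proof -
  assume "smooth u"
  then have "\<exists>i. i \<in> link u \<inter> B" by (auto simp: smooth_def)
  then have "guide u \<in> link u \<inter> B" unfolding guide_def by (rule someI_ex)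
  then show "guide u \<in> link u" "guide u \<in> B" by auto
qed

lemma smooth_K: "k \<in> K \<Longrightarrow> smooth (k u) = smooth u"
  by (simp add: smooth_def active_K link_K Nc_colour)

lemma guide_K: "k \<in> K \<Longrightarrow> guide (k u) = guide u"
  by (simp add: guide_def link_K)

abbreviation "NE u \<equiv> Nc \<chi> (link u - {guide u})"
abbreviation "block u \<equiv> orb (Nc \<chi> (link u)) u"

text \<open>The translates under \<open>a\<close> of the orbits of \<open>NE u\<close> partition the
  points. A smooth \<open>u\<close> belongs to \<open>Mv h\<close> if \<open>h u\<close> and
  \<open>u\<close> lie in different parts, so points fixed by \<open>h\<close> never belong to
  it.\<close>

definition Mv :: "(nat \<Rightarrow> nat) \<Rightarrow> nat set" where
  "Mv h = {u \<in> \<Omega>. smooth u \<and> inv' a (h u) \<notin> orb (NE u) (inv' a u)}"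

text \<open>This set depends neither on \<open>B\<close> nor on \<open>rep\<close>. Hence
  \<open>B\<close> can be chosen at random afterwards so that the rough points are a small part of
  it.\<close>

definition X :: "(nat \<Rightarrow> nat) \<Rightarrow> nat set" where
  "X h = {u \<in> \<Omega>. active u \<and> h u \<notin> star u}"

definition FX :: "(nat \<Rightarrow> nat) \<Rightarrow> nat set" where
  "FX h = {u \<in> X h. rough u}"

definition Sig :: "(nat \<Rightarrow> nat) \<Rightarrow> nat set" where
  "Sig h = {u \<in> Mv h. u = rep (block u)}"

definition Y :: "(nat \<Rightarrow> nat) \<Rightarrow> nat set" where "Y h = Mv h \<union> FX h"

text \<open>The bounds for \<open>FX h\<close> and \<open>Sig h\<close> are relative to
  \<open>X h\<close> and \<open>Mv h\<close>. This inclusion makes both relative to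
  \<open>Y h\<close>, whose cycles pay for the explicit values.\<close>

lemma X_subset_Y: "h \<in> \<A> \<Longrightarrow> X h \<subseteq> Y h"
proof
  fix u assume h: "h \<in> \<A>" and u: "u \<in> X h"
  show "u \<in> Y h"
  proof (cases "rough u")
    case True
    then show ?thesis using u by (simp add: Y_def FX_def)
  next
    case False
    then have sm: "smooth u" using u by (auto simp: X_def rough_def smooth_def)
    obtain g where g: "g \<in> K" "h = a \<circ> g" using \<A>_coset[OF h] by blast
    have hu: "h u \<in> a ` orb K u" using orbI[OF g(1) refl, of u] g(2) by simp
    have "inv' a (h u) \<notin> orb (NE u) (inv' a u)"
    proof
      assume "inv' a (h u) \<in> orb (NE u) (inv' a u)"
      then have "a (inv' a (h u)) \<in> a ` orb (NE u) (inv' a u)" by blast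
      then have "h u \<in> star u" using hu guide(1)[OF sm] f_inv[OF a_H] by (auto simp: star_def)
      then show False using u by (simp add: X_def)
    qed
    then show ?thesis using u sm by (simp add: Y_def Mv_def X_def)
  qed
qed

lemma Y_supp: "h \<in> \<A> \<Longrightarrow> Y h \<subseteq> perm_supp h"
proof
  fix u assume h: "h \<in> \<A>" and u: "u \<in> Y h"
  have "h u \<noteq> u"
  proof
    assume hu: "h u = u"
    interpret N: perm_group \<Omega> "NE u" by (rule Nc_group)
    have "u \<notin> Mv h" using hu N.orb_self by (simp add: Mv_def)
    moreover have "u \<notin> FX h" using hu by (simp add: FX_def X_def star_def)
    ultimately show False using u by (simp add: Y_def)
  qed
  then show "u \<in> perm_supp h" by (simp add: perm_supp_def)
qed

text \<open>The decoder must know this set before it knows \<open>h u\<close>. At a smooth point the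
  set depends on \<open>h\<close> only through the small orbit of \<open>inv' a (h u)\<close>, which
  the code determines by \<open>classes_agree\<close>.\<close>

definition cand :: "(nat \<Rightarrow> nat) \<Rightarrow> nat \<Rightarrow> nat set" where
  "cand h u = (if \<not> active u then a ` orb K u
     else if rough u then star u else a ` orb (NE u) (inv' a (h u)))"

definition symb :: "(nat \<Rightarrow> nat) \<Rightarrow> nat \<Rightarrow> nat" where
  "symb h u = card {v \<in> cand h u. v < h u}"

lemma finite_cand: "finite (cand h u)"
  using card_star(2)[of u] finite_orb_Nc by (auto simp: cand_def rough_def)

lemma card_cand:
  assumes "h \<in> \<A>" "0 < s" shows "card (cand h u) \<le> Suc (s * L)"
proof (cases "active u")
  case False
  have "card (a ` orb K u) \<le> card (orb K u)" using K.finite_orb by (rule card_image_le)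
  also have "\<dots> \<le> L" using False by (simp add: active_def)
  also have "L \<le> Suc (s * L)" using assms(2) by (cases s) auto
  finally show ?thesis using False by (simp add: cand_def)
next
  case act: True
  show ?thesis
  proof (cases "rough u")
    case True
    then show ?thesis using card_star(1)[OF act] act by (simp add: cand_def)
  next
    case False
    then have sm: "smooth u" using act by (auto simp: rough_def smooth_def)
    obtain g where g: "g \<in> K" "h = a \<circ> g" using \<A>_coset[OF assms(1)] by blast
    then have gu: "inv' a (h u) = g u" using inv_f[OF a_H] by simp
    have "card (a ` orb (NE u) (g u)) \<le> card (orb (NE u) (g u))"
      using finite_orb_Nc by (rule card_image_le)
    also have "\<dots> \<le> L" using card_orb_Nc[OF g(1)] link(3)[OF act guide(1)[OF sm]] by simp
    also have "L \<le> Suc (s * L)" using assms(2) by (cases s) auto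
    finally show ?thesis using False act gu by (simp add: cand_def)
  qed
qed

lemma symb_le: "h \<in> \<A> \<Longrightarrow> 0 < s \<Longrightarrow> symb h u \<le> Suc (s * L)"
  unfolding symb_def by (rule le_trans[OF card_mono[OF finite_cand] card_cand]) auto

lemma rank_inj:
  fixes x y :: nat
  assumes "finite S" "x \<in> S" "y \<in> S" "card {v \<in> S. v < x} = card {v \<in> S. v < y}"
  shows "x = y"
proof (rule ccontr)
  have *: "card {v \<in> S. v < x} < card {v \<in> S. v < y}" if "x < y" "x \<in> S" for x y
  proof (rule psubset_card_mono)
    show "finite {v \<in> S. v < y}" using assms(1) by simp
    show "{v \<in> S. v < x} \<subset> {v \<in> S. v < y}" using that by force
  qed
  assume "x \<noteq> y"
  then show False using *[of x y] *[of y x] assms by (metis linorder_neqE_nat less_irrefl)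
qed

end

text \<open>
  Two elements with the same code differ only on the omitted parts, that is on fewer than \<open>m\<close> points.
\<close>

locale coset_code_inj = coset_code +
  assumes md: "min_deg m"
    and cuts: "h \<in> \<A> \<Longrightarrow> cut_perm.cuts \<Omega> h l = Q"
    and on_Q: "h \<in> \<A> \<Longrightarrow> h' \<in> \<A> \<Longrightarrow> u \<in> Q \<Longrightarrow> h u = h' u"
    and seg_colour: "h \<in> \<A> \<Longrightarrow> u \<in> \<Omega> \<Longrightarrow> \<chi> (cut_perm.seg h l u) = \<chi> u"
    and Om_B: "h \<in> \<A> \<Longrightarrow> w \<in> Om h \<Longrightarrow> \<chi> w \<notin> B"
    and Om_small: "h \<in> \<A> \<Longrightarrow> 2 * card (Om h) < m"
    and Om_supp: "h \<in> \<A> \<Longrightarrow> Om h \<subseteq> perm_supp h"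
begin

lemma cut_perm: "h \<in> \<A> \<Longrightarrow> cut_perm \<Omega> h l"
  using fin permutes \<A>_H l_pos by unfold_locales auto

text \<open>Base points are stored only for cycles that offer no other start: long cycles are
  entered at images of cuts, and cycles that meet \<open>Y h\<close> at a point of
  \<open>Y h\<close>.\<close>

definition P :: "(nat \<Rightarrow> nat) \<Rightarrow> nat set" where
  "P h = {finite_perm.base h u | u. u \<in> perm_supp h \<and> card (cyc h u) \<le> l \<and> cyc h u \<inter> Y h = {} \<and> u \<notin> Om h}"

text \<open>All words have length \<open>l\<close>, also when the walk runs on past the end of its
  segment; so no lengths have to be recorded.\<close>

definition word :: "(nat \<Rightarrow> nat) \<Rightarrow> nat \<Rightarrow> nat list" where
  "word h v = map (\<lambda>b. symb h ((h ^^ b) v)) [0..<l]"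

text \<open>The lists carry no record of their starting points. For the first list these are
  recovered from the other components and from the common values on \<open>Q\<close>. The words at
  \<open>Mv h\<close> are kept apart because \<open>Mv h\<close> is recovered only in
  \<open>Mv_eq\<close>, after the colours in \<open>B\<close> have been decoded.\<close>

definition code :: "(nat \<Rightarrow> nat) \<Rightarrow> (nat \<times> nat) set \<times> nat set \<times> nat list list \<times> nat list list" where
  "code h = ((\<lambda>u. (u, h u)) ` (FX h \<union> Sig h), P h,
     map (word h) (sorted_list_of_set (P h \<union> FX h \<union> h ` Q)),
     map (word h) (sorted_list_of_set (Mv h)))"

lemma finite_Mv: "finite (Mv h)" using fin by (simp add: Mv_def)
lemma finite_FX: "finite (FX h)" using fin by (simp add: FX_def X_def)

lemma P_supp: "h \<in> \<A> \<Longrightarrow> P h \<subseteq> perm_supp h"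
proof
  fix x assume h: "h \<in> \<A>" and "x \<in> P h"
  then obtain u where u: "u \<in> perm_supp h" "x = finite_perm.base h u" by (auto simp: P_def)
  interpret c: cut_perm \<Omega> h l by (rule cut_perm[OF h])
  show "x \<in> perm_supp h" using u c.base_in c.cyc_supp by blast
qed

lemma Q_supp: "h \<in> \<A> \<Longrightarrow> Q \<subseteq> perm_supp h"
proof -
  assume h: "h \<in> \<A>"
  interpret c: cut_perm \<Omega> h l by (rule cut_perm[OF h])
  show ?thesis using cuts[OF h] c.cuts_subset c.long_supp by blast
qed

lemma hQ_supp: "h \<in> \<A> \<Longrightarrow> h ` Q \<subseteq> perm_supp h"
  using Q_supp inj_H[OF \<A>_H] by (fastforce simp: perm_supp_def)

lemma starts_supp: "h \<in> \<A> \<Longrightarrow> P h \<union> FX h \<union> h ` Q \<subseteq> perm_supp h"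
  using P_supp hQ_supp Y_supp by (auto simp: Y_def)

lemma rough_not_smooth: "rough u \<Longrightarrow> \<not> smooth u"
  by (auto simp: rough_def smooth_def)

text \<open>Symbols at the same place of two equal words refer to the same point only as long as the
  two walks coincide. Therefore the induction carries the equality of the walks along with that of
  the values.\<close>

lemma walk:
  assumes "word h v = word h' v" "b < l"
    and "\<And>b'. b' \<le> b \<Longrightarrow> symb h ((h ^^ b') v) = symb h' ((h ^^ b') v) \<Longrightarrow> h ((h ^^ b') v) = h' ((h ^^ b') v)"
  shows "(h ^^ b) v = (h' ^^ b) v \<and> h ((h ^^ b) v) = h' ((h ^^ b) v)"
  using assms(2,3)
proof (induction b)
  case 0
  have "word h v ! 0 = word h' v ! 0" using assms(1) by simp
  then have "symb h v = symb h' v" using 0 by (simp add: word_def)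
  then show ?case using 0(2)[of 0] by simp
next
  case (Suc b)
  then have IH: "(h ^^ b) v = (h' ^^ b) v" "h ((h ^^ b) v) = h' ((h ^^ b) v)" by auto
  then have eq: "(h ^^ Suc b) v = (h' ^^ Suc b) v" by simp
  have "word h v ! Suc b = word h' v ! Suc b" using assms(1) by simp
  then have "symb h ((h ^^ Suc b) v) = symb h' ((h' ^^ Suc b) v)"
    using Suc.prems(1) by (simp add: word_def del: funpow.simps)
  then show ?case using Suc.prems(2)[of "Suc b"] eq by simp
qed

lemma cand_mem: "h \<in> \<A> \<Longrightarrow> u \<in> \<Omega> \<Longrightarrow> u \<notin> FX h \<Longrightarrow> h u \<in> cand h u"
proof -
  assume h: "h \<in> \<A>" and u: "u \<in> \<Omega>" "u \<notin> FX h"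
  obtain g where g: "g \<in> K" "h = a \<circ> g" using \<A>_coset[OF h] by blast
  interpret N: perm_group \<Omega> "NE u" by (rule Nc_group)
  have "h u \<in> a ` orb K u" using orbI[OF g(1) refl, of u] g(2) by simp
  moreover have "h u \<in> a ` orb (NE u) (inv' a (h u))"
    using N.orb_self f_inv[OF a_H] by (metis imageI)
  ultimately show ?thesis using u by (auto simp: cand_def FX_def X_def)
qed

lemma sorted_map_eqD:
  assumes "map f (sorted_list_of_set A) = map g (sorted_list_of_set A)" "finite A" "x \<in> A"
  shows "f x = g x"
  using assms by (metis map_eq_conv set_sorted_list_of_set)

context
  fixes h h' assumes h: "h \<in> \<A>" and h': "h' \<in> \<A>" and code_eq: "code h = code h'"
begin

lemma FX_Sig_eq: "FX h \<union> Sig h = FX h' \<union> Sig h'" "u \<in> FX h \<union> Sig h \<Longrightarrow> h u = h' u"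
proof -
  have G: "(\<lambda>u. (u, h u)) ` (FX h \<union> Sig h) = (\<lambda>u. (u, h' u)) ` (FX h' \<union> Sig h')"
    using code_eq by (simp add: code_def)
  have "fst ` (\<lambda>u. (u, f u)) ` A = A" for f :: "nat \<Rightarrow> nat" and A by force
  then show "FX h \<union> Sig h = FX h' \<union> Sig h'" using G by metis
  assume "u \<in> FX h \<union> Sig h"
  then have "(u, h u) \<in> (\<lambda>u. (u, h' u)) ` (FX h' \<union> Sig h')" using G by blast
  then show "h u = h' u" by auto
qed

text \<open>The graph stores \<open>FX h\<close> and \<open>Sig h\<close> together; the predicate
  \<open>rough\<close>, which does not involve \<open>h\<close>, separates them again.\<close>

lemma FX_eq: "FX h = FX h'"
proof -
  have "FX f = (FX f \<union> Sig f) \<inter> {u. rough u}" for f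
    using rough_not_smooth by (auto simp: FX_def Sig_def Mv_def)
  then show ?thesis using FX_Sig_eq(1) by metis
qed

lemma key_general:
  assumes "u \<in> \<Omega>" "cand h u = cand h' u" "symb h u = symb h' u"
  shows "h u = h' u"
proof (cases "u \<in> FX h")
  case True
  then show ?thesis using FX_Sig_eq(2) by blast
next
  case False
  then have "h u \<in> cand h u" "h' u \<in> cand h u"
    using cand_mem[OF h assms(1)] cand_mem[OF h' assms(1)] FX_eq assms(2) by auto
  then show ?thesis
    using rank_inj[OF finite_cand] assms(2,3) by (simp add: symb_def)
qed

lemma key_not_smooth: "u \<in> \<Omega> \<Longrightarrow> \<not> smooth u \<Longrightarrow> symb h u = symb h' u \<Longrightarrow> h u = h' u"
  by (rule key_general) (auto simp: cand_def rough_def smooth_def)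

lemma words_eq:
  assumes "v \<in> P h \<union> FX h \<union> h ` Q" shows "word h v = word h' v"
proof -
  have "h ` Q = h' ` Q" using on_Q[OF h h'] by (auto simp: image_iff)
  moreover have "P h = P h'" using code_eq by (simp add: code_def)
  ultimately have "map (word h) (sorted_list_of_set (P h \<union> FX h \<union> h ` Q))
    = map (word h') (sorted_list_of_set (P h \<union> FX h \<union> h ` Q))"
    using code_eq FX_eq by (simp add: code_def)
  moreover have "finite (P h \<union> FX h \<union> h ` Q)"
    using starts_supp[OF h] finite_supp[OF \<A>_H[OF h]] finite_subset by blast
  ultimately show ?thesis using assms by (rule sorted_map_eqD)
qed

text \<open>First stage of the decoding. The walk to \<open>w\<close> stays in the colour of
  \<open>w\<close> and so meets no smooth point; neither the small orbits nor the words at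
  \<open>Mv h\<close> are needed. A start always exists, because a short cycle with a colour in
  \<open>B\<close> avoids \<open>Mv h\<close> and \<open>w\<close> is not omitted.\<close>

lemma agree_B:
  assumes w: "\<chi> w \<in> B" "w \<in> perm_supp h"
  shows "h w = h' w"
proof -
  interpret c: cut_perm \<Omega> h l by (rule cut_perm[OF h])
  have w\<Omega>: "w \<in> \<Omega>" using w(2) supp_subset[OF \<A>_H[OF h]] by blast
  have main: "h w = h' w" if v: "v \<in> P h \<union> FX h \<union> h ` Q" and b: "b < l" "(h ^^ b) v = w"
    and col: "\<And>b'. b' \<le> b \<Longrightarrow> \<chi> ((h ^^ b') v) = \<chi> w" for v b
  proof -
    have v\<Omega>: "v \<in> \<Omega>" using v starts_supp[OF h] supp_subset[OF \<A>_H[OF h]] by blast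
    have "(h ^^ b) v = (h' ^^ b) v \<and> h ((h ^^ b) v) = h' ((h ^^ b) v)"
    proof (rule walk[OF words_eq[OF v] b(1)])
      fix b' assume b': "b' \<le> b" "symb h ((h ^^ b') v) = symb h' ((h ^^ b') v)"
      have "(h ^^ b') v \<in> \<Omega>" using c.cyc_Omega[OF v\<Omega>] c.cyc_funpow by blast
      moreover have "\<not> smooth ((h ^^ b') v)" using col[OF b'(1)] w(1) by (simp add: smooth_def)
      ultimately show "h ((h ^^ b') v) = h' ((h ^^ b') v)" using b'(2) by (rule key_not_smooth)
    qed
    then show ?thesis unfolding b(2) by blast
  qed
  show ?thesis
  proof (cases "card (cyc h w) \<le> l")
    case True
    have col: "\<chi> u = \<chi> w" if "u \<in> cyc h w" for u
      using seg_colour[OF h, of u] seg_colour[OF h w\<Omega>] c.seg_short_cong[OF True that]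
        c.cyc_Omega[OF w\<Omega>] that by auto
    have col2: "\<chi> ((h ^^ b) v) = \<chi> w" if "v \<in> cyc h w" for v b
      using col c.cyc_eq[OF that] c.cyc_funpow[of b v] by blast
    show ?thesis
    proof (cases "cyc h w \<inter> FX h = {}")
      case False
      then obtain y where y: "y \<in> cyc h w" "y \<in> FX h" by blast
      have "w \<in> cyc h y" using c.cyc_eq[OF y(1)] c.cyc_self by simp
      then obtain b where b: "b < card (cyc h y)" "w = (h ^^ b) y" by (rule c.cyc_obtain)
      show ?thesis
      proof (rule main[of y b])
        show "b < l" using b(1) True c.cyc_eq[OF y(1)] by simp
        show "(h ^^ b) y = w" by (rule b(2)[symmetric])
        show "\<chi> ((h ^^ b') y) = \<chi> w" for b' by (rule col2[OF y(1)])
      qed (use y(2) in blast)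
    next
      case no: True
      have "cyc h w \<inter> Mv h = {}" using col w(1) by (auto simp: Mv_def smooth_def)
      then have "cyc h w \<inter> Y h = {}" using no by (auto simp: Y_def)
      moreover have "w \<notin> Om h" using Om_B[OF h] w(1) by blast
      ultimately have "c.base w \<in> P h" using w(2) True by (auto simp: P_def)
      moreover have "(h ^^ c.cpos w) (c.base w) = w" "c.cpos w < card (cyc h w)" by (rule c.cpos)+
      ultimately show ?thesis
        using True col2[OF c.base_in] by (intro main[of "c.base w" "c.cpos w"]) auto
    qed
  next
    case False
    then have "w \<in> c.long" using w\<Omega> by (simp add: c.long_def)
    then have "c.seg w \<in> h ` Q" using c.seg_long cuts[OF h] by simp
    moreover obtain b where b: "b < l" "(h ^^ b) (c.seg w) = w"
      "\<forall>b'\<le>b. c.seg ((h ^^ b') (c.seg w)) = c.seg w"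
      using c.seg_walk[of w] by blast
    moreover have "\<chi> ((h ^^ b') (c.seg w)) = \<chi> w" if "b' \<le> b" for b'
    proof -
      have "(h ^^ b') (c.seg w) \<in> \<Omega>"
        using c.cyc_Omega[OF w\<Omega>] c.cyc_seg[of w] c.cyc_funpow[of b' "c.seg w"] by blast
      then show ?thesis using seg_colour[OF h] b(3) that w\<Omega> by metis
    qed
    ultimately show ?thesis by (intro main[of "c.seg w" b]) auto
  qed
qed

end

lemma agree_B_all:
  assumes "h \<in> \<A>" "h' \<in> \<A>" "code h = code h'" "\<chi> w \<in> B"
  shows "h w = h' w"
proof (cases "w \<in> perm_supp h \<or> w \<in> perm_supp h'")
  case True
  then show ?thesis using agree_B[of h h' w] agree_B[of h' h w] assms by auto
next
  case False
  then show ?thesis by (simp add: perm_supp_def)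
qed

text \<open>
  The element \<open>e = h\<^sup>-\<^sup>1 h'\<close> fixes all points with colour in \<open>B\<close>, by the previous lemma. Hence its commutator with an element of the group of
  \<open>link u\<close> acts trivially on the colour \<open>guide u\<close>. So if \<open>e\<close> preserves the small orbit of the representative
  of the block of \<open>u\<close>, it preserves the small orbit of every point of that block.
\<close>

lemma classes_agree:
  assumes h: "h \<in> \<A>" and h': "h' \<in> \<A>" and ce: "code h = code h'" and u: "u \<in> \<Omega>" "smooth u"
  shows "orb (NE u) (inv' a (h u)) = orb (NE u) (inv' a (h' u))"
proof -
  obtain g where g: "g \<in> K" "h = a \<circ> g" using \<A>_coset[OF h] by blast
  obtain g' where g': "g' \<in> K" "h' = a \<circ> g'" using \<A>_coset[OF h'] by blast
  have ah: "inv' a (h v) = g v" "inv' a (h' v) = g' v" for v using g g' inv_f[OF a_H] by simp_all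
  define e where "e = inv' g \<circ> g'"
  have eK: "e \<in> K" unfolding e_def by (rule K.comp_in[OF K.inv_in[OF g(1)] g'(1)])
  have ge: "g (e v) = g' v" for v by (simp add: e_def K.f_inv[OF g(1)])
  have e_fix: "e v = v" if "h v = h' v" for v
  proof -
    have "g' v = g v" using that g(2) g'(2) inj_H[OF a_H] by simp
    then show ?thesis using K.inv_f[OF g(1)] by (simp add: e_def)
  qed
  have eB: "e v = v" if "\<chi> v \<in> B" for v
    by (rule e_fix[OF agree_B_all[OF h h' ce that]])
  define Z where "Z = link u" define i where "i = guide u"
  have i: "i \<in> Z" "i \<in> B" using guide[OF u(2)] by (simp_all add: Z_def i_def)
  have act: "active u" using u(2) by (simp add: smooth_def)
  interpret N: perm_group \<Omega> "Nc \<chi> Z" by (rule Nc_group)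
  interpret E: perm_group \<Omega> "Nc \<chi> (Z - {i})" by (rule Nc_group)
  have ZK: "f \<in> K" if "f \<in> Nc \<chi> Z" for f using Nc_link_K[OF act, of Z f] that by (simp add: Z_def)
  have comm: "e \<circ> f \<circ> inv' e \<circ> inv' f \<in> Nc \<chi> (Z - {i})" if f: "f \<in> Nc \<chi> Z" for f
  proof -
    have 1: "e \<circ> f \<circ> inv' e \<circ> inv' f \<in> Nc \<chi> Z"
      using N.comp_in[OF Nc_normal[OF eK f] N.inv_in[OF f]] by simp
    have "(e \<circ> f \<circ> inv' e \<circ> inv' f) v = v" if "\<chi> v = i" for v
    proof -
      have iv: "\<chi> (inv' f v) \<in> B" using Nc_colour[OF N.inv_in[OF f]] that i(2) by simp
      then have "inv' e (inv' f v) = inv' f v" using eB K.inv_f[OF eK] by metis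
      then have "(e \<circ> f \<circ> inv' e \<circ> inv' f) v = e v" using N.f_inv[OF f] by simp
      then show ?thesis using eB that i(2) by simp
    qed
    then show ?thesis using 1 unfolding Nc_def by auto
  qed
  define r where "r = rep (orb (Nc \<chi> Z) u)"
  have "r \<in> orb (Nc \<chi> Z) u" unfolding r_def by (rule rep_in) (use N.orb_self in blast)
  then obtain f0 where f0: "f0 \<in> Nc \<chi> Z" "r = f0 u" by (rule orbE)
  have r: "smooth r" "link r = Z" "guide r = i" "r \<in> \<Omega>" "block r = block u"
    using ZK[OF f0(1)] f0 u N.in_Omega[OF f0(1)] N.orb_eq[OF \<open>r \<in> orb (Nc \<chi> Z) u\<close>]
    by (simp_all add: smooth_K link_K guide_K Z_def i_def)
  have rr: "r = rep (block r)" using r(5) by (simp add: r_def Z_def)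
  have er: "e r \<in> orb (Nc \<chi> (Z - {i})) r"
  proof (cases "r \<in> Sig h \<or> r \<in> Sig h'")
    case True
    then have "h r = h' r" using FX_Sig_eq(2)[OF h h' ce, of r] FX_Sig_eq(2)[OF h' h ce[symmetric], of r] by auto
    then have "e r = r" by (rule e_fix)
    then show ?thesis using E.orb_self by simp
  next
    \<comment> \<open>Both elements leave the representative in the orbit of
      \<open>inv' a r\<close>. This common orbit replaces a stored value.\<close>
    case False
    then have "r \<notin> Mv h" "r \<notin> Mv h'" using rr by (auto simp: Sig_def)
    then have "g r \<in> orb (Nc \<chi> (Z - {i})) (inv' a r)" "g' r \<in> orb (Nc \<chi> (Z - {i})) (inv' a r)"
      using r ah by (auto simp: Mv_def)
    then have "g' r \<in> orb (Nc \<chi> (Z - {i})) (g r)" using E.orb_eq by simp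
    then have "g (e r) \<in> g ` orb (Nc \<chi> (Z - {i})) r" using orb_Nc_image[OF g(1)] ge by simp
    then show ?thesis using K.inj_H[OF g(1)] by (auto simp: image_iff)
  qed
  have "u \<in> orb (Nc \<chi> Z) r" using N.orb_sym \<open>r \<in> orb (Nc \<chi> Z) u\<close> .
  then obtain f where f: "f \<in> Nc \<chi> Z" "u = f r" by (rule orbE)
  have "e u = (e \<circ> f \<circ> inv' e \<circ> inv' f) (f (e r))"
    using f N.inv_f[OF f(1)] K.inv_f[OF eK] by simp
  then have "e u \<in> orb (Nc \<chi> (Z - {i})) (f (e r))" by (rule orbI[OF comm[OF f(1)]])
  moreover have "f (e r) \<in> orb (Nc \<chi> (Z - {i})) u"
    using imageI[OF er, of f] unfolding orb_Nc_image[OF f(1), symmetric] f(2)[symmetric] .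
  ultimately have eu: "e u \<in> orb (Nc \<chi> (Z - {i})) u" using E.orb_eq by blast
  have "g' u \<in> orb (Nc \<chi> (Z - {i})) (g u)"
    using imageI[OF eu, of g] unfolding orb_Nc_image[OF g(1), symmetric] ge .
  then have "orb (Nc \<chi> (Z - {i})) (g' u) = orb (Nc \<chi> (Z - {i})) (g u)" by (rule E.orb_eq)
  then show ?thesis by (simp add: ah Z_def i_def)
qed

lemma Mv_eq:
  assumes h: "h \<in> \<A>" and h': "h' \<in> \<A>" and ce: "code h = code h'"
  shows "Mv h = Mv h'"
proof -
  have "inv' a (h u) \<in> orb (NE u) (inv' a u) \<longleftrightarrow> inv' a (h' u) \<in> orb (NE u) (inv' a u)"
    if "u \<in> \<Omega>" "smooth u" for u
  proof -
    interpret E: perm_group \<Omega> "NE u" by (rule Nc_group)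
    have "x \<in> orb (NE u) y \<longleftrightarrow> orb (NE u) x = orb (NE u) y" for x y
      using E.orb_eq[of x y] E.orb_self[of x] by auto
    then show ?thesis using classes_agree[OF h h' ce that] by simp
  qed
  then show ?thesis by (auto simp: Mv_def)
qed

text \<open>Second stage of the decoding. By \<open>classes_agree\<close> and \<open>Mv_eq\<close>
  the two elements now have the same candidate sets everywhere and the same starting points in
  \<open>Mv h\<close>, so the walks may pass through smooth points.\<close>

lemma agree_off_Om:
  assumes h: "h \<in> \<A>" and h': "h' \<in> \<A>" and ce: "code h = code h'"
    and w: "w \<in> perm_supp h" "w \<notin> Om h"
  shows "h w = h' w"
proof -
  interpret c: cut_perm \<Omega> h l by (rule cut_perm[OF h])
  have w\<Omega>: "w \<in> \<Omega>" using w(1) supp_subset[OF \<A>_H[OF h]] by blast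
  have key: "h u = h' u" if "u \<in> \<Omega>" "symb h u = symb h' u" for u
  proof (rule key_general[OF h h' ce that(1) _ that(2)])
    show "cand h u = cand h' u"
      using classes_agree[OF h h' ce that(1)] by (auto simp: cand_def rough_def smooth_def)
  qed
  have words: "word h v = word h' v" if "v \<in> Mv h" for v
  proof (rule sorted_map_eqD[OF _ finite_Mv that])
    show "map (word h) (sorted_list_of_set (Mv h)) = map (word h') (sorted_list_of_set (Mv h))"
      using ce Mv_eq[OF h h' ce] by (simp add: code_def)
  qed
  have main: "h w = h' w" if v: "v \<in> P h \<union> FX h \<union> h ` Q \<union> Mv h" and b: "b < l" "(h ^^ b) v = w" for v b
  proof -
    have wv: "word h v = word h' v" using v words words_eq[OF h h' ce, of v] by blast
    have v\<Omega>: "v \<in> \<Omega>" using v starts_supp[OF h] supp_subset[OF \<A>_H[OF h]] by (auto simp: Mv_def)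
    have "(h ^^ b) v = (h' ^^ b) v \<and> h ((h ^^ b) v) = h' ((h ^^ b) v)"
    proof (rule walk[OF wv b(1)])
      fix b' assume "symb h ((h ^^ b') v) = symb h' ((h ^^ b') v)"
      moreover have "(h ^^ b') v \<in> \<Omega>" using c.cyc_Omega[OF v\<Omega>] c.cyc_funpow by blast
      ultimately show "h ((h ^^ b') v) = h' ((h ^^ b') v)" by (intro key)
    qed
    then show ?thesis unfolding b(2) by blast
  qed
  show ?thesis
  proof (cases "card (cyc h w) \<le> l")
    case True
    show ?thesis
    proof (cases "cyc h w \<inter> Y h = {}")
      case False
      then obtain y where y: "y \<in> cyc h w" "y \<in> Y h" by blast
      have "w \<in> cyc h y" using c.cyc_eq[OF y(1)] c.cyc_self by simp
      then obtain b where b: "b < card (cyc h y)" "w = (h ^^ b) y" by (rule c.cyc_obtain)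
      show ?thesis
      proof (rule main[of y b])
        show "b < l" using b(1) True c.cyc_eq[OF y(1)] by simp
        show "(h ^^ b) y = w" by (rule b(2)[symmetric])
      qed (use y(2) in \<open>auto simp: Y_def\<close>)
    next
      case no: True
      then have "c.base w \<in> P h" using w True by (auto simp: P_def)
      moreover have "(h ^^ c.cpos w) (c.base w) = w" "c.cpos w < card (cyc h w)" by (rule c.cpos)+
      ultimately show ?thesis
        by (intro main[of "c.base w" "c.cpos w"]) (use True in auto)
    qed
  next
    case False
    then have "w \<in> c.long" using w\<Omega> by (simp add: c.long_def)
    then have "c.seg w \<in> h ` Q" using c.seg_long cuts[OF h] by simp
    moreover obtain b where "b < l" "(h ^^ b) (c.seg w) = w" using c.seg_walk[of w] by blast
    ultimately show ?thesis by (intro main[of "c.seg w" b]) auto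
  qed
qed

lemma code_inj: "inj_on code \<A>"
proof (rule inj_onI)
  fix h h' assume h: "h \<in> \<A>" and h': "h' \<in> \<A>" and ce: "code h = code h'"
  let ?d = "inv' h \<circ> h'"
  have dH: "?d \<in> H" using comp_in inv_in \<A>_H h h' by blast
  have "perm_supp ?d \<subseteq> Om h \<union> Om h'"
  proof
    fix u assume "u \<in> perm_supp ?d"
    then have "inv' h (h' u) \<noteq> u" by (simp add: perm_supp_def)
    then have ne: "h u \<noteq> h' u" using inv_f[OF \<A>_H[OF h], of u] by metis
    then have "u \<in> perm_supp h \<or> u \<in> perm_supp h'" by (auto simp: perm_supp_def)
    then show "u \<in> Om h \<union> Om h'"
      using ne agree_off_Om[OF h h' ce] agree_off_Om[OF h' h ce[symmetric]] by auto
  qed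
  moreover have "finite (Om f)" if "f \<in> \<A>" for f
    by (rule finite_subset[OF Om_supp[OF that] finite_supp[OF \<A>_H[OF that]]])
  then have "finite (Om h \<union> Om h')" using h h' by simp
  ultimately have "card (perm_supp ?d) \<le> card (Om h \<union> Om h')" by (intro card_mono)
  also have "\<dots> \<le> card (Om h) + card (Om h')" by (rule card_Un_le)
  also have "\<dots> < m" using Om_small[OF h] Om_small[OF h'] by linarith
  finally have "?d = id" using md dH unfolding min_deg_def by (meson not_less)
  then have d: "inv' h (h' x) = x" for x by (metis comp_apply id_apply)
  have "h x = h' x" for x using f_inv[OF \<A>_H[OF h], of "h' x"] unfolding d .
  then show "h = h'" by (rule ext)
qed

end

section \<open>Counting the codes\<close>

lemma sum_power_le: "1 \<le> (x::nat) \<Longrightarrow> (\<Sum>i\<le>k. x ^ i) \<le> Suc k * x ^ k"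
  using sum_bounded_above[of "{..k}" "\<lambda>i. x ^ i" "x ^ k"] by (simp add: power_increasing)

lemma binomial_le_pow_all: "n choose r \<le> n ^ r"
  by (cases "r \<le> n") (simp_all add: binomial_le_pow binomial_eq_0)

context coset_code_inj begin

text \<open>The factors count the graphs of \<open>d\<close> explicit values, the sets of base
  points and the two lists of words. A list has at most \<open>k\<close> words since its starting
  points lie in the support.\<close>

lemma card_code_bound:
  assumes s: "0 < s" and A: "\<A>' \<subseteq> \<A>"
    and k: "\<And>h. h \<in> \<A>' \<Longrightarrow> card (perm_supp h) = k"
    and d: "\<And>h. h \<in> \<A>' \<Longrightarrow> card (FX h \<union> Sig h) = d"
    and c0: "\<And>h. h \<in> \<A>' \<Longrightarrow> card (P h) = c0"
  shows "card \<A>' \<le> card \<Omega> ^ (2 * d) * (card \<Omega> choose c0) * (Suc k * (s * L + 2) ^ (l * k))\<^sup>2"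
proof -
  define W where "W = {w. set w \<subseteq> {..Suc (s * L)} \<and> length w = l}"
  define Ls where "Ls = {xs. set xs \<subseteq> W \<and> length xs \<le> k}"
  define Gs where "Gs = {G. G \<subseteq> \<Omega> \<times> \<Omega> \<and> card G = d}"
  define Ps where "Ps = {S. S \<subseteq> \<Omega> \<and> card S = c0}"
  have finW: "finite W" unfolding W_def by (rule finite_lists_length_eq) simp
  have cW: "card W = (s * L + 2) ^ l" unfolding W_def by (simp add: card_lists_length_eq)
  have finLs: "finite Ls" unfolding Ls_def by (rule finite_lists_length_le[OF finW])
  have "card Ls = (\<Sum>i\<le>k. card W ^ i)" unfolding Ls_def by (rule card_lists_length_le[OF finW])
  also have "\<dots> \<le> Suc k * card W ^ k" by (rule sum_power_le) (simp add: cW)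
  finally have cLs: "card Ls \<le> Suc k * (s * L + 2) ^ (l * k)" by (simp add: cW power_mult)
  have finGs: "finite Gs" and finPs: "finite Ps" using fin by (simp_all add: Gs_def Ps_def)
  have "card Gs = card (\<Omega> \<times> \<Omega>) choose d" unfolding Gs_def by (rule n_subsets) (simp add: fin)
  also have "\<dots> \<le> card (\<Omega> \<times> \<Omega>) ^ d" by (rule binomial_le_pow_all)
  also have "\<dots> = card \<Omega> ^ (2 * d)" by (simp add: card_cartesian_product power_mult power2_eq_square)
  finally have cGs: "card Gs \<le> card \<Omega> ^ (2 * d)" .
  have cPs: "card Ps = card \<Omega> choose c0" unfolding Ps_def by (rule n_subsets[OF fin])
  have word_in: "word h v \<in> W" if "h \<in> \<A>" for h v
    using symb_le[OF that s] by (auto simp: word_def W_def)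
  have "code ` \<A>' \<subseteq> Gs \<times> Ps \<times> Ls \<times> Ls"
  proof
    fix x assume "x \<in> code ` \<A>'"
    then obtain h where h: "h \<in> \<A>'" "x = code h" by blast
    then have h\<A>: "h \<in> \<A>" using A by blast
    have supp\<Omega>: "perm_supp h \<subseteq> \<Omega>" by (rule supp_subset[OF \<A>_H[OF h\<A>]])
    have fs: "finite (perm_supp h)" by (rule finite_supp[OF \<A>_H[OF h\<A>]])
    have FS: "FX h \<union> Sig h \<subseteq> \<Omega>" by (auto simp: FX_def X_def Sig_def Mv_def)
    have "(\<lambda>u. (u, h u)) ` (FX h \<union> Sig h) \<in> Gs"
    proof -
      have "card ((\<lambda>u. (u, h u)) ` (FX h \<union> Sig h)) = card (FX h \<union> Sig h)"
        by (rule card_image) (simp add: inj_on_def)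
      then show ?thesis using d[OF h(1)] FS in_Omega[OF \<A>_H[OF h\<A>]] by (auto simp: Gs_def)
    qed
    moreover have "P h \<in> Ps" using P_supp[OF h\<A>] supp\<Omega> c0[OF h(1)] by (auto simp: Ps_def)
    moreover have "map (word h) (sorted_list_of_set S) \<in> Ls" if "S \<subseteq> perm_supp h" for S
      using card_mono[OF fs that] k[OF h(1)] word_in[OF h\<A>] by (auto simp: Ls_def)
    moreover have "Mv h \<subseteq> perm_supp h" using Y_supp[OF h\<A>] by (auto simp: Y_def)
    ultimately show "x \<in> Gs \<times> Ps \<times> Ls \<times> Ls"
      using starts_supp[OF h\<A>] by (simp add: h(2) code_def)
  qed
  moreover have "inj_on code \<A>'" using code_inj A inj_on_subset by blast
  ultimately have "card \<A>' \<le> card (Gs \<times> Ps \<times> Ls \<times> Ls)"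
    using finGs finPs finLs by (intro card_inj_on_le) auto
  also have "\<dots> = card Gs * card Ps * (card Ls)\<^sup>2"
    by (simp add: card_cartesian_product power2_eq_square)
  also have "\<dots> \<le> card \<Omega> ^ (2 * d) * (card \<Omega> choose c0) * (Suc k * (s * L + 2) ^ (l * k))\<^sup>2"
    unfolding cPs by (intro mult_mono power_mono cGs cLs) auto
  finally show ?thesis .
qed

end

section \<open>Averaging: Markov's inequality and parameters of at most average cost\<close>

lemma half_below_twice_average:
  fixes f :: "'a \<Rightarrow> real" and \<epsilon> :: real
  assumes "finite A" "\<And>h. h \<in> A \<Longrightarrow> 0 \<le> f h" "sum f A \<le> \<epsilon> * card A" "0 < \<epsilon>"
  shows "card A \<le> 2 * card {h \<in> A. f h \<le> 2 * \<epsilon>}"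
proof -
  let ?B = "{h \<in> A. \<not> f h \<le> 2 * \<epsilon>}" and ?C = "{h \<in> A. f h \<le> 2 * \<epsilon>}"
  have "real (card ?B) * (2 * \<epsilon>) \<le> sum f ?B"
    by (rule sum_bounded_below) auto
  also have "\<dots> \<le> sum f A" using assms(1,2) by (intro sum_mono2) auto
  also note assms(3)
  finally have "\<epsilon> * (2 * real (card ?B)) \<le> \<epsilon> * real (card A)" by (simp add: mult.commute mult.left_commute)
  then have "2 * real (card ?B) \<le> real (card A)" using assms(4) by simp
  moreover have "card A = card ?C + card ?B"
  proof -
    have "card (?C \<union> ?B) = card ?C + card ?B" by (rule card_Un_disjoint) (use assms(1) in auto)
    moreover have "?C \<union> ?B = A" by blast
    ultimately show ?thesis by simp
  qed
  ultimately show ?thesis by linarith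
qed

lemma ex_sum_le_average:
  fixes \<phi> :: "'a \<Rightarrow> 'b \<Rightarrow> real" and \<epsilon> :: real
  assumes "finite \<Lambda>" "\<Lambda> \<noteq> {}" "finite A" "\<And>h. h \<in> A \<Longrightarrow> (\<Sum>x\<in>\<Lambda>. \<phi> h x) \<le> \<epsilon> * card \<Lambda>"
  shows "\<exists>x\<in>\<Lambda>. (\<Sum>h\<in>A. \<phi> h x) \<le> \<epsilon> * card A"
proof (rule ccontr)
  assume "\<not> ?thesis"
  then have "(\<Sum>x\<in>\<Lambda>. \<epsilon> * card A) < (\<Sum>x\<in>\<Lambda>. \<Sum>h\<in>A. \<phi> h x)"
    using assms(1,2) by (intro sum_strict_mono) auto
  also have "\<dots> = (\<Sum>h\<in>A. \<Sum>x\<in>\<Lambda>. \<phi> h x)" by (rule sum.swap)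
  also have "\<dots> \<le> (\<Sum>h\<in>A. \<epsilon> * card \<Lambda>)" by (rule sum_mono) (rule assms(4))
  finally show False by (simp add: algebra_simps)
qed

section \<open>Unions of cycles\<close>

context finite_perm begin

lemma card_cycles_le:
  assumes "finite S" "\<And>w. w \<in> S \<Longrightarrow> cyc h w \<subseteq> S" "\<And>w. w \<in> S \<Longrightarrow> t \<le> card (cyc h w)"
  shows "t * card (base ` S) \<le> card S"
proof -
  have S: "(\<Union>b\<in>base ` S. cyc h b) = S"
  proof
    show "(\<Union>b\<in>base ` S. cyc h b) \<subseteq> S"
    proof (rule UN_least)
      fix b assume "b \<in> base ` S"
      then obtain w where w: "w \<in> S" "b = base w" by blast
      show "cyc h b \<subseteq> S" unfolding w(2) cyc_base by (rule assms(2)[OF w(1)])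
    qed
    show "S \<subseteq> (\<Union>b\<in>base ` S. cyc h b)" using in_cyc_base by blast
  qed
  have "card (\<Union>b\<in>base ` S. cyc h b) = (\<Sum>b\<in>base ` S. card (cyc h b))"
  proof (rule card_UN_disjoint)
    show "\<forall>b\<in>base ` S. \<forall>b'\<in>base ` S. b \<noteq> b' \<longrightarrow> cyc h b \<inter> cyc h b' = {}"
    proof (intro ballI impI)
      fix b b' assume b: "b \<in> base ` S" "b' \<in> base ` S" "b \<noteq> b'"
      show "cyc h b \<inter> cyc h b' = {}"
      proof (rule ccontr)
        assume "cyc h b \<inter> cyc h b' \<noteq> {}"
        then obtain x where "x \<in> cyc h b" "x \<in> cyc h b'" by blast
        then have "base x = base b" "base x = base b'" by (auto intro: base_cong)
        then show False using b base_base by auto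
      qed
    qed
  qed (use assms(1) finite_cyc in auto)
  moreover have "(\<Sum>b\<in>base ` S. t) \<le> (\<Sum>b\<in>base ` S. card (cyc h b))"
    using assms(3) cyc_base by (intro sum_mono) auto
  ultimately show ?thesis using S by (simp add: mult.commute)
qed

text \<open>Take a largest union of cycles below \<open>m / 2\<close> points. One further cycle, of
  at most \<open>l \<le> m / 4\<close> points, would take it to \<open>m / 2\<close>, so it has at
  least \<open>m / 4\<close> points unless no cycle is left.\<close>

lemma ex_cycle_union_in_range:
  assumes "finite W" "\<And>w. w \<in> W \<Longrightarrow> cyc h w \<subseteq> W" "\<And>w. w \<in> W \<Longrightarrow> card (cyc h w) \<le> l"
    and "4 * l \<le> m" "0 < m"
  shows "\<exists>U\<subseteq>W. (\<forall>w\<in>U. cyc h w \<subseteq> U) \<and> 2 * card U < m \<and> (U = W \<or> m \<le> 4 * card U)"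
proof -
  define \<U> where "\<U> = {U. U \<subseteq> W \<and> (\<forall>w\<in>U. cyc h w \<subseteq> U) \<and> 2 * card U < m}"
  have fin\<U>: "finite (card ` \<U>)" and ne: "card ` \<U> \<noteq> {}"
    using assms(1,5) by (auto simp: \<U>_def intro!: exI[of _ "{}"])
  have "Max (card ` \<U>) \<in> card ` \<U>" using fin\<U> ne by (rule Max_in)
  then obtain U where U\<U>: "U \<in> \<U>" and max': "card U = Max (card ` \<U>)" by auto
  have max: "card V \<le> card U" if "V \<in> \<U>" for V
    unfolding max' using fin\<U> that by (intro Max_ge) auto
  have U: "U \<subseteq> W" "\<And>w. w \<in> U \<Longrightarrow> cyc h w \<subseteq> U" "2 * card U < m" using U\<U> by (auto simp: \<U>_def)
  have "m \<le> 4 * card U" if UW: "U \<noteq> W"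
  proof -
    obtain w where w: "w \<in> W" "w \<notin> U" using U(1) UW by blast
    let ?V = "U \<union> cyc h w"
    have finU: "finite U" using U assms(1) finite_subset by blast
    have cV: "card ?V \<le> card U + l"
      using card_Un_le[of U "cyc h w"] assms(3)[OF w(1)] by linarith
    have closed: "cyc h v \<subseteq> ?V" if v: "v \<in> ?V" for v
    proof (cases "v \<in> U")
      case True
      then show ?thesis using U(2) by blast
    next
      case False
      then have "cyc h v = cyc h w" using v cyc_eq by blast
      then show ?thesis by blast
    qed
    have "card U < card ?V"
    proof (rule psubset_card_mono)
      show "finite ?V" using finU finite_cyc by simp
      show "U \<subset> ?V" using w(2) cyc_self[of w] by blast
    qed
    have "\<not> 2 * card ?V < m"
    proof
      assume "2 * card ?V < m"
      moreover have "?V \<subseteq> W" using U(1) assms(2)[OF w(1)] by blast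
      ultimately have "?V \<in> \<U>" using closed unfolding \<U>_def by blast
      then show False using max[of ?V] \<open>card U < card ?V\<close> by linarith
    qed
    then show ?thesis using cV assms(4) by linarith
  qed
  then show ?thesis using U by blast
qed

end

section \<open>Block representatives of least weight\<close>

context coset_code begin

lemma smooth_block_rep:
  assumes "u \<in> \<Omega>" "smooth u" "r \<in> block u"
  shows "smooth r" "block r = block u" "r \<in> \<Omega>"
proof -
  interpret N: perm_group \<Omega> "Nc \<chi> (link u)" by (rule Nc_group)
  obtain f where f: "f \<in> Nc \<chi> (link u)" "r = f u" using assms(3) by (rule orbE)
  have fK: "f \<in> K" using Nc_link_K[of u "link u"] f(1) assms(2) by (simp add: smooth_def)
  show "smooth r" using smooth_K[OF fK] assms(2) f(2) by simp
  have "link r = link u" using link_K[OF fK] f(2) by simp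
  then show "block r = block u" using N.orb_eq[OF assms(3)] by simp
  show "r \<in> \<Omega>" using N.in_Omega[OF f(1)] f(2) assms(1) by simp
qed

text \<open>Blocks are disjoint and have more than \<open>L\<close> points, and the representative
  is the lightest of them; so it carries at most the fraction \<open>1 / L\<close> of the weight of
  its block.\<close>

lemma sum_rep_weights:
  fixes w :: "nat \<Rightarrow> real"
  assumes rep_min: "\<And>D r. finite D \<Longrightarrow> r \<in> D \<Longrightarrow> w (rep D) \<le> w r" and w0: "\<And>r. 0 \<le> w r"
    and L: "0 < L"
  shows "(\<Sum>u | u \<in> \<Omega> \<and> smooth u \<and> u = rep (block u). w u) \<le> (\<Sum>r\<in>\<Omega>. w r) / real L"
proof -
  let ?R = "{u. u \<in> \<Omega> \<and> smooth u \<and> u = rep (block u)}"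
  have finR: "finite ?R" using fin by simp
  have block\<Omega>: "block u \<subseteq> \<Omega>" if "u \<in> ?R" for u
    using smooth_block_rep(3)[of u] that by blast
  have each: "real L * w u \<le> (\<Sum>r\<in>block u. w r)" if u: "u \<in> ?R" for u
  proof -
    have "L \<le> card (block u)" using link(2)[of u] u by (auto simp: smooth_def)
    then have "real L * w u \<le> real (card (block u)) * w u" using w0 by (intro mult_right_mono) auto
    also have "\<dots> = (\<Sum>r\<in>block u. w u)" by simp
    also have "\<dots> \<le> (\<Sum>r\<in>block u. w r)"
    proof (rule sum_mono)
      fix r assume r: "r \<in> block u"
      have "u = rep (block u)" using u by blast
      then show "w u \<le> w r" using rep_min[OF finite_orb_Nc r] by metis
    qed
    finally show ?thesis .
  qed
  have "real L * (\<Sum>u\<in>?R. w u) = (\<Sum>u\<in>?R. real L * w u)" by (rule sum_distrib_left)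
  also have "\<dots> \<le> (\<Sum>u\<in>?R. \<Sum>r\<in>block u. w r)" by (rule sum_mono) (rule each)
  also have "\<dots> = (\<Sum>r\<in>(\<Union>u\<in>?R. block u). w r)"
  proof (rule sum.UNION_disjoint[symmetric])
    show "\<forall>u\<in>?R. \<forall>v\<in>?R. u \<noteq> v \<longrightarrow> block u \<inter> block v = {}"
    proof (intro ballI impI)
      fix u v assume u: "u \<in> ?R" and v: "v \<in> ?R" and ne: "u \<noteq> v"
      show "block u \<inter> block v = {}"
      proof (rule ccontr)
        assume "block u \<inter> block v \<noteq> {}"
        then obtain r where "r \<in> block u" "r \<in> block v" by blast
        then have "block u = block v"
          using smooth_block_rep(2)[of u r] smooth_block_rep(2)[of v r] u v by auto
        then show False using u v ne by (metis (mono_tags, lifting) mem_Collect_eq)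
      qed
    qed
  qed (use finR finite_orb_Nc in auto)
  also have "\<dots> \<le> (\<Sum>r\<in>\<Omega>. w r)"
    using block\<Omega> w0 by (intro sum_mono2[OF fin]) auto
  finally show ?thesis using L by (simp add: pos_le_divide_eq mult.commute)
qed

text \<open>Every element spreads total weight at most 1 evenly over \<open>Mv h\<close>. The left
  side is the weight that falls on representatives, and those are chosen to be lightest in their
  blocks.\<close>

lemma card_Sig_average:
  assumes "finite \<A>" and L: "0 < L"
    and rep_min: "\<And>D r. finite D \<Longrightarrow> r \<in> D \<Longrightarrow>
      (\<Sum>h\<in>\<A>. if rep D \<in> Mv h then 1 / real (card (Mv h)) else 0)
      \<le> (\<Sum>h\<in>\<A>. if r \<in> Mv h then 1 / real (card (Mv h)) else 0)"
  shows "(\<Sum>h\<in>\<A>. real (card (Sig h)) / real (card (Mv h))) \<le> 1 / real L * card \<A>"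
proof -
  define w where "w r = (\<Sum>h\<in>\<A>. if r \<in> Mv h then 1 / real (card (Mv h)) else 0)" for r
  let ?R = "{u. u \<in> \<Omega> \<and> smooth u \<and> u = rep (block u)}"
  have "real (card (Sig h)) / real (card (Mv h)) = (\<Sum>u\<in>?R. if u \<in> Mv h then 1 / real (card (Mv h)) else 0)" for h
  proof -
    have "Sig h = {u \<in> ?R. u \<in> Mv h}" by (auto simp: Sig_def Mv_def)
    then show ?thesis using fin by (simp add: sum.If_cases Int_def)
  qed
  then have "(\<Sum>h\<in>\<A>. real (card (Sig h)) / real (card (Mv h))) = (\<Sum>u\<in>?R. w u)"
    unfolding w_def by (simp add: sum.swap[of _ \<A>])
  also have "\<dots> \<le> (\<Sum>r\<in>\<Omega>. w r) / real L"
    by (rule sum_rep_weights) (use rep_min L in \<open>auto simp: w_def intro: sum_nonneg\<close>)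
  also have "(\<Sum>r\<in>\<Omega>. w r) = (\<Sum>h\<in>\<A>. \<Sum>r\<in>\<Omega>. if r \<in> Mv h then 1 / real (card (Mv h)) else 0)"
    unfolding w_def by (rule sum.swap)
  also have "\<dots> \<le> (\<Sum>h\<in>\<A>. 1)"
  proof (rule sum_mono)
    fix h
    have "(\<Sum>r\<in>\<Omega>. if r \<in> Mv h then 1 / real (card (Mv h)) else 0) = (\<Sum>r\<in>\<Omega> \<inter> Mv h. 1 / real (card (Mv h)))"
      using fin by (simp add: sum.If_cases Int_def)
    also have "\<Omega> \<inter> Mv h = Mv h" by (auto simp: Mv_def)
    finally show "(\<Sum>r\<in>\<Omega>. if r \<in> Mv h then 1 / real (card (Mv h)) else 0) \<le> 1" by simp
  qed
  finally show ?thesis using L by (simp add: divide_right_mono)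
qed

end

section \<open>Random sets of colours\<close>

lemma sum_card_fraction:
  fixes p :: real
  assumes "finite S" "finite \<Lambda>" "0 \<le> p" "\<And>u. u \<in> S \<Longrightarrow> real (card {x \<in> \<Lambda>. E u x}) \<le> p * card \<Lambda>"
  shows "(\<Sum>x\<in>\<Lambda>. real (card {u \<in> S. E u x}) / real (card S)) \<le> p * card \<Lambda>"
proof (cases "S = {}")
  case True
  then show ?thesis using assms(3) by simp
next
  case False
  then have S: "0 < real (card S)" using assms(1) by (simp add: card_gt_0_iff)
  have c: "real (card {u \<in> A. P u}) = (\<Sum>u\<in>A. if P u then 1 else 0)" if "finite A" for A :: "'z set" and P
    using that by (simp add: sum.If_cases Int_def)
  have "(\<Sum>x\<in>\<Lambda>. real (card {u \<in> S. E u x})) = (\<Sum>x\<in>\<Lambda>. \<Sum>u\<in>S. if E u x then 1 else 0)"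
    by (simp only: c[OF assms(1)])
  also have "\<dots> = (\<Sum>u\<in>S. \<Sum>x\<in>\<Lambda>. if E u x then 1 else 0)" by (rule sum.swap)
  also have "\<dots> = (\<Sum>u\<in>S. real (card {x \<in> \<Lambda>. E u x}))" using assms(2) by (simp add: sum.If_cases Int_def)
  also have "\<dots> \<le> (\<Sum>u\<in>S. p * card \<Lambda>)" by (rule sum_mono) (rule assms(4))
  finally have "(\<Sum>x\<in>\<Lambda>. real (card {u \<in> S. E u x})) \<le> real (card S) * (p * card \<Lambda>)" by simp
  then show ?thesis using S unfolding sum_divide_distrib[symmetric]
    by (simp add: pos_divide_le_eq mult.commute)
qed

lemma card_labelings_zero:
  fixes s N :: nat
  assumes "j < s" "0 < N"
  shows "real (card {f \<in> {..<s} \<rightarrow>\<^sub>E {..<N}. f j = 0}) = 1 / real N * card ({..<s} \<rightarrow>\<^sub>E {..<N})"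
  using card_PiE_constrained_real[of "{..<s}" "{j}" "{..<N}" "{0}"] assms
  by (simp add: card_funcsetE)

lemma card_labelings_nonzero:
  fixes s N :: nat
  assumes "Z \<subseteq> {..<s}" "z < card Z" "0 < N"
  shows "real (card {f \<in> {..<s} \<rightarrow>\<^sub>E {..<N}. \<forall>i\<in>Z. f i \<noteq> 0})
    \<le> (1 - 1 / real N) ^ Suc z * card ({..<s} \<rightarrow>\<^sub>E {..<N})"
proof -
  have "{f \<in> {..<s} \<rightarrow>\<^sub>E {..<N}. \<forall>i\<in>Z. f i \<noteq> 0} = {f \<in> {..<s} \<rightarrow>\<^sub>E {..<N}. \<forall>i\<in>Z. f i \<in> {1..<N}}"
    (is "?A = ?B")
  proof
    show "?A \<subseteq> ?B"
    proof
      fix f assume f: "f \<in> ?A"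
      have "f i \<in> {1..<N}" if i: "i \<in> Z" for i
      proof -
        have "f i < N" using f i assms(1) by (auto dest!: PiE_mem)
        moreover have "f i \<noteq> 0" using f i by blast
        ultimately show ?thesis by simp
      qed
      then show "f \<in> ?B" using f by blast
    qed
    show "?B \<subseteq> ?A" by force
  qed
  then have "real (card ?A) = real N ^ s * ((real N - 1) / real N) ^ card Z"
    using card_PiE_constrained_real[OF _ assms(1), of "{..<N}" "{1..<N}"] assms(3)
    by (simp add: of_nat_diff subset_eq)
  also have "(real N - 1) / real N = 1 - 1 / real N" using assms(3) by (simp add: field_simps)
  also have "real N ^ s * (1 - 1 / real N) ^ card Z \<le> real N ^ s * (1 - 1 / real N) ^ Suc z"
    using assms(2,3) by (intro mult_left_mono power_decreasing) auto
  also have "\<dots> = (1 - 1 / real N) ^ Suc z * card ({..<s} \<rightarrow>\<^sub>E {..<N})"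
    by (simp add: card_funcsetE mult.commute del: power_Suc)
  finally show ?thesis .
qed

text \<open>A labelling with \<open>N\<close> labels encodes the random set \<open>B\<close> of
  colours with label 0. A point of \<open>X h\<close> fails through its own colour with probability
  \<open>1 / N\<close>, or because its more than \<open>z\<close> colours in \<open>Z u\<close> all
  miss \<open>B\<close>; the second \<open>1 / N\<close> is for the points of \<open>S h\<close>.
  Markov's inequality for the sum of both fractions keeps half of the family.\<close>

lemma ex_labeling:
  fixes X S :: "'h \<Rightarrow> nat set" and p :: real and s N z :: nat and \<chi> :: "nat \<Rightarrow> nat" and Z :: "nat \<Rightarrow> nat set"
  assumes "finite A" "\<And>h. h \<in> A \<Longrightarrow> finite (X h)" "\<And>h. h \<in> A \<Longrightarrow> finite (S h)"
    and \<chi>: "\<And>h u. h \<in> A \<Longrightarrow> u \<in> X h \<union> S h \<Longrightarrow> \<chi> u < s"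
    and Z: "\<And>h u. h \<in> A \<Longrightarrow> u \<in> X h \<Longrightarrow> Z u \<subseteq> {..<s} \<and> z < card (Z u)"
    and N: "0 < N" and p: "2 / real N + (1 - 1 / real N) ^ Suc z \<le> p" "0 < p"
  shows "\<exists>B\<subseteq>{..<s}. card A \<le> 2 * card {h \<in> A.
      real (card {u \<in> X h. \<chi> u \<in> B \<or> Z u \<inter> B = {}}) \<le> 2 * p * card (X h) \<and>
      real (card {u \<in> S h. \<chi> u \<in> B}) \<le> 2 * p * card (S h)}"
proof -
  define \<Lambda> where "\<Lambda> = ({..<s} \<rightarrow>\<^sub>E {..<N})"
  define q where "q = (1 - 1 / real N) ^ Suc z"
  have q0: "0 \<le> q" using N by (simp add: q_def)
  have fin\<Lambda>: "finite \<Lambda>" unfolding \<Lambda>_def by (rule finite_PiE) simp_all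
  have ne\<Lambda>: "\<Lambda> \<noteq> {}" using N by (auto simp: \<Lambda>_def PiE_eq_empty_iff)
  define \<phi> where "\<phi> h f = real (card {u \<in> X h. f (\<chi> u) = 0 \<or> (\<forall>i\<in>Z u. f i \<noteq> 0)}) / real (card (X h))
     + real (card {u \<in> S h. f (\<chi> u) = (0::nat)}) / real (card (S h))" for h f
  have "(\<Sum>f\<in>\<Lambda>. \<phi> h f) \<le> p * card \<Lambda>" if h: "h \<in> A" for h
  proof -
    have 1: "(\<Sum>f\<in>\<Lambda>. real (card {u \<in> X h. f (\<chi> u) = 0 \<or> (\<forall>i\<in>Z u. f i \<noteq> 0)}) / real (card (X h)))
      \<le> (1 / real N + q) * card \<Lambda>"
    proof (rule sum_card_fraction[OF assms(2)[OF h] fin\<Lambda>])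
      fix u assume u: "u \<in> X h"
      have "{f \<in> \<Lambda>. f (\<chi> u) = 0 \<or> (\<forall>i\<in>Z u. f i \<noteq> 0)} = {f \<in> \<Lambda>. f (\<chi> u) = 0} \<union> {f \<in> \<Lambda>. \<forall>i\<in>Z u. f i \<noteq> 0}"
        by blast
      then have "card {f \<in> \<Lambda>. f (\<chi> u) = 0 \<or> (\<forall>i\<in>Z u. f i \<noteq> 0)}
        \<le> card {f \<in> \<Lambda>. f (\<chi> u) = 0} + card {f \<in> \<Lambda>. \<forall>i\<in>Z u. f i \<noteq> 0}"
        by (simp only: card_Un_le)
      then have "real (card {f \<in> \<Lambda>. f (\<chi> u) = 0 \<or> (\<forall>i\<in>Z u. f i \<noteq> 0)})
        \<le> real (card {f \<in> \<Lambda>. f (\<chi> u) = 0}) + real (card {f \<in> \<Lambda>. \<forall>i\<in>Z u. f i \<noteq> 0})"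
        by linarith
      also have "\<dots> \<le> 1 / real N * card \<Lambda> + q * card \<Lambda>"
      proof (rule add_mono)
        show "real (card {f \<in> \<Lambda>. f (\<chi> u) = 0}) \<le> 1 / real N * card \<Lambda>"
          unfolding \<Lambda>_def by (rule eq_refl[OF card_labelings_zero[OF \<chi>[OF h] N]]) (use u in blast)
        show "real (card {f \<in> \<Lambda>. \<forall>i\<in>Z u. f i \<noteq> 0}) \<le> q * card \<Lambda>"
          unfolding \<Lambda>_def q_def using Z[OF h u] by (intro card_labelings_nonzero N) auto
      qed
      finally show "real (card {f \<in> \<Lambda>. f (\<chi> u) = 0 \<or> (\<forall>i\<in>Z u. f i \<noteq> 0)}) \<le> (1 / real N + q) * card \<Lambda>"
        by (simp add: distrib_right)
    qed (use q0 in simp)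
    have 2: "(\<Sum>f\<in>\<Lambda>. real (card {u \<in> S h. f (\<chi> u) = (0::nat)}) / real (card (S h))) \<le> 1 / real N * card \<Lambda>"
    proof (rule sum_card_fraction[OF assms(3)[OF h] fin\<Lambda>])
      fix u assume "u \<in> S h"
      then have "\<chi> u < s" using \<chi>[OF h] by blast
      then show "real (card {f \<in> \<Lambda>. f (\<chi> u) = 0}) \<le> 1 / real N * card \<Lambda>"
        unfolding \<Lambda>_def by (rule eq_refl[OF card_labelings_zero[OF _ N]])
    qed simp
    have "(1 / real N + q) * card \<Lambda> + 1 / real N * card \<Lambda> = (2 / real N + q) * card \<Lambda>"
      by (simp add: algebra_simps)
    also have "\<dots> \<le> p * card \<Lambda>" using p(1) by (intro mult_right_mono) (auto simp: q_def)
    finally show ?thesis using 1 2 unfolding \<phi>_def sum.distrib by linarith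
  qed
  then obtain f where f: "f \<in> \<Lambda>" "(\<Sum>h\<in>A. \<phi> h f) \<le> p * card A"
    using ex_sum_le_average[OF fin\<Lambda> ne\<Lambda> assms(1), of \<phi> p] by blast
  have half: "card A \<le> 2 * card {h \<in> A. \<phi> h f \<le> 2 * p}"
    by (rule half_below_twice_average[OF assms(1) _ f(2) p(2)]) (simp add: \<phi>_def)
  define B where "B = {i \<in> {..<s}. f i = 0}"
  have sub: "{h \<in> A. \<phi> h f \<le> 2 * p} \<subseteq> {h \<in> A.
      real (card {u \<in> X h. \<chi> u \<in> B \<or> Z u \<inter> B = {}}) \<le> 2 * p * card (X h) \<and>
      real (card {u \<in> S h. \<chi> u \<in> B}) \<le> 2 * p * card (S h)}"
  proof (rule subsetI, rule CollectI)
    fix h assume "h \<in> {h \<in> A. \<phi> h f \<le> 2 * p}"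
    then have h: "h \<in> A" and \<phi>: "\<phi> h f \<le> 2 * p" by auto
    have eq1: "{u \<in> X h. \<chi> u \<in> B \<or> Z u \<inter> B = {}} = {u \<in> X h. f (\<chi> u) = 0 \<or> (\<forall>i\<in>Z u. f i \<noteq> 0)}"
    proof (intro Collect_cong conj_cong refl)
      fix u assume u: "u \<in> X h"
      have "\<chi> u \<in> B \<longleftrightarrow> f (\<chi> u) = 0" using \<chi>[OF h, of u] u by (simp add: B_def)
      moreover have "Z u \<inter> B = {} \<longleftrightarrow> (\<forall>i\<in>Z u. f i \<noteq> 0)" using Z[OF h u] by (auto simp: B_def)
      ultimately show "\<chi> u \<in> B \<or> Z u \<inter> B = {} \<longleftrightarrow> f (\<chi> u) = 0 \<or> (\<forall>i\<in>Z u. f i \<noteq> 0)" by blast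
    qed
    have eq2: "{u \<in> S h. \<chi> u \<in> B} = {u \<in> S h. f (\<chi> u) = 0}"
      using \<chi>[OF h] by (auto simp: B_def)
    have frac: "real (card T) \<le> 2 * p * card V" if "real (card T) / real (card V) \<le> 2 * p" "T \<subseteq> V" "finite V" for T V :: "nat set"
    proof (cases "V = {}")
      case False
      then have "0 < real (card V)" using that(3) by (simp add: card_gt_0_iff)
      then show ?thesis using that(1) by (simp add: pos_divide_le_eq)
    qed (use that in simp)
    have nn: "0 \<le> real (card {u \<in> X h. \<chi> u \<in> B \<or> Z u \<inter> B = {}}) / real (card (X h))"
      "0 \<le> real (card {u \<in> S h. \<chi> u \<in> B}) / real (card (S h))" by simp_all
    have sum: "real (card {u \<in> X h. \<chi> u \<in> B \<or> Z u \<inter> B = {}}) / real (card (X h))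
        + real (card {u \<in> S h. \<chi> u \<in> B}) / real (card (S h)) \<le> 2 * p"
      using \<phi> unfolding \<phi>_def eq1 eq2 .
    show "h \<in> A \<and> real (card {u \<in> X h. \<chi> u \<in> B \<or> Z u \<inter> B = {}}) \<le> 2 * p * card (X h) \<and>
      real (card {u \<in> S h. \<chi> u \<in> B}) \<le> 2 * p * card (S h)"
    proof (intro conjI h)
      show "real (card {u \<in> X h. \<chi> u \<in> B \<or> Z u \<inter> B = {}}) \<le> 2 * p * card (X h)"
        by (rule frac[OF _ _ assms(2)[OF h]]) (use sum nn in linarith, blast)
      show "real (card {u \<in> S h. \<chi> u \<in> B}) \<le> 2 * p * card (S h)"
        by (rule frac[OF _ _ assms(3)[OF h]]) (use sum nn in linarith, blast)
    qed
  qed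
  have "card {h \<in> A. \<phi> h f \<le> 2 * p} \<le> card {h \<in> A.
      real (card {u \<in> X h. \<chi> u \<in> B \<or> Z u \<inter> B = {}}) \<le> 2 * p * card (X h) \<and>
      real (card {u \<in> S h. \<chi> u \<in> B}) \<le> 2 * p * card (S h)}"
    by (rule card_mono[OF _ sub]) (use assms(1) in simp)
  then have "card A \<le> 2 * card {h \<in> A.
      real (card {u \<in> X h. \<chi> u \<in> B \<or> Z u \<inter> B = {}}) \<le> 2 * p * card (X h) \<and>
      real (card {u \<in> S h. \<chi> u \<in> B}) \<le> 2 * p * card (S h)}" using half by linarith
  then show ?thesis by (intro exI[of _ B]) (auto simp: B_def)
qed

subsection \<open>Counting elements by support size and number of cycles\<close>


text \<open>
  The support splits into short cycles that are recorded only by a base point (\<open>k\<^sub>q\<close> points), omitted cycles (\<open>k\<^sub>o\<close>), short cycles that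
  meet \<open>Y\<close> (\<open>k\<^sub>y\<close>) and long cycles (\<open>k\<^sub>l\<close>). The code contains \<open>d\<close> explicit values, \<open>j\<close> values at cuts and \<open>c\<^sub>0\<close> base points.
  If fewer than \<open>m/4\<close> points are omitted, then all points counted by \<open>k\<^sub>q\<close> have colours in \<open>B\<close>, so there are few.
\<close>

definition balanced :: "nat \<Rightarrow> nat \<Rightarrow> nat \<Rightarrow> nat \<Rightarrow> nat \<Rightarrow> nat \<Rightarrow> bool" where
  "balanced k c j m d c\<^sub>0 \<longleftrightarrow> (\<exists>k\<^sub>q k\<^sub>o k\<^sub>y k\<^sub>l. k = k\<^sub>q + k\<^sub>o + k\<^sub>y + k\<^sub>l \<and> 2 * c\<^sub>0 \<le> k\<^sub>q \<and>
     80 * c \<le> 80 * c\<^sub>0 + 40 * k\<^sub>o + 40 * k\<^sub>y + 2 * k\<^sub>l \<and> 250 * d \<le> k\<^sub>y + k\<^sub>l \<and> 20 * j \<le> k\<^sub>l \<and>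
     (m \<le> 4 * k\<^sub>o \<or> 500 * k\<^sub>q \<le> k))"

text \<open>Origin of the coefficients: nontrivial cycles have at least 2 points and long ones more
  than 40, which bounds the number of cycles. \<open>FX h\<close> and \<open>Sig h\<close> are each
  at most 1/500 of \<open>Y h\<close>, which lies in the short cycles that meet it and in the long
  ones, whence 250. \<open>card_cuts\<close> with segments of 40 points gives 20.\<close>

lemma (in coset_code_inj) balanced_stats:
  assumes l: "l = 40" and h: "h \<in> \<A>"
    and Om_sub: "Om h \<subseteq> {w \<in> perm_supp h. card (cyc h w) \<le> l \<and> cyc h w \<inter> Y h = {} \<and> \<chi> w \<notin> B}"
    and Om_cyc: "\<And>w. w \<in> Om h \<Longrightarrow> cyc h w \<subseteq> Om h"
    and Om_large: "Om h = {w \<in> perm_supp h. card (cyc h w) \<le> l \<and> cyc h w \<inter> Y h = {} \<and> \<chi> w \<notin> B} \<or> m \<le> 4 * card (Om h)"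
    and FX_small: "500 * card (FX h) \<le> card (X h)"
    and Sig_small: "500 * card (Sig h) \<le> card (Mv h)"
    and B_small: "500 * card {w \<in> perm_supp h. \<chi> w \<in> B} \<le> card (perm_supp h)"
  shows "balanced (card (perm_supp h)) (card (finite_perm.base h ` perm_supp h)) (card Q) m
    (card (FX h \<union> Sig h)) (card (P h))"
proof -
  interpret c: cut_perm \<Omega> h l by (rule cut_perm[OF h])
  let ?S = "perm_supp h"
  have finS: "finite ?S" by (rule finite_supp[OF \<A>_H[OF h]])
  have S\<Omega>: "?S \<subseteq> \<Omega>" by (rule supp_subset[OF \<A>_H[OF h]])
  define Sq where "Sq = {w \<in> ?S. card (cyc h w) \<le> l \<and> cyc h w \<inter> Y h = {} \<and> w \<notin> Om h}"
  define Sy where "Sy = {w \<in> ?S. card (cyc h w) \<le> l \<and> cyc h w \<inter> Y h \<noteq> {}}"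
  define Sl where "Sl = c.long"
  have Om: "Om h \<subseteq> ?S" "\<And>w. w \<in> Om h \<Longrightarrow> card (cyc h w) \<le> l \<and> cyc h w \<inter> Y h = {} \<and> \<chi> w \<notin> B"
    using Om_sub by auto
  have Sl: "Sl = {w \<in> ?S. \<not> card (cyc h w) \<le> l}"
    using c.long_supp S\<Omega> by (auto simp: Sl_def c.long_def)
  have fins: "finite Sq" "finite Sy" "finite Sl" "finite (Om h)"
    using finS Om(1) finite_subset by (auto simp: Sq_def Sy_def Sl)
  have parts: "?S = Sq \<union> (Om h \<union> (Sy \<union> Sl))"
    using Om(1) by (auto simp: Sq_def Sy_def Sl)
  have disj: "Sq \<inter> (Om h \<union> (Sy \<union> Sl)) = {}" "Om h \<inter> (Sy \<union> Sl) = {}" "Sy \<inter> Sl = {}"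
    using Om(2) by (auto simp: Sq_def Sy_def Sl)
  have "card (Sq \<union> (Om h \<union> (Sy \<union> Sl))) = card Sq + (card (Om h) + (card Sy + card Sl))"
    using fins disj by (simp only: card_Un_disjoint finite_Un)
  then have k: "card ?S = card Sq + card (Om h) + card Sy + card Sl"
    unfolding parts[symmetric] by simp
  have cycS: "cyc h w \<subseteq> ?S" "2 \<le> card (cyc h w)" if "w \<in> ?S" for w
    using c.cyc_supp c.card_cyc_ge2 that by auto
  have closed: "cyc h w \<subseteq> T" if w: "w \<in> T"
    and T: "T = {w \<in> ?S. R (cyc h w)}" for w T and R :: "nat set \<Rightarrow> bool"
    using cycS(1)[of w] c.cyc_eq[of _ w] w unfolding T by auto
  have Sq_closed: "cyc h w \<subseteq> Sq" if w: "w \<in> Sq" for w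
  proof
    fix v assume v: "v \<in> cyc h w"
    have "v \<notin> Om h"
    proof
      assume "v \<in> Om h"
      then have "cyc h w \<subseteq> Om h" using Om_cyc[of v] c.cyc_eq[OF v] by simp
      then show False using w c.cyc_self by (auto simp: Sq_def)
    qed
    then show "v \<in> Sq" using w v cycS(1)[of w] c.cyc_eq[OF v] by (auto simp: Sq_def)
  qed
  have Sy_closed: "cyc h w \<subseteq> Sy" if "w \<in> Sy" for w
    using closed[OF that, of "\<lambda>C. card C \<le> l \<and> C \<inter> Y h \<noteq> {}"] by (simp add: Sy_def)
  have Sl_closed: "cyc h w \<subseteq> Sl" if "w \<in> Sl" for w
    using closed[OF that, of "\<lambda>C. \<not> card C \<le> l"] by (simp add: Sl)
  have "P h = c.base ` Sq" by (auto simp: P_def Sq_def)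
  then have c0: "2 * card (P h) \<le> card Sq"
    using c.card_cycles_le[of Sq 2] fins(1) Sq_closed cycS(2) by (auto simp: Sq_def)
  have co: "2 * card (c.base ` Om h) \<le> card (Om h)"
    using c.card_cycles_le[of "Om h" 2] fins(4) Om_cyc cycS(2) Om(1) by blast
  have cy: "2 * card (c.base ` Sy) \<le> card Sy"
    using c.card_cycles_le[of Sy 2] fins(2) Sy_closed cycS(2) by (auto simp: Sy_def)
  have cl: "40 * card (c.base ` Sl) \<le> card Sl"
    using c.card_cycles_le[of Sl 40] fins(3) Sl_closed l by (auto simp: Sl)
  have base_parts: "c.base ` ?S = c.base ` Sq \<union> (c.base ` Om h \<union> (c.base ` Sy \<union> c.base ` Sl))"
    by (subst parts) (simp add: image_Un)
  have "card (c.base ` ?S) \<le> card (c.base ` Sq) + (card (c.base ` Om h) + (card (c.base ` Sy) + card (c.base ` Sl)))"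
    unfolding base_parts using card_Un_le[of "c.base ` Sq" "c.base ` Om h \<union> (c.base ` Sy \<union> c.base ` Sl)"]
      card_Un_le[of "c.base ` Om h" "c.base ` Sy \<union> c.base ` Sl"] card_Un_le[of "c.base ` Sy" "c.base ` Sl"]
    by linarith
  then have cc: "80 * card (c.base ` ?S) \<le> 80 * card (P h) + 40 * card (Om h) + 40 * card Sy + 2 * card Sl"
    using co cy cl \<open>P h = c.base ` Sq\<close> by simp
  have Y_sub: "Y h \<subseteq> Sy \<union> Sl"
    using Y_supp[OF h] c.cyc_self by (auto simp: Sy_def Sl)
  then have cY: "card (Y h) \<le> card Sy + card Sl"
    using card_mono[OF _ Y_sub] card_Un_le[of Sy Sl] fins by (simp add: le_trans)
  have finY: "finite (Y h)" using finite_Mv finite_FX by (simp add: Y_def)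
  have "card (X h) \<le> card (Y h)" "card (Mv h) \<le> card (Y h)"
    by (rule card_mono[OF finY X_subset_Y[OF h]], rule card_mono[OF finY]) (simp add: Y_def)
  then have d: "250 * card (FX h \<union> Sig h) \<le> card Sy + card Sl"
    using cY FX_small Sig_small card_Un_le[of "FX h" "Sig h"] by linarith
  have j: "20 * card Q \<le> card Sl"
    using c.card_cuts cuts[OF h] l by (simp add: Sl_def)
  have "m \<le> 4 * card (Om h) \<or> 500 * card Sq \<le> card ?S"
  proof (cases "m \<le> 4 * card (Om h)")
    case False
    then have "Sq \<subseteq> {w \<in> ?S. \<chi> w \<in> B}" using Om_large by (auto simp: Sq_def)
    then have "card Sq \<le> card {w \<in> ?S. \<chi> w \<in> B}" using finS by (intro card_mono) auto
    then show ?thesis using B_small by linarith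
  qed simp
  then show ?thesis unfolding balanced_def using k c0 cc d j by blast
qed

section \<open>Families inside one coset of the stabiliser of a colouring\<close>

context perm_group begin

text \<open>The parameters depend on one another: \<open>B\<close> is chosen from the sets
  \<open>X h\<close>, then \<open>rep\<close> from the sets \<open>Mv h\<close>, which involve
  \<open>B\<close>, then \<open>Om\<close> from \<open>Y h\<close>. Each of the first two choices
  keeps half of the family, whence the factor 4; \<open>Suc k\<close> squared counts the pairs of
  \<open>d\<close> and \<open>c\<^sub>0\<close>.\<close>

lemma coset_family_bound:
  fixes \<beta> :: real
  assumes md: "min_deg m" and m: "160 \<le> m" and L: "1000 \<le> L" and s: "0 < s" and N: "0 < N"
    and p: "2 / real N + (1 - 1 / real N) ^ Suc z \<le> 1 / 1000"
    and \<chi>: "\<And>u. u \<in> \<Omega> \<Longrightarrow> \<chi> u < s" and a: "a \<in> H"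
    and coset: "\<And>h. h \<in> \<A> \<Longrightarrow> \<exists>g\<in>Nc \<chi> {..<s}. h = a \<circ> g"
    and cuts: "\<And>h. h \<in> \<A> \<Longrightarrow> cut_perm.cuts \<Omega> h 40 = Q"
    and on_Q: "\<And>h h' u. h \<in> \<A> \<Longrightarrow> h' \<in> \<A> \<Longrightarrow> u \<in> Q \<Longrightarrow> h u = h' u"
    and seg_colour: "\<And>h u. h \<in> \<A> \<Longrightarrow> u \<in> \<Omega> \<Longrightarrow> \<chi> (cut_perm.seg h 40 u) = \<chi> u"
    and good: "\<And>h u. h \<in> \<A> \<Longrightarrow> u \<in> perm_supp h \<Longrightarrow> good s z L \<chi> u"
    and k: "\<And>h. h \<in> \<A> \<Longrightarrow> card (perm_supp h) = k"
    and c: "\<And>h. h \<in> \<A> \<Longrightarrow> card (finite_perm.base h ` perm_supp h) = c"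
    and \<beta>: "\<And>d c\<^sub>0. balanced k c (card Q) m d c\<^sub>0 \<Longrightarrow> real (card \<Omega> ^ (2 * d) * (card \<Omega> choose c\<^sub>0)) \<le> \<beta>"
    and \<beta>0: "0 \<le> \<beta>"
  shows "real (card \<A>) \<le> 4 * real ((Suc k)\<^sup>2) * \<beta> * real ((Suc k * (s * L + 2) ^ (40 * k))\<^sup>2)"
proof -
  \<comment> \<open>Placeholders stand for what is not yet chosen; \<open>X\<close> and
    \<open>link\<close> do not depend on them.\<close>
  interpret c0: coset_code \<Omega> H m s L 40 \<chi> a Q \<A> "{}" "\<lambda>D. SOME x. x \<in> D" "\<lambda>_. {}"
    by unfold_locales (use \<chi> a coset some_in_eq in auto)
  have fin\<A>: "finite \<A>" by (rule finite_subset[OF _ finite_H]) (use c0.\<A>_H in blast)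
  have Xsupp: "c0.X h \<subseteq> perm_supp h" for h
    by (auto simp: c0.X_def c0.star_def perm_supp_def)
  have \<A>\<Omega>: "perm_supp h \<subseteq> \<Omega>" if "h \<in> \<A>" for h by (rule supp_subset[OF c0.\<A>_H[OF that]])
  have finsupp: "finite (perm_supp h)" if "h \<in> \<A>" for h by (rule finite_supp[OF c0.\<A>_H[OF that]])
  have link: "c0.link u \<subseteq> {..<s} \<and> z < card (c0.link u)" if h: "h \<in> \<A>" and u: "u \<in> c0.X h" for h u
  proof -
    have act: "c0.active u" using u by (simp add: c0.X_def)
    have "u \<in> perm_supp h" using Xsupp u by blast
    then have "\<not> card (c0.link u) \<le> z" using good[OF h] c0.link(1,2)[OF act] unfolding good_def by (meson not_less)
    then show ?thesis using c0.link(1)[OF act] by simp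
  qed
  have "\<exists>B\<subseteq>{..<s}. card \<A> \<le> 2 * card {h \<in> \<A>.
      real (card {u \<in> c0.X h. \<chi> u \<in> B \<or> c0.link u \<inter> B = {}}) \<le> 2 * (1 / 1000) * card (c0.X h) \<and>
      real (card {u \<in> perm_supp h. \<chi> u \<in> B}) \<le> 2 * (1 / 1000) * card (perm_supp h)}"
  proof (rule ex_labeling[OF fin\<A> _ finsupp _ link N p])
    show "finite (c0.X h)" for h using fin by (simp add: c0.X_def)
    show "\<chi> u < s" if "h \<in> \<A>" "u \<in> c0.X h \<union> perm_supp h" for h u
      using that \<chi> \<A>\<Omega> by (auto simp: c0.X_def)
  qed auto
  then obtain B where B: "B \<subseteq> {..<s}" and half1: "card \<A> \<le> 2 * card {h \<in> \<A>.
      real (card {u \<in> c0.X h. \<chi> u \<in> B \<or> c0.link u \<inter> B = {}}) \<le> 2 * (1 / 1000) * card (c0.X h) \<and>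
      real (card {u \<in> perm_supp h. \<chi> u \<in> B}) \<le> 2 * (1 / 1000) * card (perm_supp h)}"
    by blast
  define \<A>2 where "\<A>2 = {h \<in> \<A>.
      real (card {u \<in> c0.X h. \<chi> u \<in> B \<or> c0.link u \<inter> B = {}}) \<le> 2 * (1 / 1000) * card (c0.X h) \<and>
      real (card {u \<in> perm_supp h. \<chi> u \<in> B}) \<le> 2 * (1 / 1000) * card (perm_supp h)}"
  have \<A>2: "\<A>2 \<subseteq> \<A>" "finite \<A>2" using fin\<A> by (auto simp: \<A>2_def)
  interpret c1: coset_code \<Omega> H m s L 40 \<chi> a Q \<A>2 B "\<lambda>D. SOME x. x \<in> D" "\<lambda>_. {}"
    by unfold_locales (use \<chi> a coset some_in_eq \<A>2 B in auto)
  define w where "w r = (\<Sum>h\<in>\<A>2. if r \<in> c1.Mv h then 1 / real (card (c1.Mv h)) else 0)" for r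
  \<comment> \<open>Least weight is wanted on blocks, which are finite; the other branch provides
    the member that the locale demands of every nonempty set.\<close>
  define rep where "rep D = (if finite D \<and> D \<noteq> {} then arg_min_on w D else SOME x. x \<in> D)" for D
  have rep_in: "rep D \<in> D" if "D \<noteq> {}" for D
    using that arg_min_if_finite(1)[of D w] some_in_eq[of D] by (auto simp: rep_def)
  have rep_min: "w (rep D) \<le> w r" if "finite D" "r \<in> D" for D r
    using that arg_min_least[of D r w] by (auto simp: rep_def)
  interpret c2: coset_code \<Omega> H m s L 40 \<chi> a Q \<A>2 B rep "\<lambda>_. {}"
    by unfold_locales (use \<chi> a coset rep_in \<A>2 B in auto)
  have "(\<Sum>h\<in>\<A>2. real (card (c2.Sig h)) / real (card (c2.Mv h))) \<le> 1 / real L * card \<A>2"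
    by (rule c2.card_Sig_average[OF \<A>2(2)]) (use L rep_min in \<open>auto simp: w_def\<close>)
  then have half2: "card \<A>2 \<le> 2 * card {h \<in> \<A>2. real (card (c2.Sig h)) / real (card (c2.Mv h)) \<le> 2 * (1 / real L)}"
    using L by (intro half_below_twice_average[OF \<A>2(2)]) auto
  define \<A>3 where "\<A>3 = {h \<in> \<A>2. real (card (c2.Sig h)) / real (card (c2.Mv h)) \<le> 2 * (1 / real L)}"
  have \<A>3: "\<A>3 \<subseteq> \<A>2" "finite \<A>3" "\<A>3 \<subseteq> \<A>" using \<A>2 by (auto simp: \<A>3_def)
  have cut: "cut_perm \<Omega> h 40" if "h \<in> \<A>" for h
    by unfold_locales (use fin permutes c0.\<A>_H[OF that] in auto)
  define W0 where "W0 h = {w \<in> perm_supp h. card (cyc h w) \<le> 40 \<and> cyc h w \<inter> c2.Y h = {} \<and> \<chi> w \<notin> B}" for h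
  \<comment> \<open>Membership in \<open>W0 h\<close> is a property of the whole cycle: a short
    cycle is a single segment and so has one colour.\<close>
  have W0_cyc: "cyc h w \<subseteq> W0 h" if h: "h \<in> \<A>" and w: "w \<in> W0 h" for h w
  proof
    interpret cp: cut_perm \<Omega> h 40 by (rule cut[OF h])
    fix v assume v: "v \<in> cyc h w"
    have ws: "w \<in> perm_supp h" "card (cyc h w) \<le> 40" using w by (auto simp: W0_def)
    have vs: "v \<in> perm_supp h" using cp.cyc_supp[OF ws(1)] v by blast
    have "cp.seg v = cp.seg w" by (rule cp.seg_short_cong[OF ws(2) v])
    then have "\<chi> v = \<chi> w"
      using seg_colour[OF h subsetD[OF \<A>\<Omega>[OF h] vs]] seg_colour[OF h subsetD[OF \<A>\<Omega>[OF h] ws(1)]] by simp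
    then show "v \<in> W0 h" using w vs cp.cyc_eq[OF v] by (simp add: W0_def)
  qed
  have "\<exists>U\<subseteq>W0 h. (\<forall>w\<in>U. cyc h w \<subseteq> U) \<and> 2 * card U < m \<and> (U = W0 h \<or> m \<le> 4 * card U)"
    if h: "h \<in> \<A>" for h
  proof -
    interpret cp: cut_perm \<Omega> h 40 by (rule cut[OF h])
    show ?thesis
    proof (rule cp.ex_cycle_union_in_range[of _ 40])
      show "finite (W0 h)" using finsupp[OF h] by (simp add: W0_def)
      show "\<And>w. w \<in> W0 h \<Longrightarrow> cyc h w \<subseteq> W0 h" by (rule W0_cyc[OF h])
    qed (use m in \<open>auto simp: W0_def\<close>)
  qed
  then obtain Om where Om: "\<And>h. h \<in> \<A> \<Longrightarrow> Om h \<subseteq> W0 h \<and> (\<forall>w\<in>Om h. cyc h w \<subseteq> Om h) \<and>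
      2 * card (Om h) < m \<and> (Om h = W0 h \<or> m \<le> 4 * card (Om h))"
    by metis
  interpret c3: coset_code_inj \<Omega> H m s L 40 \<chi> a Q \<A>3 B rep Om
  proof
    fix h h' assume "h \<in> \<A>3" "h' \<in> \<A>3"
    then show "\<And>u. u \<in> Q \<Longrightarrow> h u = h' u" using \<A>3(3) on_Q by blast
  next
    fix h assume "h \<in> \<A>3"
    then have h: "h \<in> \<A>" using \<A>3(3) by blast
    show "\<exists>g\<in>Nc \<chi> {..<s}. h = a \<circ> g" by (rule coset[OF h])
    show "cut_perm.cuts \<Omega> h 40 = Q" by (rule cuts[OF h])
    show "\<And>u. u \<in> \<Omega> \<Longrightarrow> \<chi> (cut_perm.seg h 40 u) = \<chi> u" by (rule seg_colour[OF h])
    show "\<And>w. w \<in> Om h \<Longrightarrow> \<chi> w \<notin> B" "2 * card (Om h) < m" "Om h \<subseteq> perm_supp h"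
      using Om[OF h] by (auto simp: W0_def)
  qed (use \<chi> a rep_in B md in auto)
  have stats: "balanced k c (card Q) m (card (c3.FX h \<union> c3.Sig h)) (card (c3.P h))" if h3: "h \<in> \<A>3" for h
  proof -
    have h: "h \<in> \<A>" using h3 \<A>3(3) by blast
    have h2: "h \<in> \<A>2" using h3 \<A>3(1) by blast
    have "c3.FX h = {u \<in> c0.X h. \<chi> u \<in> B \<or> c0.link u \<inter> B = {}}"
      by (auto simp: c3.FX_def c3.rough_def c0.X_def)
    then have FX: "500 * card (c3.FX h) \<le> card (c3.X h)" using h2 by (simp add: \<A>2_def)
    have Bs: "500 * card {w \<in> perm_supp h. \<chi> w \<in> B} \<le> card (perm_supp h)" using h2 by (simp add: \<A>2_def)
    have Sig: "500 * card (c3.Sig h) \<le> card (c3.Mv h)"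
    proof (cases "c3.Mv h = {}")
      case True
      then show ?thesis by (simp add: c3.Sig_def)
    next
      case False
      then have "0 < real (card (c3.Mv h))" using c3.finite_Mv by (simp add: card_gt_0_iff)
      moreover have "real (card (c3.Sig h)) / real (card (c3.Mv h)) \<le> 2 * (1 / real L)"
        using h3 by (simp add: \<A>3_def)
      ultimately have "real (card (c3.Sig h)) \<le> 2 * (1 / real L) * real (card (c3.Mv h))"
        by (simp add: pos_divide_le_eq)
      also have "\<dots> \<le> 1 / 500 * real (card (c3.Mv h))"
        using L by (intro mult_right_mono) (auto simp: field_simps)
      finally show ?thesis by simp
    qed
    show ?thesis
      using c3.balanced_stats[OF refl h3 _ _ _ FX Sig Bs] Om[OF h] k[OF h] c[OF h]
      unfolding W0_def by auto
  qed
  let ?T = "\<lambda>d c\<^sub>0. {h \<in> \<A>3. card (c3.FX h \<union> c3.Sig h) = d \<and> card (c3.P h) = c\<^sub>0}"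
  let ?W = "(Suc k * (s * L + 2) ^ (40 * k))\<^sup>2"
  have T: "real (card (?T d c\<^sub>0)) \<le> \<beta> * real ?W" for d c\<^sub>0
  proof (cases "?T d c\<^sub>0 = {}")
    case True
    show ?thesis unfolding True using \<beta>0 by simp
  next
    case False
    then obtain h where h: "h \<in> \<A>3" "card (c3.FX h \<union> c3.Sig h) = d" "card (c3.P h) = c\<^sub>0" by blast
    have bal: "balanced k c (card Q) m d c\<^sub>0" using stats[OF h(1)] unfolding h(2,3) .
    have "card (?T d c\<^sub>0) \<le> card \<Omega> ^ (2 * d) * (card \<Omega> choose c\<^sub>0) * ?W"
      by (rule c3.card_code_bound[OF s]) (use \<A>3(3) k in auto)
    then have "real (card (?T d c\<^sub>0)) \<le> real (card \<Omega> ^ (2 * d) * (card \<Omega> choose c\<^sub>0)) * real ?W"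
      unfolding of_nat_mult[symmetric] by (rule of_nat_mono)
    also have "\<dots> \<le> \<beta> * real ?W" by (intro mult_right_mono \<beta>[OF bal]) simp
    finally show ?thesis .
  qed
  have "\<A>3 \<subseteq> (\<Union>x\<in>{..k} \<times> {..k}. ?T (fst x) (snd x))"
  proof
    fix h assume h: "h \<in> \<A>3"
    then have hA: "h \<in> \<A>" using \<A>3(3) by blast
    have "c3.FX h \<union> c3.Sig h \<subseteq> perm_supp h" "c3.P h \<subseteq> perm_supp h"
      using c3.Y_supp[OF h] c3.P_supp[OF h] by (auto simp: c3.Y_def c3.Sig_def)
    then have "card (c3.FX h \<union> c3.Sig h) \<le> k" "card (c3.P h) \<le> k"
      using card_mono[OF finsupp[OF hA]] k[OF hA] by metis+
    then show "h \<in> (\<Union>x\<in>{..k} \<times> {..k}. ?T (fst x) (snd x))"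
      using h by (intro UN_I[of "(card (c3.FX h \<union> c3.Sig h), card (c3.P h))"]) auto
  qed
  then have "card \<A>3 \<le> card (\<Union>x\<in>{..k} \<times> {..k}. ?T (fst x) (snd x))"
    using \<A>3(2) by (intro card_mono) auto
  also have "\<dots> \<le> (\<Sum>x\<in>{..k} \<times> {..k}. card (?T (fst x) (snd x)))"
    using card_UN_le[of "{..k} \<times> {..k}" "\<lambda>x. ?T (fst x) (snd x)"] by simp
  finally have "real (card \<A>3) \<le> (\<Sum>x\<in>{..k} \<times> {..k}. real (card (?T (fst x) (snd x))))"
    unfolding of_nat_sum[symmetric] by (rule of_nat_mono)
  also have "\<dots> \<le> (\<Sum>x\<in>{..k} \<times> {..k}. \<beta> * real ?W)" by (rule sum_mono) (rule T)
  also have "\<dots> = real ((Suc k)\<^sup>2) * \<beta> * real ?W"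
    by (simp add: card_cartesian_product power2_eq_square)
  finally have "real (card \<A>3) \<le> real ((Suc k)\<^sup>2) * \<beta> * real ?W" .
  moreover have "card \<A> \<le> 4 * card \<A>3" using half1 half2 unfolding \<A>2_def[symmetric] \<A>3_def[symmetric] by linarith
  then have "real (card \<A>) \<le> 4 * real (card \<A>3)" by linarith
  ultimately show ?thesis by linarith
qed

end

section \<open>Averaging over all colourings\<close>

context perm_group begin

definition adapted :: "nat \<Rightarrow> nat \<Rightarrow> nat \<Rightarrow> (nat \<Rightarrow> nat) \<Rightarrow> (nat \<Rightarrow> nat) \<Rightarrow> bool" where
  "adapted s z L \<chi> h \<longleftrightarrow> (\<forall>u\<in>\<Omega>. \<chi> (cut_perm.seg h 40 u) = \<chi> u) \<and> (\<forall>u\<in>perm_supp h. good s z L \<chi> u)"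

lemma cut_40: "h \<in> H \<Longrightarrow> cut_perm \<Omega> h 40"
  by unfold_locales (auto simp: fin permutes)

text \<open>A colouring that is constant on segments is a function on the set \<open>R\<close> of
  their first points. By a union bound over the \<open>k\<close> points of the support, three
  quarters of these functions give only good points there. \<open>R\<close> contains the points
  fixed by \<open>h\<close>, which bounds its size from below.\<close>

lemma card_adapted:
  assumes md: "min_deg m" and h: "h \<in> H" and k: "card (perm_supp h) = k"
    and a: "0 < a" "120 * a \<le> m" and z: "z \<le> s" "0 < z" and \<kappa>: "8 ^ 40 * real z / real s \<le> 1"
    and un: "4 * real k * (real s ^ z * real (Suc (40 * a)) * (8 ^ 40 * real z / real s) ^ a) \<le> 1"
  shows "3 * real s ^ (card \<Omega> - k) \<le> 4 * real (card {\<chi> \<in> \<Omega> \<rightarrow>\<^sub>E {..<s}. adapted s z (Suc (40 * a)) \<chi> h})"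
proof -
  interpret c: cut_perm \<Omega> h 40 by (rule cut_40[OF h])
  define R where "R = c.seg ` \<Omega>"
  define C where "C = R \<rightarrow>\<^sub>E {..<s}"
  define \<phi> where "\<phi> f = restrict (f \<circ> c.seg) \<Omega>" for f :: "nat \<Rightarrow> nat"
  define bad where "bad x = {f \<in> C. \<not> good s z (Suc (40 * a)) (\<phi> f) x}" for x
  define \<epsilon> where "\<epsilon> = real s ^ z * real (Suc (40 * a)) * (8 ^ 40 * real z / real s) ^ a"
  have s: "0 < s" using z by simp
  have seg_\<Omega>: "c.seg u \<in> \<Omega>" if "u \<in> \<Omega>" for u using c.cyc_Omega[OF that] c.seg_in_cyc by blast
  have finR: "finite R" using fin by (simp add: R_def)
  have finC: "finite C" by (simp add: C_def finite_PiE finR)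
  have S: "perm_supp h \<subseteq> \<Omega>" "finite (perm_supp h)" using supp_subset finite_supp h by auto
  have inj: "inj_on \<phi> C"
  proof (rule inj_onI)
    fix f f' assume f: "f \<in> C" "f' \<in> C" "\<phi> f = \<phi> f'"
    show "f = f'"
    proof (rule PiE_ext[OF f(1,2)[unfolded C_def]])
      fix x assume "x \<in> R"
      then obtain u where u: "u \<in> \<Omega>" "x = c.seg u" by (auto simp: R_def)
      have "\<phi> f u = \<phi> f' u" by (simp only: f(3))
      then show "f x = f' x" using u by (simp add: \<phi>_def)
    qed
  qed
  have bad: "real (card (bad x)) \<le> real s ^ card R * \<epsilon>" if "x \<in> perm_supp h" for x
    unfolding bad_def C_def R_def \<phi>_def \<epsilon>_def
    by (rule card_bad_colourings[OF md])
      (use that S seg_\<Omega> c.card_le_seg_image a z \<kappa> in auto)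
  have "real (card (\<Union>x\<in>perm_supp h. bad x)) \<le> (\<Sum>x\<in>perm_supp h. real (card (bad x)))"
    unfolding of_nat_sum[symmetric] by (rule of_nat_mono[OF card_UN_le[OF S(2)]])
  also have "\<dots> \<le> real k * (real s ^ card R * \<epsilon>)"
    using sum_bounded_above[of "perm_supp h" "\<lambda>x. real (card (bad x))", OF bad] k by simp
  finally have "4 * real (card (\<Union>x\<in>perm_supp h. bad x)) \<le> real s ^ card R * (4 * real k * \<epsilon>)"
    by (simp add: mult.left_commute)
  also have "\<dots> \<le> real s ^ card R * 1" using un unfolding \<epsilon>_def by (intro mult_left_mono) auto
  finally have U: "4 * real (card (\<Union>x\<in>perm_supp h. bad x)) \<le> real s ^ card R" by simp
  have CR: "real (card C) = real s ^ card R" by (simp add: C_def card_funcsetE finR)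
  have "card C \<le> card (C - (\<Union>x\<in>perm_supp h. bad x)) + card (\<Union>x\<in>perm_supp h. bad x)"
    using diff_card_le_card_Diff[of "\<Union>x\<in>perm_supp h. bad x" C] finC S(2) by (auto simp: bad_def)
  then have "real (card C) \<le> real (card (C - (\<Union>x\<in>perm_supp h. bad x))) + real (card (\<Union>x\<in>perm_supp h. bad x))"
    unfolding of_nat_add[symmetric] by (rule of_nat_mono)
  then have 1: "3 * real s ^ card R \<le> 4 * real (card (C - (\<Union>x\<in>perm_supp h. bad x)))"
    using U CR by linarith
  have "\<phi> ` (C - (\<Union>x\<in>perm_supp h. bad x)) \<subseteq> {\<chi> \<in> \<Omega> \<rightarrow>\<^sub>E {..<s}. adapted s z (Suc (40 * a)) \<chi> h}"
  proof
    fix \<chi> assume "\<chi> \<in> \<phi> ` (C - (\<Union>x\<in>perm_supp h. bad x))"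
    then obtain f where f: "f \<in> C" "\<And>x. x \<in> perm_supp h \<Longrightarrow> f \<notin> bad x" "\<chi> = \<phi> f" by blast
    have "f (c.seg u) < s" if "u \<in> \<Omega>" for u
    proof -
      have "c.seg u \<in> R" using that by (simp add: R_def)
      then show ?thesis using f(1) PiE_mem[of f R "\<lambda>_. {..<s}" "c.seg u"] by (simp add: C_def)
    qed
    then have "\<chi> \<in> \<Omega> \<rightarrow>\<^sub>E {..<s}" by (auto simp: f(3) \<phi>_def)
    moreover have "adapted s z (Suc (40 * a)) \<chi> h"
      unfolding adapted_def using f seg_\<Omega> by (auto simp: \<phi>_def c.seg_seg bad_def)
    ultimately show "\<chi> \<in> {\<chi> \<in> \<Omega> \<rightarrow>\<^sub>E {..<s}. adapted s z (Suc (40 * a)) \<chi> h}" by blast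
  qed
  then have "card (\<phi> ` (C - (\<Union>x\<in>perm_supp h. bad x))) \<le> card {\<chi> \<in> \<Omega> \<rightarrow>\<^sub>E {..<s}. adapted s z (Suc (40 * a)) \<chi> h}"
    by (rule card_mono[rotated]) (simp add: fin finite_PiE)
  moreover have "card (\<phi> ` (C - (\<Union>x\<in>perm_supp h. bad x))) = card (C - (\<Union>x\<in>perm_supp h. bad x))"
    by (rule card_image[OF inj_on_subset[OF inj]]) blast
  ultimately have 2: "real (card (C - (\<Union>x\<in>perm_supp h. bad x))) \<le> real (card {\<chi> \<in> \<Omega> \<rightarrow>\<^sub>E {..<s}. adapted s z (Suc (40 * a)) \<chi> h})"
    by simp
  have "\<Omega> - perm_supp h \<subseteq> R"
  proof
    fix u assume u: "u \<in> \<Omega> - perm_supp h"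
    then have "c.seg u = u" by (intro c.seg_notin) blast
    then show "u \<in> R" using u unfolding R_def by (metis DiffD1 imageI)
  qed
  then have "card (\<Omega> - perm_supp h) \<le> card R" by (rule card_mono[OF finR])
  then have "card \<Omega> - k \<le> card R" using S k by (simp add: card_Diff_subset)
  then have "real s ^ (card \<Omega> - k) \<le> real s ^ card R" using s by (intro power_increasing) auto
  then show ?thesis using 1 2 by linarith
qed

text \<open>Off the cuts both elements preserve the colour, and on the cuts they coincide. If
  \<open>inv' a (h u)\<close> were a cut \<open>w\<close>, then \<open>h w = a w = h u\<close> would
  give \<open>w = u\<close>; so a point off the cuts is never mixed with a cut.\<close>

lemma coset_of_equal_cuts:
  assumes h: "h \<in> H" and a: "a \<in> H" and \<chi>: "\<And>u. u \<in> \<Omega> \<Longrightarrow> \<chi> u < s"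
    and col: "\<forall>u\<in>\<Omega>. \<chi> (cut_perm.seg h 40 u) = \<chi> u" "\<forall>u\<in>\<Omega>. \<chi> (cut_perm.seg a 40 u) = \<chi> u"
    and Q: "cut_perm.cuts \<Omega> h 40 = Q" "cut_perm.cuts \<Omega> a 40 = Q" "\<And>u. u \<in> Q \<Longrightarrow> h u = a u"
  shows "\<exists>g\<in>Nc \<chi> {..<s}. h = a \<circ> g"
proof (rule bexI)
  interpret c: cut_perm \<Omega> h 40 by (rule cut_40[OF h])
  interpret ca: cut_perm \<Omega> a 40 by (rule cut_40[OF a])
  show "h = a \<circ> (inv' a \<circ> h)" by (rule ext) (simp add: f_inv[OF a])
  have ch: "\<chi> (h u) = \<chi> u" if "u \<in> \<Omega>" "u \<notin> Q" for u
    using col(1)[rule_format, of "h u"] col(1)[rule_format, of u] c.seg_step[of u] that Q(1) c.in_Omega_h[of u] by simp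
  have ca: "\<chi> (a u) = \<chi> u" if "u \<in> \<Omega>" "u \<notin> Q" for u
    using col(2)[rule_format, of "a u"] col(2)[rule_format, of u] ca.seg_step[of u] that Q(2) ca.in_Omega_h[of u] by simp
  have "\<chi> (inv' a (h u)) = \<chi> u" for u
  proof (cases "u \<in> \<Omega> \<and> u \<notin> Q")
    case True
    define w where "w = inv' a (h u)"
    have aw: "a w = h u" by (simp add: w_def f_inv[OF a])
    have w\<Omega>: "w \<in> \<Omega>" using True aw c.in_Omega_h[of u] ca.in_Omega_h[of w] by simp
    have "w \<notin> Q"
    proof
      assume w: "w \<in> Q"
      then have "h w = h u" using Q(3) aw by simp
      then have "w = u" using inj_H[OF h] by blast
      then show False using w True by blast
    qed
    then show ?thesis using ca[OF w\<Omega>] ch[of u] True aw unfolding w_def by simp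
  next
    case False
    then have "h u = a u"
      using Q(3) permutes_not_in[OF permutes[OF h]] permutes_not_in[OF permutes[OF a]] by (cases "u \<in> \<Omega>") auto
    then show ?thesis by (simp add: inv_f[OF a])
  qed
  then show "inv' a \<circ> h \<in> Nc \<chi> {..<s}"
    using comp_in[OF inv_in[OF a] h] \<chi> by (simp add: Nc_def)
qed

text \<open>Elements with the same graph on their cuts lie in one coset. There are at most
  \<open>card \<Omega> ^ (2 * j)\<close> graphs with \<open>j\<close> cuts; dividing \<beta> by this
  number before \<open>coset_family_bound\<close> is applied lets the sum over the graphs restore
  \<beta>. Only the values of \<open>j\<close> cost a factor \<open>Suc k\<close>.\<close>

lemma card_adapted_family:
  fixes \<beta> :: real
  assumes md: "min_deg m" and m: "160 \<le> m" and L: "1000 \<le> L" and s: "0 < s" and N: "0 < N"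
    and p: "2 / real N + (1 - 1 / real N) ^ Suc z \<le> 1 / 1000"
    and \<chi>: "\<chi> \<in> \<Omega> \<rightarrow>\<^sub>E {..<s}"
    and \<A>: "\<A> \<subseteq> H" "\<And>h. h \<in> \<A> \<Longrightarrow> adapted s z L \<chi> h"
    and k: "\<And>h. h \<in> \<A> \<Longrightarrow> card (perm_supp h) = k"
    and c: "\<And>h. h \<in> \<A> \<Longrightarrow> card (finite_perm.base h ` perm_supp h) = c"
    and \<beta>: "\<And>j d c\<^sub>0. balanced k c j m d c\<^sub>0 \<Longrightarrow> real (card \<Omega> ^ (2 * (j + d)) * (card \<Omega> choose c\<^sub>0)) \<le> \<beta>"
    and \<beta>0: "0 \<le> \<beta>" and n: "0 < card \<Omega>"
  shows "real (card \<A>) \<le> real (Suc k) * (4 * real ((Suc k)\<^sup>2) * \<beta> * real ((Suc k * (s * L + 2) ^ (40 * k))\<^sup>2))"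
proof -
  define n where "n = card \<Omega>"
  define W where "W = real ((Suc k * (s * L + 2) ^ (40 * k))\<^sup>2)"
  define gr where "gr h = (\<lambda>u. (u, h u)) ` cut_perm.cuts \<Omega> h 40" for h :: "nat \<Rightarrow> nat"
  define \<T> where "\<T> j = {T. T \<subseteq> \<Omega> \<times> \<Omega> \<and> card T = j}" for j
  have fin\<T>: "finite (\<T> j)" for j using fin by (simp add: \<T>_def)
  have \<chi>s: "\<chi> u < s" if "u \<in> \<Omega>" for u using \<chi> that PiE_mem by fastforce
  have HA: "h \<in> H" if "h \<in> \<A>" for h using \<A>(1) that by blast
  have fst_gr: "fst ` gr h = cut_perm.cuts \<Omega> h 40" for h by (simp add: gr_def image_image)
  have card_gr: "card (gr h) = card (cut_perm.cuts \<Omega> h 40)" for h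
    unfolding gr_def by (rule card_image) (simp add: inj_on_def)
  have each: "real (card {h \<in> \<A>. gr h = T}) \<le> 4 * real ((Suc k)\<^sup>2) * (\<beta> / real n ^ (2 * j)) * W"
    if T: "T \<in> \<T> j" for T j
  proof (cases "{h \<in> \<A>. gr h = T} = {}")
    case True
    show ?thesis unfolding True using \<beta>0 by (simp add: W_def)
  next
    case False
    then obtain a where a: "a \<in> \<A>" "gr a = T" by blast
    have cutsT: "cut_perm.cuts \<Omega> h 40 = fst ` T" if "gr h = T" for h using fst_gr that by blast
    have cj: "card (fst ` T) = j"
      using card_gr[of a] cutsT[OF a(2)] a(2) T by (simp add: \<T>_def)
    have on_T: "h u = v" if "gr h = T" "(u, v) \<in> T" for h u v using that by (auto simp: gr_def)
    have agree: "h u = h' u" if "gr h = T" "gr h' = T" "u \<in> fst ` T" for h h' u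
      using on_T[OF that(1)] on_T[OF that(2)] that(3) by fastforce
    show ?thesis unfolding W_def
    proof (rule coset_family_bound[OF md m L s N p, of \<chi> a _ "fst ` T"])
      show "a \<in> H" using a HA by blast
      fix h assume h: "h \<in> {h \<in> \<A>. gr h = T}"
      then have ad: "adapted s z L \<chi> h" "h \<in> H" using \<A> by blast+
      have ada: "adapted s z L \<chi> a" using \<A>(2)[OF a(1)] .
      show "\<exists>g\<in>Nc \<chi> {..<s}. h = a \<circ> g"
      proof (rule coset_of_equal_cuts[OF ad(2) HA[OF a(1)] \<chi>s])
        show "cut_perm.cuts \<Omega> h 40 = fst ` T" "cut_perm.cuts \<Omega> a 40 = fst ` T"
          by (rule cutsT, use h in simp) (rule cutsT[OF a(2)])
        show "h u = a u" if "u \<in> fst ` T" for u by (rule agree[of h a u, OF _ a(2) that]) (use h in simp)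
      qed (use ad(1) ada in \<open>auto simp: adapted_def\<close>)
      show "cut_perm.cuts \<Omega> h 40 = fst ` T" by (rule cutsT) (use h in simp)
      show "\<And>u. u \<in> \<Omega> \<Longrightarrow> \<chi> (cut_perm.seg h 40 u) = \<chi> u" using ad(1) by (simp add: adapted_def)
      show "\<And>u. u \<in> perm_supp h \<Longrightarrow> good s z L \<chi> u" using ad(1) by (simp add: adapted_def)
      show "card (perm_supp h) = k" by (rule k) (use h in simp)
      show "card (finite_perm.base h ` perm_supp h) = c" by (rule c) (use h in simp)
      fix h' u assume h': "h' \<in> {h \<in> \<A>. gr h = T}" and u: "u \<in> fst ` T"
      show "h u = h' u" by (rule agree[of h h' u]) (use h h' u in simp_all)
    next
      fix d c\<^sub>0 assume "balanced k c (card (fst ` T)) m d c\<^sub>0"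
      then have "real (n ^ (2 * (j + d)) * (n choose c\<^sub>0)) \<le> \<beta>"
        using \<beta>[of j d c\<^sub>0] cj by (simp add: n_def)
      moreover have "real (n ^ (2 * (j + d)) * (n choose c\<^sub>0)) = real n ^ (2 * j) * real (n ^ (2 * d) * (n choose c\<^sub>0))"
        by (simp add: power_add distrib_left)
      ultimately have "real n ^ (2 * j) * real (n ^ (2 * d) * (n choose c\<^sub>0)) \<le> \<beta>" by (simp only:)
      moreover have "0 < real n ^ (2 * j)" using n by (simp add: n_def)
      ultimately have "real (n ^ (2 * d) * (n choose c\<^sub>0)) \<le> \<beta> / real n ^ (2 * j)"
        by (simp only: pos_le_divide_eq mult.commute)
      then show "real (card \<Omega> ^ (2 * d) * (card \<Omega> choose c\<^sub>0)) \<le> \<beta> / real n ^ (2 * j)"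
        unfolding n_def .
    qed (use \<chi>s \<beta>0 in auto)
  qed
  have "\<A> \<subseteq> (\<Union>j\<in>{..k}. \<Union>T\<in>\<T> j. {h \<in> \<A>. gr h = T})"
  proof
    fix h assume h: "h \<in> \<A>"
    interpret cp: cut_perm \<Omega> h 40 by (rule cut_40[OF HA[OF h]])
    have "gr h \<subseteq> \<Omega> \<times> \<Omega>" using cp.cuts_subset cp.in_Omega_h by (auto simp: gr_def cp.long_def)
    moreover have "card (gr h) \<le> k"
      using card_mono[OF finite_supp[OF HA[OF h]] order_trans[OF cp.cuts_subset cp.long_supp]] k[OF h]
      by (simp add: card_gr)
    ultimately show "h \<in> (\<Union>j\<in>{..k}. \<Union>T\<in>\<T> j. {h \<in> \<A>. gr h = T})" using h by (auto simp: \<T>_def)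
  qed
  moreover have "finite (\<Union>j\<in>{..k}. \<Union>T\<in>\<T> j. {h \<in> \<A>. gr h = T})"
    using finite_subset[OF \<A>(1) finite_H] fin\<T> by simp
  ultimately have "card \<A> \<le> card (\<Union>j\<in>{..k}. \<Union>T\<in>\<T> j. {h \<in> \<A>. gr h = T})" by (intro card_mono)
  also have "\<dots> \<le> (\<Sum>j\<in>{..k}. card (\<Union>T\<in>\<T> j. {h \<in> \<A>. gr h = T}))" by (rule card_UN_le) simp
  also have "\<dots> \<le> (\<Sum>j\<in>{..k}. \<Sum>T\<in>\<T> j. card {h \<in> \<A>. gr h = T})" by (intro sum_mono card_UN_le fin\<T>)
  finally have "real (card \<A>) \<le> (\<Sum>j\<in>{..k}. \<Sum>T\<in>\<T> j. real (card {h \<in> \<A>. gr h = T}))"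
    unfolding of_nat_sum[symmetric] by (rule of_nat_mono)
  also have "\<dots> \<le> (\<Sum>j\<in>{..k}. 4 * real ((Suc k)\<^sup>2) * \<beta> * W)"
  proof (rule sum_mono)
    fix j assume "j \<in> {..k}"
    have "card (\<T> j) = n\<^sup>2 choose j"
      using n_subsets[of "\<Omega> \<times> \<Omega>" j] fin by (simp add: \<T>_def card_cartesian_product n_def power2_eq_square)
    also have "\<dots> \<le> (n\<^sup>2) ^ j" by (rule binomial_le_pow_all)
    finally have "real (card (\<T> j)) \<le> real ((n\<^sup>2) ^ j)" by (rule of_nat_mono)
    then have cT: "real (card (\<T> j)) \<le> real n ^ (2 * j)" by (simp add: power_mult)
    have "(\<Sum>T\<in>\<T> j. real (card {h \<in> \<A>. gr h = T})) \<le> real (card (\<T> j)) * (4 * real ((Suc k)\<^sup>2) * (\<beta> / real n ^ (2 * j)) * W)"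
      by (rule sum_bounded_above) (rule each)
    also have "\<dots> \<le> real n ^ (2 * j) * (4 * real ((Suc k)\<^sup>2) * (\<beta> / real n ^ (2 * j)) * W)"
      by (rule mult_right_mono[OF cT]) (use \<beta>0 in \<open>simp add: W_def\<close>)
    also have "\<dots> = 4 * real ((Suc k)\<^sup>2) * \<beta> * W" using n by (simp add: n_def)
    finally show "(\<Sum>T\<in>\<T> j. real (card {h \<in> \<A>. gr h = T})) \<le> 4 * real ((Suc k)\<^sup>2) * \<beta> * W" .
  qed
  also have "\<dots> = real (Suc k) * (4 * real ((Suc k)\<^sup>2) * \<beta> * W)" by simp
  finally show ?thesis unfolding W_def .
qed

text \<open>Double counting of pairs of an element and a colouring adapted to it. By
  \<open>card_adapted\<close> an element occurs with at least
  \<open>3/4 * s ^ (card \<Omega> - k)\<close> colourings, and a single colouring serves the family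
  of \<open>card_adapted_family\<close>; the quotient leaves \<open>s ^ k\<close>.\<close>

lemma card_class_bound:
  fixes \<beta> :: real
  assumes md: "min_deg m" and m: "160 \<le> m" and s: "0 < s" and N: "0 < N"
    and p: "2 / real N + (1 - 1 / real N) ^ Suc z \<le> 1 / 1000"
    and a: "25 \<le> a" "120 * a \<le> m" and z: "z \<le> s" "0 < z" and \<kappa>: "8 ^ 40 * real z / real s \<le> 1"
    and un: "4 * real k * (real s ^ z * real (Suc (40 * a)) * (8 ^ 40 * real z / real s) ^ a) \<le> 1"
    and \<beta>: "\<And>j d c\<^sub>0. balanced k c j m d c\<^sub>0 \<Longrightarrow> real (card \<Omega> ^ (2 * (j + d)) * (card \<Omega> choose c\<^sub>0)) \<le> \<beta>"
    and \<beta>0: "0 \<le> \<beta>" and n: "0 < card \<Omega>" "k \<le> card \<Omega>"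
  shows "3 * real (card {h \<in> H. card (perm_supp h) = k \<and> card (finite_perm.base h ` perm_supp h) = c})
    \<le> 4 * real s ^ k * (real (Suc k) * (4 * real ((Suc k)\<^sup>2) * \<beta> * real ((Suc k * (s * Suc (40 * a) + 2) ^ (40 * k))\<^sup>2)))"
proof -
  define \<A> where "\<A> = {h \<in> H. card (perm_supp h) = k \<and> card (finite_perm.base h ` perm_supp h) = c}"
  define \<Xi> where "\<Xi> = (\<Omega> \<rightarrow>\<^sub>E {..<s})"
  define M where "M = real (Suc k) * (4 * real ((Suc k)\<^sup>2) * \<beta> * real ((Suc k * (s * Suc (40 * a) + 2) ^ (40 * k))\<^sup>2))"
  have fin\<A>: "finite \<A>" using finite_H by (simp add: \<A>_def)
  have fin\<Xi>: "finite \<Xi>" using fin by (simp add: \<Xi>_def finite_PiE)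
  have c1: "real (card {x \<in> A. P x}) = (\<Sum>x\<in>A. if P x then 1 else 0)" if "finite A" for A :: "'z set" and P
    using that by (simp add: sum.If_cases Int_def)
  have "real (card \<A>) * (3 * real s ^ (card \<Omega> - k)) = (\<Sum>h\<in>\<A>. 3 * real s ^ (card \<Omega> - k))" by simp
  also have "\<dots> \<le> (\<Sum>h\<in>\<A>. 4 * real (card {\<chi> \<in> \<Xi>. adapted s z (Suc (40 * a)) \<chi> h}))"
    unfolding \<Xi>_def
    by (intro sum_mono card_adapted[OF md _ _ _ a(2) z \<kappa> un]) (use a(1) in \<open>auto simp: \<A>_def\<close>)
  also have "\<dots> = 4 * (\<Sum>h\<in>\<A>. \<Sum>\<chi>\<in>\<Xi>. if adapted s z (Suc (40 * a)) \<chi> h then 1 else 0)"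
    by (simp only: c1[OF fin\<Xi>] sum_distrib_left)
  also have "\<dots> = 4 * (\<Sum>\<chi>\<in>\<Xi>. \<Sum>h\<in>\<A>. if adapted s z (Suc (40 * a)) \<chi> h then 1 else 0)"
    by (subst sum.swap) simp
  also have "\<dots> = 4 * (\<Sum>\<chi>\<in>\<Xi>. real (card {h \<in> \<A>. adapted s z (Suc (40 * a)) \<chi> h}))"
    by (simp only: c1[OF fin\<A>])
  also have "(\<Sum>\<chi>\<in>\<Xi>. real (card {h \<in> \<A>. adapted s z (Suc (40 * a)) \<chi> h})) \<le> (\<Sum>\<chi>\<in>\<Xi>. M)"
  proof (rule sum_mono)
    fix \<chi> assume "\<chi> \<in> \<Xi>"
    then show "real (card {h \<in> \<A>. adapted s z (Suc (40 * a)) \<chi> h}) \<le> M"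
      unfolding M_def using a(1)
      by (intro card_adapted_family[OF md m _ s N p, of _ \<chi>] \<beta> \<beta>0 n(1)) (auto simp: \<Xi>_def \<A>_def)
  qed
  also have "(\<Sum>\<chi>\<in>\<Xi>. M) = real s ^ card \<Omega> * M" by (simp add: \<Xi>_def card_funcsetE fin)
  also have "real s ^ card \<Omega> = real s ^ k * real s ^ (card \<Omega> - k)"
    using n(2) by (simp flip: power_add)
  finally have "(3 * real (card \<A>)) * real s ^ (card \<Omega> - k) \<le> (4 * real s ^ k * M) * real s ^ (card \<Omega> - k)"
    by (simp add: mult_ac)
  then have "3 * real (card \<A>) \<le> 4 * real s ^ k * M"
    by (rule mult_right_le_imp_le) (use s in simp)
  then show ?thesis unfolding \<A>_def M_def .
qed

end

section \<open>Numerical estimates\<close>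

lemma power_le_fact_exp:
  fixes x :: real assumes "0 \<le> x" shows "x ^ c \<le> fact c * exp x"
proof -
  have "x ^ c / fact c \<le> (\<Sum>i\<le>c. x ^ i / fact i)"
    by (rule member_le_sum[of c "{..c}" "\<lambda>i. x ^ i / fact i"]) (use assms in auto)
  also have "\<dots> = (\<Sum>i\<in>{..c}. x ^ i /\<^sub>R fact i)" by (simp add: field_simps)
  also have "\<dots> \<le> exp x"
    unfolding exp_def by (rule sum_le_suminf[OF summable_exp_generic]) (use assms in auto)
  finally show ?thesis by (simp add: field_simps)
qed

text \<open>The bound holds for any \<open>k\<close>, since \<open>k ^ c / c!\<close> is one term of
  the series of \<open>exp k\<close>. It is applied with the support size as \<open>k\<close>, so
  that its power of \<open>k\<close> can be compared with that in the class size.\<close>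

lemma binomial_le_exp:
  fixes k n c :: nat
  assumes "0 < k" "0 < n"
  shows "real (n choose c) \<le> exp (real c * (ln n - ln k) + k)"
proof -
  have "real (n choose c) * fact c \<le> real n ^ c"
    by (metis binomial_fact_pow of_nat_fact of_nat_le_iff of_nat_mult of_nat_power)
  also have "\<dots> = exp (real c * ln n)" using assms by (simp add: exp_of_nat_mult)
  finally have 1: "real (n choose c) * fact c \<le> exp (real c * ln n)" .
  have "exp (real c * ln k) \<le> fact c * exp (real k)"
    using power_le_fact_exp[of "real k" c] assms by (simp add: exp_of_nat_mult)
  then have "real (n choose c) * exp (real c * ln k) \<le> real (n choose c) * (fact c * exp (real k))"
    by (rule mult_left_mono) simp
  also have "\<dots> \<le> exp (real c * ln n) * exp (real k)" using mult_right_mono[OF 1, of "exp (real k)"] by (simp add: mult.assoc)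
  finally have "real (n choose c) \<le> exp (real c * ln n) * exp (real k) / exp (real c * ln k)"
    by (simp add: pos_le_divide_eq)
  also have "\<dots> = exp (real c * (ln n - ln k) + k)"
    by (simp add: right_diff_distrib exp_diff exp_add)
  finally show ?thesis .
qed

text \<open>A linear programming certificate: the difference \<open>A\<close> of the exponents is a
  combination, with nonnegative multipliers, of the slacks of the constraints in
  \<open>balanced\<close> and of terms that are nonnegative because
  \<open>\<mu> \<le> \<nu>\<close>. The tight kind is \<open>k\<^sub>y\<close>: of its 1/2, explicit
  values take 1/125 and the powers of \<open>k\<close> take 3/8, which leaves 117/1000 for
  \<open>m / 40\<close>.\<close>

lemma balanced_exponent:
  assumes bal: "balanced k c j m d c\<^sub>0" and k: "0 < k" "m \<le> k" "k \<le> n"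
  shows "real (n ^ (2 * (j + d)) * (n choose c\<^sub>0))
    \<le> exp (k / 2 * ln n - c / 2 * ln k + k - k / 8 * ln k - m / 40 * ln n)"
proof -
  obtain k\<^sub>q k\<^sub>o k\<^sub>y k\<^sub>l where b: "k = k\<^sub>q + k\<^sub>o + k\<^sub>y + k\<^sub>l" "2 * c\<^sub>0 \<le> k\<^sub>q"
      "80 * c \<le> 80 * c\<^sub>0 + 40 * k\<^sub>o + 40 * k\<^sub>y + 2 * k\<^sub>l" "250 * d \<le> k\<^sub>y + k\<^sub>l" "20 * j \<le> k\<^sub>l"
     "m \<le> 4 * k\<^sub>o \<or> 500 * k\<^sub>q \<le> k"
    using bal unfolding balanced_def by blast
  define \<mu> \<nu> where "\<mu> = ln (real k)" and "\<nu> = ln (real n)"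
  have l: "0 \<le> \<mu>" "\<mu> \<le> \<nu>" using k by (auto simp: \<mu>_def \<nu>_def)
  have "real (n ^ (2 * (j + d)) * (n choose c\<^sub>0)) \<le> exp (real (2 * (j + d)) * \<nu>) * exp (real c\<^sub>0 * (\<nu> - \<mu>) + k)"
  proof -
    have "real n ^ (2 * (j + d)) = exp (real (2 * (j + d)) * \<nu>)"
      using k unfolding exp_of_nat_mult \<nu>_def by simp
    moreover have "real (n choose c\<^sub>0) \<le> exp (real c\<^sub>0 * (\<nu> - \<mu>) + k)"
      unfolding \<mu>_def \<nu>_def using k by (intro binomial_le_exp) auto
    ultimately show ?thesis unfolding of_nat_mult of_nat_power by (intro mult_mono) auto
  qed
  also have "\<dots> = exp (2 * (real j + real d) * \<nu> + real c\<^sub>0 * (\<nu> - \<mu>) + k)"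
    unfolding exp_add[symmetric] by simp
  also have "\<dots> \<le> exp (k / 2 * \<nu> - c / 2 * \<mu> + k - k / 8 * \<mu> - m / 40 * \<nu>)"
  proof -
    have r: "real k = real k\<^sub>q + real k\<^sub>o + real k\<^sub>y + real k\<^sub>l" "2 * real c\<^sub>0 \<le> real k\<^sub>q"
      "80 * real c \<le> 80 * real c\<^sub>0 + 40 * real k\<^sub>o + 40 * real k\<^sub>y + 2 * real k\<^sub>l"
      "250 * real d \<le> real k\<^sub>y + real k\<^sub>l" "20 * real j \<le> real k\<^sub>l" using b(1-5) by linarith+
    \<comment> \<open>Either \<open>m \<le> 4 * k\<^sub>o\<close>, or \<open>k\<^sub>q\<close> is at
      most 1/500 of \<open>k\<close> and \<open>r\<close> is almost all of \<open>k\<close>, which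
      is at least \<open>m\<close>.\<close>
    have "25 * m \<le> 117 * r" if "k = k\<^sub>q + r" "k\<^sub>o \<le> r" for r
      using b(6)
    proof
      assume "500 * k\<^sub>q \<le> k"
      then have "499 * k\<^sub>q \<le> r" using that by linarith
      then have "499 * k \<le> 500 * r" using that by linarith
      then show ?thesis using k(2) by linarith
    qed (use that in linarith)
    from this[of "k\<^sub>o + k\<^sub>y + k\<^sub>l"] have "25 * m \<le> 117 * (k\<^sub>o + k\<^sub>y + k\<^sub>l)" using b(1) by simp
    then have "real (25 * m) \<le> real (117 * (k\<^sub>o + k\<^sub>y + k\<^sub>l))" by (rule of_nat_mono)
    then have m40: "25 * real m \<le> 117 * (real k\<^sub>o + real k\<^sub>y + real k\<^sub>l)" by simp
    define A where "A = k / 2 * \<nu> - c / 2 * \<mu> + k - k / 8 * \<mu> - m / 40 * \<nu>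
      - (2 * (real j + real d) * \<nu> + real c\<^sub>0 * (\<nu> - \<mu>) + k)"
    have "A = (real k\<^sub>l / 10 - 2 * real j) * \<nu> + ((real k\<^sub>y + real k\<^sub>l) / 125 - 2 * real d) * \<nu>
      + ((real c\<^sub>0 / 2 + real k\<^sub>o / 4 + real k\<^sub>y / 4 + real k\<^sub>l / 80) - real c / 2) * \<mu>
      + (real k\<^sub>q / 2 - real c\<^sub>0) * (\<nu> - \<mu> / 2)
      + (117 * (real k\<^sub>o + real k\<^sub>y + real k\<^sub>l) - 25 * real m) / 1000 * \<nu>
      + (real k\<^sub>q / 8 * \<mu> + real k\<^sub>o * (383 / 1000 * \<nu> - 3 / 8 * \<mu>)
        + real k\<^sub>y * (3 / 8 * \<nu> - 3 / 8 * \<mu>) + real k\<^sub>l * (275 / 1000 * \<nu> - 11 / 80 * \<mu>))"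
      unfolding A_def r(1) by (simp add: field_simps)
    moreover have "0 \<le> \<dots>"
    proof (intro add_nonneg_nonneg mult_nonneg_nonneg)
      show "0 \<le> real k\<^sub>l / 10 - 2 * real j" "0 \<le> (real k\<^sub>y + real k\<^sub>l) / 125 - 2 * real d"
        "0 \<le> real k\<^sub>q / 2 - real c\<^sub>0" using r by simp_all
      show "0 \<le> (real c\<^sub>0 / 2 + real k\<^sub>o / 4 + real k\<^sub>y / 4 + real k\<^sub>l / 80) - real c / 2"
        using r(3) by simp
      show "0 \<le> (117 * (real k\<^sub>o + real k\<^sub>y + real k\<^sub>l) - 25 * real m) / 1000" using m40 by simp
    qed (use l in simp_all)
    ultimately have "2 * (real j + real d) * \<nu> + real c\<^sub>0 * (\<nu> - \<mu>) + k \<le> k / 2 * \<nu> - c / 2 * \<mu> + k - k / 8 * \<mu> - m / 40 * \<nu>"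
      unfolding A_def by linarith
    then show ?thesis by simp
  qed
  finally show ?thesis unfolding \<mu>_def \<nu>_def .
qed

lemma ex_root_ceiling:
  fixes k e :: nat
  assumes "0 < k" "0 < e"
  shows "\<exists>s::nat. 0 < s \<and> k \<le> s ^ e \<and> exp (ln k / e) \<le> real s \<and> real s \<le> exp (1 + ln k / e)"
proof (intro exI conjI)
  define x where "x = exp (ln (real k) / e)"
  have x1: "1 \<le> x" using assms by (simp add: x_def)
  define s where "s = nat \<lceil>x\<rceil>"
  have xs: "x \<le> real s" unfolding s_def by (rule real_nat_ceiling_ge)
  show "exp (ln (real k) / e) \<le> real s" using xs by (simp add: x_def)
  show "0 < s" using xs x1 by linarith
  have "real s \<le> x + 1" using x1 unfolding s_def by linarith
  also have "\<dots> \<le> 2 * x" using x1 by simp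
  also have "\<dots> \<le> exp 1 * x" using exp_ge_add_one_self[of 1] x1 by (intro mult_right_mono) auto
  finally show "real s \<le> exp (1 + ln k / e)" by (simp add: x_def exp_add)
  have "real k = x ^ e" using assms by (simp add: x_def flip: exp_of_nat_mult)
  also have "\<dots> \<le> real s ^ e" using xs x1 by (intro power_mono) auto
  finally show "k \<le> s ^ e" by (simp only: of_nat_power[symmetric] of_nat_le_iff)
qed

text \<open>The first term is 1/2000. Since 44001/4000 exceeds 11, the second is at most exp(-11),
  which is below 1/2048.\<close>

lemma labelling_parameters: "2 / real 4000 + (1 - 1 / real 4000) ^ Suc 44000 \<le> 1 / 1000"
proof -
  have "(1 - 1 / real 4000) \<le> exp (- (1 / 4000))" using exp_ge_add_one_self[of "- (1 / 4000)"] by simp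
  then have "(1 - 1 / real 4000) ^ Suc 44000 \<le> exp (- (1 / 4000)) ^ Suc 44000" by (intro power_mono) auto
  also have "\<dots> = exp (real (Suc 44000) * - (1 / 4000))" by (rule exp_of_nat_mult[symmetric])
  also have "\<dots> \<le> exp (- 11)" by simp
  also have "\<dots> = 1 / exp 1 ^ 11" by (simp add: exp_minus inverse_eq_divide flip: exp_of_nat_mult)
  also have "\<dots> \<le> 1 / 2 ^ 11"
    using exp_ge_add_one_self[of 1] by (intro divide_left_mono power_mono) auto
  finally show ?thesis by simp
qed

text \<open>
  The exponential factor bounds \<open>1 / sqrt \<bar>h\<^sup>G\<bar>\<close> for \<open>h\<close> in the counted set. With \<open>s\<close> of size about
  \<open>k powr (1/2000)\<close> all powers of \<open>s\<close> in the counting bound are absorbed by the factor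
  \<open>k powr (k/8)\<close> gained in \<open>balanced_exponent\<close>.
\<close>

lemma class_weight_bound:
  "\<exists>m\<^sub>0>0. \<forall>\<Omega> H (m::nat) (k::nat) (c::nat). perm_group \<Omega> H \<longrightarrow> perm_group.min_deg H m \<longrightarrow> m\<^sub>0 \<le> m \<longrightarrow> m \<le> k \<longrightarrow> k \<le> card \<Omega> \<longrightarrow>
     real (card {h \<in> H. card (perm_supp h) = k \<and> card (finite_perm.base h ` perm_supp h) = c})
       * exp (k / 2 - k / 2 * ln (card \<Omega>) + c / 2 * ln k) \<le> exp (- (m / 40 * ln (card \<Omega>)))"
proof -
  \<comment> \<open>With \<open>\<kappa>\<^sup>2 \<le> 1 / s\<close> this \<open>a\<close> gives
    \<open>\<kappa> ^ a \<le> 1 / s ^ (z + e + 1)\<close>. The exponent pays for the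
    \<open>s ^ z\<close> sets of colours, for the \<open>k \<le> s ^ e\<close> points of the
    support, and with one more \<open>s\<close> for the constant \<open>4 * L\<close>. The three
    summands of \<open>M\<close> ensure \<open>\<kappa>\<^sup>2 \<le> 1 / s\<close>,
    \<open>4 * L \<le> s\<close> and \<open>z \<le> s\<close>.\<close>
  define z e a L :: nat where "z = 44000" and "e = 2000" and "a = 2 * (z + e + 1)" and "L = Suc (40 * a)"
  define M where "M = (8 ^ 40 * real z)\<^sup>2 + 4 * real L + real z"
  define \<Lambda> where "\<Lambda> = max (e * ln M) (3600 + 3200 * ln (real L + 2))"
  obtain m\<^sub>1 :: nat where m1: "exp \<Lambda> \<le> m\<^sub>1" using real_arch_simple by blast
  define m\<^sub>0 where "m\<^sub>0 = Suc (m\<^sub>1 + 160 + 120 * a)"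
  have z1: "1 \<le> real z" by (simp add: z_def)
  have M1: "1 \<le> M" using z1 by (simp add: M_def add_increasing)
  show ?thesis
  proof (intro exI[of _ m\<^sub>0] conjI allI impI)
    show "0 < m\<^sub>0" by (simp add: m\<^sub>0_def)
    fix \<Omega> H m k c
    assume "perm_group \<Omega> H" and md: "perm_group.min_deg H m" and m: "m\<^sub>0 \<le> m" "m \<le> k" and kn: "k \<le> card \<Omega>"
    interpret perm_group \<Omega> H by fact
    define N where "N = real (card {h \<in> H. card (perm_supp h) = k \<and> card (finite_perm.base h ` perm_supp h) = c})"
    define n where "n = card \<Omega>"
    define \<mu> \<nu> where "\<mu> = ln (real k)" and "\<nu> = ln (real n)"
    have k0: "0 < k" using m by (simp add: m\<^sub>0_def)
    have n0: "0 < n" using k0 kn by (simp add: n_def)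
    have "exp \<Lambda> \<le> real k" using m1 m by (simp add: m\<^sub>0_def)
    then have \<Lambda>: "\<Lambda> \<le> \<mu>" using k0 by (simp add: \<mu>_def ln_ge_iff)
    obtain s where s: "0 < s" "k \<le> s ^ e" "exp (\<mu> / e) \<le> real s" "real s \<le> exp (1 + \<mu> / e)"
      using ex_root_ceiling[OF k0, of e] unfolding \<mu>_def e_def by auto
    have "M = exp (ln M)" using M1 by simp
    also have "\<dots> \<le> exp (\<mu> / e)" using \<Lambda> by (simp add: \<Lambda>_def e_def)
    also note s(3)
    finally have Ms: "M \<le> real s" .
    have parts: "0 \<le> (8 ^ 40 * real z)\<^sup>2" "0 \<le> real L" "0 \<le> real z" by simp_all
    have "real z \<le> real s" using Ms parts unfolding M_def by linarith
    then have zs: "z \<le> s" by simp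
    have Ls: "4 * real L \<le> real s" using Ms parts unfolding M_def by linarith
    have ks: "(8 ^ 40 * real z)\<^sup>2 \<le> real s" using Ms parts unfolding M_def by linarith
    define \<kappa> where "\<kappa> = 8 ^ 40 * real z / real s"
    have \<kappa>0: "0 \<le> \<kappa>" by (simp add: \<kappa>_def)
    have "\<kappa>\<^sup>2 = (8 ^ 40 * real z)\<^sup>2 / real s / real s" by (simp add: \<kappa>_def power_divide power2_eq_square)
    also have "\<dots> \<le> 1 / real s" using ks s(1) by (intro divide_right_mono) (auto simp: divide_le_eq)
    finally have \<kappa>2: "\<kappa>\<^sup>2 \<le> 1 / real s" .
    have "1 / real s \<le> 1" using s(1) by simp
    then have "\<kappa>\<^sup>2 \<le> 1" using \<kappa>2 by linarith
    then have \<kappa>1: "\<kappa> \<le> 1" using \<kappa>0 by (simp add: power_le_one_iff)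
    have "\<kappa> ^ a = (\<kappa>\<^sup>2) ^ (z + e + 1)" unfolding a_def by (rule power_mult)
    also have "\<dots> \<le> (1 / real s) ^ (z + e + 1)" using \<kappa>2 by (intro power_mono) auto
    finally have \<kappa>a: "\<kappa> ^ a \<le> 1 / real s ^ (z + e + 1)" by (simp add: power_one_over)
    have un: "4 * real k * (real s ^ z * real L * \<kappa> ^ a) \<le> 1"
    proof -
      have "real k \<le> real s ^ e" using s(2) by (simp only: of_nat_power[symmetric] of_nat_le_iff)
      then have "4 * real k * (real s ^ z * real L * \<kappa> ^ a) \<le> 4 * real s ^ e * (real s ^ z * real L * (1 / real s ^ (z + e + 1)))"
        using \<kappa>a \<kappa>0 by (intro mult_mono) auto
      also have "\<dots> = 4 * real L / real s" using s(1) by (simp add: power_add)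
      also have "\<dots> \<le> 1" using Ls s(1) by (simp add: divide_le_eq)
      finally show ?thesis .
    qed
    define \<beta> where "\<beta> = exp (k / 2 * \<nu> - c / 2 * \<mu> + k - k / 8 * \<mu> - m / 40 * \<nu>)"
    have "3 * N \<le> 4 * real s ^ k * (real (Suc k) * (4 * real ((Suc k)\<^sup>2) * \<beta> * real ((Suc k * (s * L + 2) ^ (40 * k))\<^sup>2)))"
      unfolding N_def L_def
    proof (rule card_class_bound[OF md, of _ 4000 z])
      show "120 * a \<le> m" "160 \<le> m" using m(1) by (simp_all add: m\<^sub>0_def)
      show "25 \<le> a" by (simp add: a_def e_def)
      show "2 / real 4000 + (1 - 1 / real 4000) ^ Suc z \<le> 1 / 1000"
        using labelling_parameters unfolding z_def .
      show "8 ^ 40 * real z / real s \<le> 1" using \<kappa>1 by (simp only: \<kappa>_def)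
      show "4 * real k * (real s ^ z * real (Suc (40 * a)) * (8 ^ 40 * real z / real s) ^ a) \<le> 1"
        using un by (simp only: \<kappa>_def L_def)
      show "real (card \<Omega> ^ (2 * (j + d)) * (card \<Omega> choose c\<^sub>0)) \<le> \<beta>" if "balanced k c j m d c\<^sub>0" for j d c\<^sub>0
        unfolding \<beta>_def \<nu>_def \<mu>_def n_def using that k0 m(2) kn by (rule balanced_exponent)
      show "0 < z" by (simp add: z_def)
      show "0 < card \<Omega>" using n0 by (simp add: n_def)
    qed (use s(1) zs kn \<beta>_def in auto)
    also have "\<dots> = 16 * (real (Suc k) ^ 5 * (real s ^ k * (real s * real L + 2) ^ (80 * k)) * \<beta>)"
    proof -
      have "4 * S * (K * (4 * K\<^sup>2 * B * (K * W)\<^sup>2)) = 16 * (K ^ 5 * (S * W\<^sup>2) * B)" for S K B W :: real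
        by (simp add: power2_eq_square) (simp add: numeral_eq_Suc)
      note this[of "real s ^ k" "real (Suc k)" \<beta> "(real s * real L + 2) ^ (40 * k)"]
      moreover have "40 * k * 2 = 80 * k" by simp
      then have "((real s * real L + 2) ^ (40 * k))\<^sup>2 = (real s * real L + 2) ^ (80 * k)"
        by (simp only: power_mult[symmetric])
      ultimately show ?thesis by (simp only: of_nat_mult of_nat_power of_nat_add of_nat_numeral)
    qed
    finally have N: "3 * N \<le> 16 * (real (Suc k) ^ 5 * (real s ^ k * (real s * real L + 2) ^ (80 * k)) * \<beta>)" .
    define \<gamma> where "\<gamma> = 1 + \<mu> / e"
    have "16 * (real (Suc k) ^ 5 * (real s ^ k * (real s * real L + 2) ^ (80 * k)) * \<beta>)
      \<le> exp (3 * real k) * (exp (5 * real k) * (exp (real k * \<gamma>) * exp (80 * real k * (\<gamma> + ln (real L + 2)))) * \<beta>)"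
    proof (intro mult_mono)
      have "(16::real) \<le> 2 ^ (3 * 2)" by simp
      also have "(2::real) ^ (3 * 2) \<le> 2 ^ (3 * k)"
        using m by (intro power_increasing) (auto simp: m\<^sub>0_def)
      also have "\<dots> \<le> exp 1 ^ (3 * k)" using exp_ge_add_one_self[of 1] by (intro power_mono) auto
      also have "\<dots> = exp (3 * real k)" by (simp flip: exp_of_nat_mult)
      finally show "16 \<le> exp (3 * real k)" by simp
      have "real (Suc k) ^ 5 \<le> exp (real k) ^ 5" using exp_ge_add_one_self[of "real k"] by (intro power_mono) auto
      then show "real (Suc k) ^ 5 \<le> exp (5 * real k)" by (simp flip: exp_of_nat_mult)
      have "real s ^ k \<le> exp \<gamma> ^ k" using s(4) by (intro power_mono) (auto simp: \<gamma>_def)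
      then show "real s ^ k \<le> exp (real k * \<gamma>)" by (simp flip: exp_of_nat_mult)
      have "real s * real L + 2 \<le> real s * (real L + 2)" using s(1) by (simp add: distrib_left)
      also have "\<dots> \<le> exp \<gamma> * exp (ln (real L + 2))" using s(4) by (intro mult_mono) (auto simp: \<gamma>_def)
      finally have "(real s * real L + 2) ^ (80 * k) \<le> exp (\<gamma> + ln (real L + 2)) ^ (80 * k)"
        by (intro power_mono) (auto simp: exp_add)
      also have "\<dots> = exp (80 * real k * (\<gamma> + ln (real L + 2)))" by (simp flip: exp_of_nat_mult)
      finally show "(real s * real L + 2) ^ (80 * k) \<le> exp (80 * real k * (\<gamma> + ln (real L + 2)))" .
    qed (auto simp: \<beta>_def)
    also have "\<dots> = exp (k * (8 + 81 * \<gamma> + 80 * ln (real L + 2))) * \<beta>"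
      by (simp add: algebra_simps flip: exp_add)
    \<comment> \<open>The powers of \<open>s\<close> contribute 81/2000 of \<mu>, well below 1/8;
      the rest is below the threshold built into \<Lambda>. The 3/2 consists of the summand
      \<open>k\<close> in \<beta> and the \<open>k / 2\<close> in the weight.\<close>
    also have "\<dots> \<le> exp (k * (\<mu> / 8 - 3 / 2)) * \<beta>"
    proof -
      have "3600 + 3200 * ln (real L + 2) \<le> \<mu>" using \<Lambda> by (simp add: \<Lambda>_def)
      moreover have "0 \<le> ln (real L + 2)" by simp
      moreover have "81 * \<gamma> = 81 + 81 / 2000 * \<mu>" by (simp add: \<gamma>_def e_def)
      ultimately have "8 + 81 * \<gamma> + 80 * ln (real L + 2) \<le> \<mu> / 8 - 3 / 2"
        by linarith
      then have "k * (8 + 81 * \<gamma> + 80 * ln (real L + 2)) \<le> k * (\<mu> / 8 - 3 / 2)" by (intro mult_left_mono) auto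
      then show ?thesis by (simp add: \<beta>_def)
    qed
    also have "\<dots> = exp (- (m / 40 * \<nu>)) * exp (- (k / 2 - k / 2 * \<nu> + c / 2 * \<mu>))"
      unfolding \<beta>_def exp_add[symmetric] by (simp add: algebra_simps)
    finally have "3 * N \<le> exp (- (m / 40 * \<nu>)) * exp (- (k / 2 - k / 2 * \<nu> + c / 2 * \<mu>))"
      using N by linarith
    moreover have "N \<le> 3 * N" by (simp add: N_def)
    ultimately have "N \<le> exp (- (m / 40 * \<nu>)) * exp (- (k / 2 - k / 2 * \<nu> + c / 2 * \<mu>))" by linarith
    then have "N * exp (k / 2 - k / 2 * \<nu> + c / 2 * \<mu>) \<le> exp (- (m / 40 * \<nu>)) * exp (- (k / 2 - k / 2 * \<nu> + c / 2 * \<mu>)) * exp (k / 2 - k / 2 * \<nu> + c / 2 * \<mu>)"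
      by (rule mult_right_mono) simp
    also have "\<dots> = exp (- (m / 40 * \<nu>))" unfolding mult.assoc exp_add[symmetric] by simp
    finally show "real (card {h \<in> H. card (perm_supp h) = k \<and> card (finite_perm.base h ` perm_supp h) = c})
       * exp (k / 2 - k / 2 * ln (card \<Omega>) + c / 2 * ln k) \<le> exp (- (m / 40 * ln (card \<Omega>)))"
      unfolding N_def \<nu>_def \<mu>_def n_def .
  qed
qed

subsection \<open>Schur's lemma and the convolution of characters\<close>


lemma subspace_vecI:
  assumes "W \<subseteq> carrier_vec d" "0\<^sub>v d \<in> W"
    and "\<And>v w. v \<in> W \<Longrightarrow> w \<in> W \<Longrightarrow> v + w \<in> W" "\<And>c v. v \<in> W \<Longrightarrow> c \<cdot>\<^sub>v v \<in> W"
  shows "VectorSpace.subspace class_ring W (module_vec TYPE(complex) d)"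
  using assms
  by (intro VectorSpace.subspace.intro LinearCombinations.submodule.intro vec_vs vec_module)
    (auto simp: module_vec_simps class_ring_simps)

lemma irr_repD:
  assumes "(d, \<rho>) \<in> irreducible_reps G"
  shows "0 < d" "\<And>x y. x \<in> carrier G \<Longrightarrow> y \<in> carrier G \<Longrightarrow> \<rho> (x \<otimes>\<^bsub>G\<^esub> y) = \<rho> x * \<rho> y"
    "\<And>W. VectorSpace.subspace class_ring W (module_vec TYPE(complex) d) \<Longrightarrow>
       (\<And>g v. g \<in> carrier G \<Longrightarrow> v \<in> W \<Longrightarrow> \<rho> g *\<^sub>v v \<in> W) \<Longrightarrow> W = {0\<^sub>v d} \<or> W = carrier_vec d"
  using assms by (auto simp: irreducible_reps_def mat_reps_def hom_def units_of_def ring_mat_def)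

lemma irr_rep_one:
  assumes "group G" "(d, \<rho>) \<in> irreducible_reps G"
  shows "\<rho> \<one>\<^bsub>G\<^esub> = 1\<^sub>m d"
proof -
  interpret group G by fact
  have "\<rho> \<one>\<^bsub>G\<^esub> \<in> carrier (GL d)" using assms(2) by (auto simp: irreducible_reps_def mat_reps_def hom_def)
  then obtain Q where c: "\<rho> \<one>\<^bsub>G\<^esub> \<in> carrier_mat d d" "Q \<in> carrier_mat d d" "\<rho> \<one>\<^bsub>G\<^esub> * Q = 1\<^sub>m d"
    by (auto simp: GL_carrier_iff)
  have "\<rho> \<one>\<^bsub>G\<^esub> * \<rho> \<one>\<^bsub>G\<^esub> = \<rho> \<one>\<^bsub>G\<^esub>" using irr_repD(2)[OF assms(2), of "\<one>\<^bsub>G\<^esub>" "\<one>\<^bsub>G\<^esub>"] by simp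
  then have "\<rho> \<one>\<^bsub>G\<^esub> * (\<rho> \<one>\<^bsub>G\<^esub> * Q) = \<rho> \<one>\<^bsub>G\<^esub> * Q"
    using c assoc_mult_mat[OF c(1,1,2)] by simp
  then show ?thesis using c by simp
qed

lemma kernel_subspace:
  fixes B :: "complex mat"
  assumes "B \<in> carrier_mat d d'"
  shows "VectorSpace.subspace class_ring {v \<in> carrier_vec d'. B *\<^sub>v v = 0\<^sub>v d} (module_vec TYPE(complex) d')"
  by (rule subspace_vecI)
    (use assms in \<open>auto simp: mult_add_distrib_mat_vec[OF assms] mult_mat_vec[OF assms]\<close>)

lemma image_subspace:
  fixes B :: "complex mat"
  assumes "B \<in> carrier_mat d d'"
  shows "VectorSpace.subspace class_ring ((\<lambda>v. B *\<^sub>v v) ` carrier_vec d') (module_vec TYPE(complex) d)"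
proof (rule subspace_vecI)
  show "(\<lambda>v. B *\<^sub>v v) ` carrier_vec d' \<subseteq> carrier_vec d" using assms by auto
  show "0\<^sub>v d \<in> (\<lambda>v. B *\<^sub>v v) ` carrier_vec d'"
    by (rule image_eqI[of _ _ "0\<^sub>v d'"]) (use assms in auto)
next
  fix v w assume "v \<in> (\<lambda>v. B *\<^sub>v v) ` carrier_vec d'" "w \<in> (\<lambda>v. B *\<^sub>v v) ` carrier_vec d'"
  then obtain x y where "x \<in> carrier_vec d'" "y \<in> carrier_vec d'" "v = B *\<^sub>v x" "w = B *\<^sub>v y" by blast
  then show "v + w \<in> (\<lambda>v. B *\<^sub>v v) ` carrier_vec d'"
    by (intro image_eqI[of _ _ "x + y"]) (auto simp: mult_add_distrib_mat_vec[OF assms])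
next
  fix c v assume "v \<in> (\<lambda>v. B *\<^sub>v v) ` carrier_vec d'"
  then obtain x where "x \<in> carrier_vec d'" "v = B *\<^sub>v x" by blast
  then show "c \<cdot>\<^sub>v v \<in> (\<lambda>v. B *\<^sub>v v) ` carrier_vec d'"
    by (intro image_eqI[of _ _ "c \<cdot>\<^sub>v x"]) (auto simp: mult_mat_vec[OF assms])
qed

lemma mat_eq_if_mult_vec_eq:
  fixes A B :: "complex mat"
  assumes A: "A \<in> carrier_mat n m" and B: "B \<in> carrier_mat n m"
    and eq: "\<And>v. v \<in> carrier_vec m \<Longrightarrow> A *\<^sub>v v = B *\<^sub>v v"
  shows "A = B"
proof (rule eq_matI)
  fix i j assume ij: "i < dim_row B" "j < dim_col B"
  then have "(A *\<^sub>v unit_vec m j) $ i = (B *\<^sub>v unit_vec m j) $ i" using eq[of "unit_vec m j"] by simp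
  then show "A $$ (i, j) = B $$ (i, j)" using ij A B by simp
qed (use A B in auto)

lemma zero_mat_if_kernel_full:
  fixes B :: "complex mat"
  assumes B: "B \<in> carrier_mat d d'" and "{v \<in> carrier_vec d'. B *\<^sub>v v = 0\<^sub>v d} = carrier_vec d'"
  shows "B = 0\<^sub>m d d'"
proof (rule mat_eq_if_mult_vec_eq[OF B])
  fix v :: "complex vec" assume v: "v \<in> carrier_vec d'"
  then have "v \<in> {v \<in> carrier_vec d'. B *\<^sub>v v = 0\<^sub>v d}" unfolding assms(2) .
  moreover have "0\<^sub>m d d' *\<^sub>v v = 0\<^sub>v d" by (rule eq_vecI) (use v in auto)
  ultimately show "B *\<^sub>v v = 0\<^sub>m d d' *\<^sub>v v" by simp
qed simp

lemma bijective_mat_inverse: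
  fixes B :: "complex mat"
  assumes B: "B \<in> carrier_mat d d'" and inj: "{v \<in> carrier_vec d'. B *\<^sub>v v = 0\<^sub>v d} = {0\<^sub>v d'}"
    and surj: "(\<lambda>v. B *\<^sub>v v) ` carrier_vec d' = carrier_vec d"
  shows "d = d' \<and> (\<exists>C\<in>carrier_mat d' d. B * C = 1\<^sub>m d \<and> C * B = 1\<^sub>m d')"
proof -
  have "\<exists>x\<in>carrier_vec d'. B *\<^sub>v x = v" if "v \<in> carrier_vec d" for v using surj that by (metis imageE)
  then obtain f where f: "\<And>v. v \<in> carrier_vec d \<Longrightarrow> f v \<in> carrier_vec d' \<and> B *\<^sub>v f v = v" by metis
  define C where "C = mat_of_cols d' (map (\<lambda>j. f (unit_vec d j)) [0..<d])"
  have C: "C \<in> carrier_mat d' d" unfolding C_def by auto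
  have "B * C = 1\<^sub>m d"
  proof (rule eq_matI)
    fix i j assume ij: "i < dim_row (1\<^sub>m d :: complex mat)" "j < dim_col (1\<^sub>m d :: complex mat)"
    have "col C j = f (unit_vec d j)" unfolding C_def using ij f[of "unit_vec d j"] by (intro trans[OF col_mat_of_cols]) auto
    then have "(B * C) $$ (i, j) = (B *\<^sub>v f (unit_vec d j)) $ i" using ij B C by simp
    also have "\<dots> = unit_vec d j $ i" using f[of "unit_vec d j"] by simp
    also have "\<dots> = 1\<^sub>m d $$ (i, j)" using ij by simp
    finally show "(B * C) $$ (i, j) = 1\<^sub>m d $$ (i, j)" .
  qed (use B C in auto)
  then have BC: "B * C = 1\<^sub>m d" .
  have CB: "C * B = 1\<^sub>m d'"
  proof (rule mat_eq_if_mult_vec_eq[of _ d' d'])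
    fix v :: "complex vec" assume v: "v \<in> carrier_vec d'"
    define u where "u = (C * B) *\<^sub>v v"
    have u: "u \<in> carrier_vec d'" unfolding u_def using B C v by (auto intro!: mult_mat_vec_carrier)
    have "B *\<^sub>v u = (B * (C * B)) *\<^sub>v v" unfolding u_def by (rule assoc_mult_mat_vec[symmetric]) (use B C v in auto)
    also have "B * (C * B) = B" using B C BC assoc_mult_mat[OF B C B] by simp
    finally have "B *\<^sub>v (u - v) = B *\<^sub>v v - B *\<^sub>v v"
      using mult_minus_distrib_mat_vec[OF B u v] by simp
    also have "\<dots> = 0\<^sub>v d" using B v by auto
    finally have "u - v \<in> {v \<in> carrier_vec d'. B *\<^sub>v v = 0\<^sub>v d}" using u v by simp
    then have uv: "u - v = 0\<^sub>v d'" unfolding inj by simp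
    have "u = v"
    proof (rule eq_vecI)
      fix i assume "i < dim_vec v"
      then have i: "i < d'" using v by simp
      have "(u - v) $ i = 0" unfolding uv using i by simp
      then show "u $ i = v $ i" using i u v by simp
    qed (use u v in simp)
    then show "(C * B) *\<^sub>v v = 1\<^sub>m d' *\<^sub>v v" using v by (simp add: u_def)
  qed (use B C in auto)
  \<comment> \<open>Equality of the dimensions comes from the equal traces of \<open>B * C\<close>
    and \<open>C * B\<close>.\<close>
  have "of_nat d = mat_trace (1\<^sub>m d :: complex mat)" "of_nat d' = mat_trace (1\<^sub>m d' :: complex mat)"
    by (simp_all add: mat_trace_def)
  then have "of_nat d = (of_nat d' :: complex)" using mat_trace_comm[OF B C] BC CB by simp
  then show ?thesis using C BC CB by auto
qed

text \<open>Kernel and image of an intertwiner are invariant. The clause on the kernel is kept for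
  \<open>schur_scalar\<close>, where the equivalence of a representation with itself says
  nothing.\<close>

lemma schur_intertwiner:
  assumes \<rho>: "(d, \<rho>) \<in> irreducible_reps G" and \<sigma>: "(d', \<sigma>) \<in> irreducible_reps G"
    and B: "B \<in> carrier_mat d d'" and int: "\<And>g. g \<in> carrier G \<Longrightarrow> \<rho> g * B = B * \<sigma> g"
  shows "B = 0\<^sub>m d d' \<or> (((d', \<sigma>), (d, \<rho>)) \<in> irr_equiv G \<and> {v \<in> carrier_vec d'. B *\<^sub>v v = 0\<^sub>v d} = {0\<^sub>v d'})"
proof (cases "B = 0\<^sub>m d d'")
  case False
  let ?K = "{v \<in> carrier_vec d'. B *\<^sub>v v = 0\<^sub>v d}" and ?I = "(\<lambda>v. B *\<^sub>v v) ` carrier_vec d'"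
  note rc = rep_carrier[OF \<rho>] and sc = rep_carrier[OF \<sigma>]
  have move: "B *\<^sub>v (\<sigma> g *\<^sub>v v) = \<rho> g *\<^sub>v (B *\<^sub>v v)" if "g \<in> carrier G" "v \<in> carrier_vec d'" for g v
    using assoc_mult_mat_vec[OF B sc[OF that(1)] that(2)] assoc_mult_mat_vec[OF rc[OF that(1)] B that(2)] int[OF that(1)]
    by simp
  have "?K = {0\<^sub>v d'} \<or> ?K = carrier_vec d'"
  proof (rule irr_repD(3)[OF \<sigma> kernel_subspace[OF B]])
    fix g v assume g: "g \<in> carrier G" and v: "v \<in> ?K"
    then have "\<rho> g *\<^sub>v (B *\<^sub>v v) = 0\<^sub>v d" using rc[OF g] by auto
    then show "\<sigma> g *\<^sub>v v \<in> ?K" using move[OF g, of v] v sc[OF g] by auto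
  qed
  then have K: "?K = {0\<^sub>v d'}" using zero_mat_if_kernel_full[OF B] False by blast
  have "?I = {0\<^sub>v d} \<or> ?I = carrier_vec d"
  proof (rule irr_repD(3)[OF \<rho> image_subspace[OF B]])
    fix g v assume g: "g \<in> carrier G" and "v \<in> ?I"
    then obtain x where x: "x \<in> carrier_vec d'" "v = B *\<^sub>v x" by blast
    show "\<rho> g *\<^sub>v v \<in> ?I"
      using x sc[OF g] by (intro image_eqI[of _ _ "\<sigma> g *\<^sub>v x"]) (simp_all add: move[OF g])
  qed
  moreover have "?I \<noteq> {0\<^sub>v d}"
  proof
    assume "?I = {0\<^sub>v d}"
    then have "?K = carrier_vec d'" by blast
    then show False using zero_mat_if_kernel_full[OF B] False by blast
  qed
  ultimately have I: "?I = carrier_vec d" by blast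
  obtain C where C: "d = d'" "C \<in> carrier_mat d' d" "B * C = 1\<^sub>m d" "C * B = 1\<^sub>m d'"
    using bijective_mat_inverse[OF B K I] by blast
  then have "B \<in> carrier (GL d)" using B unfolding GL_carrier_iff by auto
  then have "((d', \<sigma>), (d, \<rho>)) \<in> irr_equiv G"
    using \<rho> \<sigma> int C(1) unfolding irr_equiv_def by (auto intro!: bexI[of _ B])
  then show ?thesis using K by blast
qed simp

lemma schur_scalar:
  assumes \<rho>: "(d, \<rho>) \<in> irreducible_reps G" and B: "B \<in> carrier_mat d d"
    and int: "\<And>g. g \<in> carrier G \<Longrightarrow> \<rho> g * B = B * \<rho> g"
  shows "\<exists>c. B = c \<cdot>\<^sub>m 1\<^sub>m d"
proof -
  note rc = rep_carrier[OF \<rho>]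
  obtain c v where v: "v \<in> carrier_vec d" "v \<noteq> 0\<^sub>v d" "B *\<^sub>v v = c \<cdot>\<^sub>v v"
    using spectrum_non_empty[OF B irr_repD(1)[OF \<rho>]] B
    by (auto simp: spectrum_def eigenvalue_def eigenvector_def)
  define M where "M = B - c \<cdot>\<^sub>m 1\<^sub>m d"
  have cm: "c \<cdot>\<^sub>m 1\<^sub>m d \<in> carrier_mat d d" by simp
  have M: "M \<in> carrier_mat d d" unfolding M_def using cm by (rule minus_carrier_mat)
  have int_M: "\<rho> g * M = M * \<rho> g" if g: "g \<in> carrier G" for g
    unfolding M_def mult_minus_distrib_mat[OF rc[OF g] B cm] minus_mult_distrib_mat[OF B cm rc[OF g]]
    using int[OF g] rc[OF g] mult_smult_distrib[OF rc[OF g], of "1\<^sub>m d" d c] mult_smult_assoc_mat[of "1\<^sub>m d" d d "\<rho> g" d c] by simp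
  have "M = 0\<^sub>m d d \<or> (((d, \<rho>), (d, \<rho>)) \<in> irr_equiv G \<and> {v \<in> carrier_vec d. M *\<^sub>v v = 0\<^sub>v d} = {0\<^sub>v d})"
    by (rule schur_intertwiner[OF \<rho> \<rho> M]) (rule int_M)
  then have "M = 0\<^sub>m d d"
  proof
    assume "((d, \<rho>), (d, \<rho>)) \<in> irr_equiv G \<and> {v \<in> carrier_vec d. M *\<^sub>v v = 0\<^sub>v d} = {0\<^sub>v d}"
    then have ker: "{v \<in> carrier_vec d. M *\<^sub>v v = 0\<^sub>v d} = {0\<^sub>v d}" by (rule conjunct2)
    have "M *\<^sub>v v = B *\<^sub>v v - (c \<cdot>\<^sub>m 1\<^sub>m d) *\<^sub>v v" unfolding M_def by (rule minus_mult_distrib_mat_vec[OF B cm v(1)])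
    also have "(c \<cdot>\<^sub>m 1\<^sub>m d) *\<^sub>v v = c \<cdot>\<^sub>v v" by (rule eq_vecI) (use v(1) in \<open>auto simp: scalar_prod_left_unit\<close>)
    finally have "M *\<^sub>v v = 0\<^sub>v d" unfolding v(3) using v(1) by auto
    then have "v \<in> {v \<in> carrier_vec d. M *\<^sub>v v = 0\<^sub>v d}" using v(1) by simp
    then show ?thesis unfolding ker using v(2) by simp
  qed
  then have M0: "B - c \<cdot>\<^sub>m 1\<^sub>m d = 0\<^sub>m d d" unfolding M_def .
  have "B = c \<cdot>\<^sub>m 1\<^sub>m d"
  proof (rule eq_matI)
    fix i j assume "i < dim_row (c \<cdot>\<^sub>m 1\<^sub>m d)" "j < dim_col (c \<cdot>\<^sub>m 1\<^sub>m d)"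
    then have ij: "i < d" "j < d" by simp_all
    have "(B - c \<cdot>\<^sub>m 1\<^sub>m d) $$ (i, j) = 0" unfolding M0 using ij by simp
    then show "B $$ (i, j) = (c \<cdot>\<^sub>m 1\<^sub>m d) $$ (i, j)" using ij B by simp
  qed (use B in auto)
  then show ?thesis by blast
qed

lemma mat_mult_entry:
  fixes A B :: "complex mat"
  assumes "A \<in> carrier_mat n m" "B \<in> carrier_mat m p" "i < n" "j < p"
  shows "(A * B) $$ (i, j) = (\<Sum>k<m. A $$ (i, k) * B $$ (k, j))"
  using assms by (simp add: scalar_prod_def atLeast0LessThan)

section \<open>Orthogonality relations\<close>

locale finite_group = group G for G (structure) +
  assumes finite_carrier: "finite (carrier G)"
begin

lemma sum_translate: "g \<in> carrier G \<Longrightarrow> (\<Sum>y\<in>carrier G. f (g \<otimes> y)) = (\<Sum>y\<in>carrier G. f y)"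
  by (rule sum.reindex_bij_witness[of _ "\<lambda>y. inv g \<otimes> y" "\<lambda>y. g \<otimes> y"]) (auto simp: m_assoc[symmetric])

lemma order_pos: "0 < Coset.order G"
  using finite_carrier one_closed by (auto simp: Coset.order_def card_gt_0_iff)

text \<open>In entries, \<open>B\<close> is the sum over \<open>y\<close> of
  \<open>\<rho> y * E * \<sigma> (inv y)\<close>, with \<open>E\<close> the matrix unit at position
  (i, j).\<close>

lemma averaged_matrix_intertwines:
  assumes \<rho>: "(d, \<rho>) \<in> irreducible_reps G" and \<sigma>: "(d', \<sigma>) \<in> irreducible_reps G"
    and ij: "i < d" "j < d'" and g: "g \<in> carrier G"
  defines "B \<equiv> mat d d' (\<lambda>(a, b). \<Sum>y\<in>carrier G. \<rho> y $$ (a, i) * \<sigma> (inv y) $$ (j, b))"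
  shows "\<rho> g * B = B * \<sigma> g"
proof (rule eq_matI)
  note rc = rep_carrier[OF \<rho>] and sc = rep_carrier[OF \<sigma>]
  note rm = irr_repD(2)[OF \<rho>] and sm = irr_repD(2)[OF \<sigma>]
  have B: "B \<in> carrier_mat d d'" by (simp add: B_def)
  fix a b assume "a < dim_row (B * \<sigma> g)" "b < dim_col (B * \<sigma> g)"
  then have ab: "a < d" "b < d'" using B sc[OF g] by simp_all
  have "(\<rho> g * B) $$ (a, b) = (\<Sum>k<d. \<Sum>y\<in>carrier G. \<rho> g $$ (a, k) * (\<rho> y $$ (k, i) * \<sigma> (inv y) $$ (j, b)))"
    using mat_mult_entry[OF rc[OF g] B ab] ab by (simp add: B_def sum_distrib_left)
  also have "\<dots> = (\<Sum>y\<in>carrier G. (\<Sum>k<d. \<rho> g $$ (a, k) * \<rho> y $$ (k, i)) * \<sigma> (inv y) $$ (j, b))"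
    by (subst sum.swap) (simp add: sum_distrib_right mult.assoc)
  also have "\<dots> = (\<Sum>y\<in>carrier G. \<rho> (g \<otimes> y) $$ (a, i) * \<sigma> (inv y) $$ (j, b))"
    using ab ij by (intro sum.cong refl) (simp add: rm g mat_mult_entry[OF rc[OF g] rc])
  also have "\<dots> = (\<Sum>y\<in>carrier G. \<rho> (g \<otimes> y) $$ (a, i) * \<sigma> (inv (g \<otimes> y) \<otimes> g) $$ (j, b))"
    using g by (intro sum.cong refl) (simp add: inv_mult_group m_assoc)
  also have "\<dots> = (\<Sum>y\<in>carrier G. \<rho> y $$ (a, i) * \<sigma> (inv y \<otimes> g) $$ (j, b))"
    by (rule sum_translate[OF g])
  also have "\<dots> = (\<Sum>y\<in>carrier G. \<rho> y $$ (a, i) * (\<Sum>k<d'. \<sigma> (inv y) $$ (j, k) * \<sigma> g $$ (k, b)))"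
    using ab ij by (intro sum.cong refl) (simp add: sm g mat_mult_entry[OF sc sc[OF g]])
  also have "\<dots> = (\<Sum>k<d'. (\<Sum>y\<in>carrier G. \<rho> y $$ (a, i) * \<sigma> (inv y) $$ (j, k)) * \<sigma> g $$ (k, b))"
    unfolding sum_distrib_left sum_distrib_right by (subst sum.swap) (simp add: mult.assoc)
  also have "\<dots> = (B * \<sigma> g) $$ (a, b)"
    using mat_mult_entry[OF B sc[OF g] ab] ab by (simp add: B_def)
  finally show "(\<rho> g * B) $$ (a, b) = (B * \<sigma> g) $$ (a, b)" .
qed (use rep_carrier[OF \<rho> g] rep_carrier[OF \<sigma> g] in \<open>auto simp: B_def\<close>)

lemma schur_orthogonality_distinct:
  assumes \<rho>: "(d, \<rho>) \<in> irreducible_reps G" and \<sigma>: "(d', \<sigma>) \<in> irreducible_reps G"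
    and ne: "((d', \<sigma>), (d, \<rho>)) \<notin> irr_equiv G" and ij: "i < d" "j < d'" and ab: "a < d" "b < d'"
  shows "(\<Sum>y\<in>carrier G. \<rho> y $$ (a, i) * \<sigma> (inv y) $$ (j, b)) = 0"
proof -
  define B where "B = mat d d' (\<lambda>(a, b). \<Sum>y\<in>carrier G. \<rho> y $$ (a, i) * \<sigma> (inv y) $$ (j, b))"
  have "B = 0\<^sub>m d d' \<or> (((d', \<sigma>), (d, \<rho>)) \<in> irr_equiv G \<and> {v \<in> carrier_vec d'. B *\<^sub>v v = 0\<^sub>v d} = {0\<^sub>v d'})"
    by (rule schur_intertwiner[OF \<rho> \<sigma>]) (simp_all add: B_def averaged_matrix_intertwines[OF \<rho> \<sigma> ij])
  then have "B $$ (a, b) = 0" using ne ab by simp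
  then show ?thesis using ab by (simp add: B_def)
qed

lemma schur_orthogonality_same:
  assumes \<rho>: "(d, \<rho>) \<in> irreducible_reps G" and ij: "i < d" "j < d" and ab: "a < d" "b < d"
  shows "(\<Sum>y\<in>carrier G. \<rho> y $$ (a, i) * \<rho> (inv y) $$ (j, b))
    = (if i = j \<and> a = b then of_nat (Coset.order G) / of_nat d else 0)"
proof -
  note rc = rep_carrier[OF \<rho>] and rm = irr_repD(2)[OF \<rho>]
  define B where "B = mat d d (\<lambda>(a, b). \<Sum>y\<in>carrier G. \<rho> y $$ (a, i) * \<rho> (inv y) $$ (j, b))"
  have "\<exists>c. B = c \<cdot>\<^sub>m 1\<^sub>m d"
    by (rule schur_scalar[OF \<rho>]) (simp_all add: B_def averaged_matrix_intertwines[OF \<rho> \<rho> ij])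
  then obtain c where c: "B = c \<cdot>\<^sub>m 1\<^sub>m d" by blast
  have entry: "(\<Sum>y\<in>carrier G. \<rho> y $$ (x, i) * \<rho> (inv y) $$ (j, z)) = (if x = z then c else 0)" if "x < d" "z < d" for x z
  proof -
    have "(\<Sum>y\<in>carrier G. \<rho> y $$ (x, i) * \<rho> (inv y) $$ (j, z)) = B $$ (x, z)" using that by (simp add: B_def)
    also have "\<dots> = (if x = z then c else 0)" unfolding c using that by simp
    finally show ?thesis .
  qed
  \<comment> \<open>The scalar is found from the trace of \<open>B\<close>: cyclically rearranged,
    each summand becomes an entry of \<open>\<rho> (inv y \<otimes> y)\<close>.\<close>
  have "of_nat d * c = (\<Sum>x<d. \<Sum>y\<in>carrier G. \<rho> y $$ (x, i) * \<rho> (inv y) $$ (j, x))"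
    by (simp add: entry)
  also have "\<dots> = (\<Sum>y\<in>carrier G. \<Sum>x<d. \<rho> (inv y) $$ (j, x) * \<rho> y $$ (x, i))"
    by (subst sum.swap) (simp add: mult.commute)
  also have "\<dots> = (\<Sum>y\<in>carrier G. \<rho> (inv y \<otimes> y) $$ (j, i))"
    using ij by (intro sum.cong refl) (simp only: rm inv_closed mat_mult_entry[OF rc rc])
  also have "\<dots> = (\<Sum>y\<in>carrier G. 1\<^sub>m d $$ (j, i))"
    by (intro sum.cong refl) (simp add: irr_rep_one[OF is_group \<rho>])
  also have "\<dots> = (if i = j then of_nat (Coset.order G) else 0)" using ij by (simp add: Coset.order_def)
  finally have "c = (if i = j then of_nat (Coset.order G) / of_nat d else 0)"
    using irr_repD(1)[OF \<rho>] by (auto simp: field_simps split: if_splits)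
  then show ?thesis using entry[OF ab] by simp
qed

lemma trace_rep_mult:
  assumes \<rho>: "(d, \<rho>) \<in> irreducible_reps G" and x: "x \<in> carrier G" "y \<in> carrier G"
  shows "mat_trace (\<rho> (x \<otimes> y)) = (\<Sum>i<d. \<Sum>a<d. \<rho> x $$ (i, a) * \<rho> y $$ (a, i))"
  using rep_carrier[OF \<rho> x(1)] rep_carrier[OF \<rho> x(2)]
  by (simp add: irr_repD(2)[OF \<rho> x] mat_trace_def mat_mult_entry del: index_mult_mat(1))

lemma trace_convolution:
  assumes \<rho>: "(d, \<rho>) \<in> irreducible_reps G" and \<sigma>: "(d', \<sigma>) \<in> irreducible_reps G"
    and x: "x \<in> carrier G" and z: "z \<in> carrier G"
  shows "(\<Sum>y\<in>carrier G. mat_trace (\<rho> (x \<otimes> y)) * mat_trace (\<sigma> (inv y \<otimes> z)))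
    = (\<Sum>i<d. \<Sum>a<d. \<Sum>j<d'. \<Sum>b<d'. \<rho> x $$ (i, a) * \<sigma> z $$ (b, j) *
        (\<Sum>y\<in>carrier G. \<rho> y $$ (a, i) * \<sigma> (inv y) $$ (j, b)))"
proof -
  have "(\<Sum>y\<in>carrier G. mat_trace (\<rho> (x \<otimes> y)) * mat_trace (\<sigma> (inv y \<otimes> z)))
    = (\<Sum>y\<in>carrier G. (\<Sum>i<d. \<Sum>a<d. \<rho> x $$ (i, a) * \<rho> y $$ (a, i)) * (\<Sum>j<d'. \<Sum>b<d'. \<sigma> (inv y) $$ (j, b) * \<sigma> z $$ (b, j)))"
    using x z by (intro sum.cong refl) (simp add: trace_rep_mult[OF \<rho>] trace_rep_mult[OF \<sigma>])
  also have "\<dots> = (\<Sum>y\<in>carrier G. \<Sum>i<d. \<Sum>a<d. \<Sum>j<d'. \<Sum>b<d'. \<rho> x $$ (i, a) * \<sigma> z $$ (b, j) * (\<rho> y $$ (a, i) * \<sigma> (inv y) $$ (j, b)))"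
    unfolding sum_distrib_right unfolding sum_distrib_left by (intro sum.cong refl) (simp only: mult_ac)
  also have "\<dots> = (\<Sum>i<d. \<Sum>a<d. \<Sum>j<d'. \<Sum>b<d'. \<Sum>y\<in>carrier G. \<rho> x $$ (i, a) * \<sigma> z $$ (b, j) * (\<rho> y $$ (a, i) * \<sigma> (inv y) $$ (j, b)))"
    by (subst sum.swap, rule sum.cong[OF refl], subst sum.swap, rule sum.cong[OF refl], subst sum.swap,
        rule sum.cong[OF refl], subst sum.swap, rule refl)
  finally show ?thesis by (simp only: sum_distrib_left)
qed

text \<open>With \<open>x\<close> and \<open>z\<close> free, one identity yields both the
  idempotence of the kernels in \<open>character_kernels\<close> and, at the identity, the
  orthogonality of characters used in \<open>class_character_sum\<close>.\<close>

lemma character_convolution: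
  assumes C: "C \<in> Irr G" "C' \<in> Irr G" and x: "x \<in> carrier G" and z: "z \<in> carrier G"
  shows "(\<Sum>y\<in>carrier G. irr_char C (x \<otimes> y) * irr_char C' (inv y \<otimes> z))
    = (if C = C' then of_nat (Coset.order G) / of_nat (irr_dim C) * irr_char C (x \<otimes> z) else 0)"
proof -
  have rep: "(SOME r. r \<in> D) \<in> D" if "D \<in> Irr G" for D
    using that in_quotient_imp_non_empty[OF equiv_irr_equiv] unfolding Irr_def by (metis some_in_eq)
  have irr: "r \<in> irreducible_reps G" if "D \<in> Irr G" "r \<in> D" for D r
    using that in_quotient_imp_subset[OF equiv_irr_equiv] unfolding Irr_def by blast
  obtain d \<rho> where r: "(SOME r. r \<in> C) = (d, \<rho>)" by (cases "SOME r. r \<in> C")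
  obtain d' \<sigma> where s: "(SOME r. r \<in> C') = (d', \<sigma>)" by (cases "SOME r. r \<in> C'")
  have \<rho>: "(d, \<rho>) \<in> irreducible_reps G" using irr[OF C(1) rep[OF C(1)]] r by simp
  have \<sigma>: "(d', \<sigma>) \<in> irreducible_reps G" using irr[OF C(2) rep[OF C(2)]] s by simp
  have ch: "irr_char C g = mat_trace (\<rho> g)" "irr_char C' g = mat_trace (\<sigma> g)" for g
    by (simp_all add: irr_char_def r s)
  show ?thesis
  proof (cases "C = C'")
    case True
    then have e: "d' = d" "\<sigma> = \<rho>" using r s by simp_all
    have "(\<Sum>y\<in>carrier G. mat_trace (\<rho> (x \<otimes> y)) * mat_trace (\<rho> (inv y \<otimes> z)))
      = (\<Sum>i<d. \<Sum>a<d. \<Sum>j<d. \<Sum>b<d. \<rho> x $$ (i, a) * \<rho> z $$ (b, j) * (if i = j \<and> a = b then of_nat (Coset.order G) / of_nat d else 0))"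
      unfolding trace_convolution[OF \<rho> \<rho> x z]
      by (intro sum.cong refl arg_cong2[of _ _ _ _ "times"] schur_orthogonality_same[OF \<rho>]) auto
    also have "\<dots> = (\<Sum>i<d. \<Sum>a<d. \<rho> x $$ (i, a) * \<rho> z $$ (a, i) * (of_nat (Coset.order G) / of_nat d))"
    proof (intro sum.cong refl)
      fix i a assume ia: "i \<in> {..<d}" "a \<in> {..<d}"
      have "(\<Sum>b<d. \<rho> x $$ (i, a) * \<rho> z $$ (b, j) * (if i = j \<and> a = b then of_nat (Coset.order G) / of_nat d else 0))
        = (if i = j then \<rho> x $$ (i, a) * \<rho> z $$ (a, i) * (of_nat (Coset.order G) / of_nat d) else 0)" for j
      proof (cases "i = j")
        case True
        have "(\<Sum>b<d. \<rho> x $$ (i, a) * \<rho> z $$ (b, j) * (if i = j \<and> a = b then of_nat (Coset.order G) / of_nat d else 0))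
          = (\<Sum>b<d. if a = b then \<rho> x $$ (i, a) * \<rho> z $$ (b, j) * (of_nat (Coset.order G) / of_nat d) else 0)"
          using True by (intro sum.cong refl) simp
        also have "\<dots> = \<rho> x $$ (i, a) * \<rho> z $$ (a, j) * (of_nat (Coset.order G) / of_nat d)"
          using ia by (subst sum.delta') auto
        finally show ?thesis using True by simp
      qed simp
      then show "(\<Sum>j<d. \<Sum>b<d. \<rho> x $$ (i, a) * \<rho> z $$ (b, j) * (if i = j \<and> a = b then of_nat (Coset.order G) / of_nat d else 0))
        = \<rho> x $$ (i, a) * \<rho> z $$ (a, i) * (of_nat (Coset.order G) / of_nat d)"
        using ia by (simp only: sum.delta') simp
    qed
    also have "\<dots> = of_nat (Coset.order G) / of_nat d * mat_trace (\<rho> (x \<otimes> z))"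
      unfolding trace_rep_mult[OF \<rho> x z] by (simp add: sum_distrib_left mult.commute)
    finally show ?thesis using True unfolding ch by (simp add: e irr_dim_def s)
  next
    case False
    have "((d', \<sigma>), (d, \<rho>)) \<notin> irr_equiv G"
    proof
      assume eq: "((d', \<sigma>), (d, \<rho>)) \<in> irr_equiv G"
      have "(d', \<sigma>) \<in> C'" "(d, \<rho>) \<in> C" using rep[OF C(2)] rep[OF C(1)] unfolding r s .
      from quotient_eqI[OF equiv_irr_equiv C(2)[unfolded Irr_def] C(1)[unfolded Irr_def] this eq]
      have "C' = C" .
      then show False using False by simp
    qed
    then have "(\<Sum>y\<in>carrier G. mat_trace (\<rho> (x \<otimes> y)) * mat_trace (\<sigma> (inv y \<otimes> z))) = 0"
      unfolding trace_convolution[OF \<rho> \<sigma> x z]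
      by (intro sum.neutral ballI) (simp add: schur_orthogonality_distinct[OF \<rho> \<sigma>])
    then show ?thesis using False unfolding ch by simp
  qed
qed

end

subsection \<open>Bessel inequalities for characters\<close>


lemma upper_triangular_pow:
  fixes B :: "complex mat"
  assumes B: "B \<in> carrier_mat n n" and ut: "upper_triangular B"
  shows "upper_triangular (B ^\<^sub>m k) \<and> (\<forall>i<n. (B ^\<^sub>m k) $$ (i, i) = (B $$ (i, i)) ^ k)"
proof (induction k)
  case 0
  then show ?case using B by auto
next
  case (Suc k)
  note P = pow_carrier_mat[OF B, of k]
  have up: "(B ^\<^sub>m k) $$ (i, j) = 0" if "j < i" "i < n" for i j using Suc P that by auto
  have ub: "B $$ (i, j) = 0" if "j < i" "i < n" for i j using ut B that by auto
  have ent: "(B ^\<^sub>m Suc k) $$ (i, j) = (\<Sum>t<n. (B ^\<^sub>m k) $$ (i, t) * B $$ (t, j))" if "i < n" "j < n" for i j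
    using mat_mult_entry[OF P B that] by simp
  have "(B ^\<^sub>m Suc k) $$ (i, j) = 0" if ij: "j < i" "i < n" for i j
  proof -
    have "(B ^\<^sub>m k) $$ (i, t) * B $$ (t, j) = 0" if "t < n" for t
      using up[of t i] ub[of j t] ij that by (cases "t < i") auto
    then have "(\<Sum>t<n. (B ^\<^sub>m k) $$ (i, t) * B $$ (t, j)) = 0" by (intro sum.neutral) blast
    then show ?thesis using ent[of i j] ij by simp
  qed
  moreover have "(B ^\<^sub>m Suc k) $$ (i, i) = (B $$ (i, i)) ^ Suc k" if i: "i < n" for i
  proof -
    have "(\<Sum>t<n. (B ^\<^sub>m k) $$ (i, t) * B $$ (t, i)) = (\<Sum>t<n. if t = i then (B ^\<^sub>m k) $$ (i, i) * B $$ (i, i) else 0)"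
    proof (rule sum.cong[OF refl])
      fix t assume "t \<in> {..<n}"
      then show "(B ^\<^sub>m k) $$ (i, t) * B $$ (t, i) = (if t = i then (B ^\<^sub>m k) $$ (i, i) * B $$ (i, i) else 0)"
        using up[of t i] ub[of i t] i by (cases t i rule: linorder_cases) auto
    qed
    also have "\<dots> = (B ^\<^sub>m k) $$ (i, i) * B $$ (i, i)" using i by simp
    finally show ?thesis using ent[OF i i] Suc i by simp
  qed
  ultimately show ?case using B by (auto simp del: pow_mat.simps)
qed

text \<open>After triangularisation the diagonal entries are roots of unity, whose inverses are
  their conjugates. This yields \<open>irr_char_inv\<close> without an invariant inner
  product.\<close>

lemma trace_finite_order:
  fixes A :: "complex mat"
  assumes A: "A \<in> carrier_mat n n" and N: "A ^\<^sub>m Suc N = 1\<^sub>m n"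
  shows "mat_trace (A ^\<^sub>m N) = cnj (mat_trace A)"
proof -
  obtain es where "char_poly A = (\<Prod>e\<leftarrow>es. [:- e, 1:])" using char_poly_factorized[OF A] by blast
  from schur_decomposition_exists[OF A this] obtain B where B: "B \<in> carrier_mat n n" "upper_triangular B"
    and sim: "similar_mat A B" by blast
  obtain P Q where wit: "similar_mat_wit A B P Q" using sim by (auto simp: similar_mat_def)
  have PQ: "P \<in> carrier_mat n n" "Q \<in> carrier_mat n n" "Q * P = 1\<^sub>m n" "P * Q = 1\<^sub>m n"
    using similar_mat_witD2[OF A wit] by auto
  have tr: "mat_trace (A ^\<^sub>m k) = mat_trace (B ^\<^sub>m k)" for k
  proof -
    note Bk = pow_carrier_mat[OF B(1), of k]
    have "A ^\<^sub>m k = P * B ^\<^sub>m k * Q" by (rule similar_mat_wit_pow_id[OF wit])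
    then have "mat_trace (A ^\<^sub>m k) = mat_trace (Q * (P * B ^\<^sub>m k))"
      using mat_trace_comm[of "P * B ^\<^sub>m k" n n Q] PQ Bk by simp
    also have "Q * (P * B ^\<^sub>m k) = B ^\<^sub>m k"
      using assoc_mult_mat[OF PQ(2) PQ(1) Bk] unfolding PQ(3) left_mult_one_mat[OF Bk] by (rule sym)
    finally show ?thesis .
  qed
  have BN: "B ^\<^sub>m Suc N = 1\<^sub>m n"
  proof -
    note Bk = pow_carrier_mat[OF B(1), of "Suc N"]
    have "P * B ^\<^sub>m Suc N * Q = 1\<^sub>m n" using similar_mat_wit_pow_id[OF wit, of "Suc N"] N by simp
    then have "Q * (P * B ^\<^sub>m Suc N * Q) * P = 1\<^sub>m n" using PQ by simp
    moreover have "Q * (P * B ^\<^sub>m Suc N * Q) * P = (Q * P) * B ^\<^sub>m Suc N * (Q * P)"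
      using PQ(1,2) Bk by (simp add: assoc_mult_mat[of _ n n _ n _ n] del: pow_mat.simps)
    ultimately show ?thesis
      unfolding PQ(3) left_mult_one_mat[OF Bk] right_mult_one_mat[OF Bk] by simp
  qed
  have diag: "(B ^\<^sub>m k) $$ (i, i) = (B $$ (i, i)) ^ k" if "i < n" for i k
    using upper_triangular_pow[OF B] that by blast
  have "mat_trace (B ^\<^sub>m N) = (\<Sum>i<n. (B $$ (i, i)) ^ N)"
    using B(1) diag by (simp add: mat_trace_def)
  also have "\<dots> = (\<Sum>i<n. cnj (B $$ (i, i)))"
  proof (rule sum.cong[OF refl])
    fix i assume "i \<in> {..<n}"
    then have t: "(B $$ (i, i)) ^ Suc N = 1" using diag[of i "Suc N"] unfolding BN by simp
    then have "cmod ((B $$ (i, i)) ^ Suc N) = cmod 1" by (rule arg_cong)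
    then have "cmod (B $$ (i, i)) ^ Suc N = 1 ^ Suc N" unfolding norm_power norm_one power_one .
    then have "cmod (B $$ (i, i)) = 1" by (rule power_inject_base) simp_all
    then have "B $$ (i, i) * cnj (B $$ (i, i)) = 1" by (simp add: complex_norm_square[symmetric])
    then have "(B $$ (i, i)) ^ N = (B $$ (i, i)) ^ N * (B $$ (i, i) * cnj (B $$ (i, i)))" by simp
    also have "\<dots> = (B $$ (i, i)) ^ Suc N * cnj (B $$ (i, i))" by simp
    finally show "(B $$ (i, i)) ^ N = cnj (B $$ (i, i))" unfolding t by simp
  qed
  also have "\<dots> = cnj (mat_trace B)" using B by (simp add: mat_trace_def)
  also have "mat_trace B = mat_trace A" using tr[of 1] A B(1) by simp
  finally show ?thesis using tr by simp
qed

context finite_group begin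

lemma irr_rep_pow:
  assumes \<rho>: "(d, \<rho>) \<in> irreducible_reps G" and g: "g \<in> carrier G"
  shows "\<rho> (g [^] (k::nat)) = \<rho> g ^\<^sub>m k"
proof (induction k)
  case 0
  then show ?case using irr_rep_one[OF is_group \<rho>] rep_carrier[OF \<rho> g] by simp
next
  case (Suc k)
  then show ?case using irr_repD(2)[OF \<rho>, of "g [^] k" g] g by simp
qed

lemma irr_rep_ex:
  assumes "C \<in> Irr G"
  obtains d \<rho> where "(d, \<rho>) \<in> irreducible_reps G" "irr_dim C = d" "irr_char C = (\<lambda>g. mat_trace (\<rho> g))"
proof -
  have "(SOME r. r \<in> C) \<in> C"
    using assms in_quotient_imp_non_empty[OF equiv_irr_equiv] unfolding Irr_def by (metis some_in_eq)
  then have "(SOME r. r \<in> C) \<in> irreducible_reps G"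
    using assms in_quotient_imp_subset[OF equiv_irr_equiv] unfolding Irr_def by blast
  then show ?thesis
    by (intro that[of "fst (SOME r. r \<in> C)" "snd (SOME r. r \<in> C)"]) (auto simp: irr_dim_def irr_char_def)
qed

lemma irr_dim_pos: "C \<in> Irr G \<Longrightarrow> 0 < irr_dim C"
  by (metis irr_rep_ex irr_repD(1))

lemma irr_char_one:
  assumes "C \<in> Irr G" shows "irr_char C \<one> = of_nat (irr_dim C)"
proof -
  obtain d \<rho> where "(d, \<rho>) \<in> irreducible_reps G" "irr_dim C = d" "irr_char C = (\<lambda>g. mat_trace (\<rho> g))"
    by (rule irr_rep_ex[OF assms])
  then show ?thesis by (simp add: irr_rep_one[OF is_group] mat_trace_def)
qed

lemma irr_char_inv:
  assumes "C \<in> Irr G" and g: "g \<in> carrier G"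
  shows "irr_char C (inv g) = cnj (irr_char C g)"
proof -
  obtain d \<rho> where \<rho>: "(d, \<rho>) \<in> irreducible_reps G" and ch: "irr_char C = (\<lambda>g. mat_trace (\<rho> g))"
    by (rule irr_rep_ex[OF assms(1)])
  obtain N where N: "Coset.order G = Suc N" using order_pos gr0_implies_Suc by blast
  have one: "g [^] Suc N = \<one>" using pow_order_eq_1[OF g] N by simp
  then have "inv g = g [^] N" using g by (intro inv_equality) auto
  moreover have "\<rho> g ^\<^sub>m Suc N = 1\<^sub>m d"
    using irr_rep_pow[OF \<rho> g, of "Suc N"] unfolding one irr_rep_one[OF is_group \<rho>] by simp
  ultimately show ?thesis
    using trace_finite_order[OF rep_carrier[OF \<rho> g]] irr_rep_pow[OF \<rho> g, of N] by (simp add: ch)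
qed

lemma irr_char_conj:
  assumes "C \<in> Irr G" and g: "g \<in> carrier G" and h: "h \<in> carrier G"
  shows "irr_char C (g \<otimes> h \<otimes> inv g) = irr_char C h"
proof -
  obtain d \<rho> where \<rho>: "(d, \<rho>) \<in> irreducible_reps G" and ch: "irr_char C = (\<lambda>g. mat_trace (\<rho> g))"
    by (rule irr_rep_ex[OF assms(1)])
  note rc = rep_carrier[OF \<rho>]
  have "mat_trace (\<rho> (g \<otimes> h \<otimes> inv g)) = mat_trace (\<rho> (g \<otimes> h) * \<rho> (inv g))"
    using g h irr_repD(2)[OF \<rho>, of "g \<otimes> h" "inv g"] by simp
  also have "\<dots> = mat_trace (\<rho> (inv g) * \<rho> (g \<otimes> h))" using g h by (intro mat_trace_comm[of _ d d] rc) auto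
  also have "\<rho> (inv g) * \<rho> (g \<otimes> h) = \<rho> (inv g \<otimes> (g \<otimes> h))"
    using g h irr_repD(2)[OF \<rho>, of "inv g" "g \<otimes> h"] by simp
  also have "inv g \<otimes> (g \<otimes> h) = h" using g h by (simp add: m_assoc[symmetric])
  finally show ?thesis by (simp add: ch)
qed

end

text \<open>\<open>K\<close> is its own adjoint and its own square, so the inner product of
  \<open>f\<close> with \<open>K f\<close> is that of \<open>K f\<close> with itself.\<close>

lemma hermitian_idempotent_form:
  fixes K :: "'a \<Rightarrow> 'a \<Rightarrow> complex"
  assumes herm: "\<And>x y. x \<in> X \<Longrightarrow> y \<in> X \<Longrightarrow> cnj (K x y) = K y x"
    and idem: "\<And>x z. x \<in> X \<Longrightarrow> z \<in> X \<Longrightarrow> (\<Sum>y\<in>X. K x y * K y z) = K x z"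
  shows "(\<Sum>x\<in>X. \<Sum>y\<in>X. cnj (f x) * K x y * f y) = of_real (\<Sum>y\<in>X. (cmod (\<Sum>z\<in>X. K y z * f z))\<^sup>2)"
proof -
  have "(\<Sum>x\<in>X. \<Sum>z\<in>X. cnj (f x) * K x z * f z) = (\<Sum>x\<in>X. \<Sum>z\<in>X. \<Sum>y\<in>X. cnj (f x) * (K x y * K y z) * f z)"
  proof (intro sum.cong refl)
    fix x z assume xz: "x \<in> X" "z \<in> X"
    have "cnj (f x) * K x z * f z = cnj (f x) * (\<Sum>y\<in>X. K x y * K y z) * f z" unfolding idem[OF xz] ..
    also have "\<dots> = (\<Sum>y\<in>X. cnj (f x) * (K x y * K y z) * f z)" by (simp only: sum_distrib_left sum_distrib_right)
    finally show "cnj (f x) * K x z * f z = (\<Sum>y\<in>X. cnj (f x) * (K x y * K y z) * f z)" .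
  qed
  also have "\<dots> = (\<Sum>x\<in>X. \<Sum>y\<in>X. \<Sum>z\<in>X. cnj (f x) * (K x y * K y z) * f z)"
    by (intro sum.cong refl sum.swap)
  also have "\<dots> = (\<Sum>y\<in>X. \<Sum>x\<in>X. \<Sum>z\<in>X. cnj (f x) * (K x y * K y z) * f z)" by (rule sum.swap)
  also have "\<dots> = (\<Sum>y\<in>X. (\<Sum>z\<in>X. K y z * f z) * cnj (\<Sum>x\<in>X. K y x * f x))"
  proof (rule sum.cong[OF refl])
    fix y assume y: "y \<in> X"
    have "cnj (\<Sum>x\<in>X. K y x * f x) = (\<Sum>x\<in>X. K x y * cnj (f x))"
      using y by (simp add: herm)
    then have "(\<Sum>z\<in>X. K y z * f z) * cnj (\<Sum>x\<in>X. K y x * f x) = (\<Sum>x\<in>X. K x y * cnj (f x)) * (\<Sum>z\<in>X. K y z * f z)"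
      by (simp add: mult.commute)
    also have "\<dots> = (\<Sum>x\<in>X. \<Sum>z\<in>X. K x y * cnj (f x) * (K y z * f z))" by (rule sum_product)
    also have "\<dots> = (\<Sum>x\<in>X. \<Sum>z\<in>X. cnj (f x) * (K x y * K y z) * f z)"
      by (intro sum.cong refl) (simp only: mult_ac)
    finally show "(\<Sum>x\<in>X. \<Sum>z\<in>X. cnj (f x) * (K x y * K y z) * f z) = (\<Sum>z\<in>X. K y z * f z) * cnj (\<Sum>x\<in>X. K y x * f x)" ..
  qed
  also have "\<dots> = of_real (\<Sum>y\<in>X. (cmod (\<Sum>z\<in>X. K y z * f z))\<^sup>2)"
    by (simp only: of_real_sum complex_norm_square)
  finally show ?thesis .
qed

text \<open>Bessel's inequality: the sum \<open>S\<close> of orthogonal projections is a projection,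
  hence so is its complement \<open>R\<close>, whose form is nonnegative.\<close>

lemma orthogonal_kernels_form:
  fixes K :: "'c \<Rightarrow> 'a \<Rightarrow> 'a \<Rightarrow> complex"
  assumes X: "finite X" and T: "finite T"
    and herm: "\<And>C x y. C \<in> T \<Longrightarrow> x \<in> X \<Longrightarrow> y \<in> X \<Longrightarrow> cnj (K C x y) = K C y x"
    and orth: "\<And>C C' x z. C \<in> T \<Longrightarrow> C' \<in> T \<Longrightarrow> x \<in> X \<Longrightarrow> z \<in> X \<Longrightarrow>
        (\<Sum>y\<in>X. K C x y * K C' y z) = (if C = C' then K C x z else 0)"
  shows "\<And>C. C \<in> T \<Longrightarrow> \<exists>r\<ge>0. (\<Sum>x\<in>X. \<Sum>y\<in>X. cnj (f x) * K C x y * f y) = of_real r"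
    and "(\<Sum>C\<in>T. Re (\<Sum>x\<in>X. \<Sum>y\<in>X. cnj (f x) * K C x y * f y)) \<le> (\<Sum>x\<in>X. (cmod (f x))\<^sup>2)"
proof -
  show "\<exists>r\<ge>0. (\<Sum>x\<in>X. \<Sum>y\<in>X. cnj (f x) * K C x y * f y) = of_real r" if C: "C \<in> T" for C
    by (rule exI, rule conjI[OF _ hermitian_idempotent_form])
      (auto intro: sum_nonneg simp: herm[OF C] orth[OF C C])
  define S where "S x y = (\<Sum>C\<in>T. K C x y)" for x y
  define R where "R x y = (if x = y then 1 else 0) - S x y" for x y
  have S_herm: "cnj (S x y) = S y x" if "x \<in> X" "y \<in> X" for x y
    using that by (simp add: S_def herm)
  have S_idem: "(\<Sum>y\<in>X. S x y * S y z) = S x z" if xz: "x \<in> X" "z \<in> X" for x z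
  proof -
    have "(\<Sum>y\<in>X. S x y * S y z) = (\<Sum>y\<in>X. \<Sum>C\<in>T. \<Sum>C'\<in>T. K C x y * K C' y z)"
      by (simp add: S_def sum_product)
    also have "\<dots> = (\<Sum>C\<in>T. \<Sum>y\<in>X. \<Sum>C'\<in>T. K C x y * K C' y z)" by (rule sum.swap)
    also have "\<dots> = (\<Sum>C\<in>T. \<Sum>C'\<in>T. \<Sum>y\<in>X. K C x y * K C' y z)" by (intro sum.cong refl sum.swap)
    also have "\<dots> = (\<Sum>C\<in>T. \<Sum>C'\<in>T. if C = C' then K C x z else 0)" by (intro sum.cong refl orth xz)
    also have "\<dots> = S x z" using T by (simp add: S_def)
    finally show ?thesis .
  qed
  have R_herm: "cnj (R x y) = R y x" if "x \<in> X" "y \<in> X" for x y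
    using that S_herm by (simp add: R_def)
  have R_idem: "(\<Sum>y\<in>X. R x y * R y z) = R x z" if xz: "x \<in> X" "z \<in> X" for x z
  proof -
    have "R x y * R y z = (if x = y then R x z else 0) - (if y = z then S x y else 0) + S x y * S y z" for y
      by (auto simp: R_def algebra_simps)
    then have "(\<Sum>y\<in>X. R x y * R y z) = (\<Sum>y\<in>X. if x = y then R x z else 0) - (\<Sum>y\<in>X. if y = z then S x y else 0) + (\<Sum>y\<in>X. S x y * S y z)"
      by (simp only: sum.distrib sum_subtractf)
    also have "\<dots> = R x z - S x z + S x z" using X xz by (simp add: S_idem)
    finally show ?thesis by simp
  qed
  have "(\<Sum>x\<in>X. \<Sum>y\<in>X. cnj (f x) * R x y * f y)
    = (\<Sum>x\<in>X. \<Sum>y\<in>X. (if x = y then cnj (f x) * f x else 0) - cnj (f x) * S x y * f y)"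
    by (intro sum.cong refl) (auto simp: R_def algebra_simps)
  also have "\<dots> = (\<Sum>x\<in>X. cnj (f x) * f x) - (\<Sum>x\<in>X. \<Sum>y\<in>X. cnj (f x) * S x y * f y)"
    using X by (simp add: sum_subtractf)
  also have "(\<Sum>x\<in>X. \<Sum>y\<in>X. cnj (f x) * S x y * f y) = (\<Sum>x\<in>X. \<Sum>y\<in>X. \<Sum>C\<in>T. cnj (f x) * K C x y * f y)"
    by (simp add: S_def sum_distrib_left sum_distrib_right)
  also have "\<dots> = (\<Sum>x\<in>X. \<Sum>C\<in>T. \<Sum>y\<in>X. cnj (f x) * K C x y * f y)" by (intro sum.cong refl sum.swap)
  also have "\<dots> = (\<Sum>C\<in>T. \<Sum>x\<in>X. \<Sum>y\<in>X. cnj (f x) * K C x y * f y)" by (rule sum.swap)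
  also have "(\<Sum>x\<in>X. cnj (f x) * f x) = of_real (\<Sum>x\<in>X. (cmod (f x))\<^sup>2)"
    by (simp only: of_real_sum complex_norm_square mult.commute)
  finally have "of_real (\<Sum>x\<in>X. (cmod (f x))\<^sup>2) - (\<Sum>C\<in>T. \<Sum>x\<in>X. \<Sum>y\<in>X. cnj (f x) * K C x y * f y)
    = of_real (\<Sum>y\<in>X. (cmod (\<Sum>z\<in>X. R y z * f z))\<^sup>2)"
    using hermitian_idempotent_form[of X R f, OF R_herm R_idem] by simp
  from arg_cong[OF this, of Re]
  have "(\<Sum>x\<in>X. (cmod (f x))\<^sup>2) - (\<Sum>C\<in>T. Re (\<Sum>x\<in>X. \<Sum>y\<in>X. cnj (f x) * K C x y * f y))
    = (\<Sum>y\<in>X. (cmod (\<Sum>z\<in>X. R y z * f z))\<^sup>2)"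
    unfolding minus_complex.sel(1) Re_complex_of_real Re_sum[of _ T] .
  moreover have "0 \<le> \<dots>" by (intro sum_nonneg) simp
  ultimately show "(\<Sum>C\<in>T. Re (\<Sum>x\<in>X. \<Sum>y\<in>X. cnj (f x) * K C x y * f y)) \<le> (\<Sum>x\<in>X. (cmod (f x))\<^sup>2)"
    by linarith
qed

context finite_group begin

text \<open>
  The kernels \<open>K C\<close> are those of the orthogonal projections onto the isotypic components of the group algebra.
\<close>

lemma character_kernels:
  fixes f :: "'a \<Rightarrow> complex"
  defines "K \<equiv> \<lambda>C x y. of_nat (irr_dim C) / of_nat (Coset.order G) * irr_char C (inv x \<otimes> y)"
  shows "\<And>C. C \<in> Irr G \<Longrightarrow> \<exists>r\<ge>0. (\<Sum>x\<in>carrier G. \<Sum>y\<in>carrier G. cnj (f x) * K C x y * f y) = of_real r"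
    and "\<And>T. finite T \<Longrightarrow> T \<subseteq> Irr G \<Longrightarrow>
      (\<Sum>C\<in>T. Re (\<Sum>x\<in>carrier G. \<Sum>y\<in>carrier G. cnj (f x) * K C x y * f y)) \<le> (\<Sum>x\<in>carrier G. (cmod (f x))\<^sup>2)"
proof -
  have herm: "cnj (K C x y) = K C y x" if "C \<in> Irr G" "x \<in> carrier G" "y \<in> carrier G" for C x y
    using that by (simp add: K_def irr_char_inv[symmetric] inv_mult_group)
  have orth: "(\<Sum>y\<in>carrier G. K C x y * K C' y z) = (if C = C' then K C x z else 0)"
    if C: "C \<in> Irr G" "C' \<in> Irr G" and xz: "x \<in> carrier G" "z \<in> carrier G" for C C' x z
  proof -
    have "(\<Sum>y\<in>carrier G. K C x y * K C' y z) = of_nat (irr_dim C) / of_nat (Coset.order G) * (of_nat (irr_dim C') / of_nat (Coset.order G)) *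
        (\<Sum>y\<in>carrier G. irr_char C (inv x \<otimes> y) * irr_char C' (inv y \<otimes> z))"
      unfolding K_def sum_distrib_left by (intro sum.cong refl) (simp only: mult_ac)
    then show ?thesis
      using character_convolution[OF C inv_closed[OF xz(1)] xz(2)] order_pos irr_dim_pos[OF C(1)]
      by (simp add: K_def)
  qed
  show "\<exists>r\<ge>0. (\<Sum>x\<in>carrier G. \<Sum>y\<in>carrier G. cnj (f x) * K C x y * f y) = of_real r" if "C \<in> Irr G" for C
    by (rule orthogonal_kernels_form(1)[OF finite_carrier, of "{C}" K]) (use that herm orth in auto)
  show "(\<Sum>C\<in>T. Re (\<Sum>x\<in>carrier G. \<Sum>y\<in>carrier G. cnj (f x) * K C x y * f y)) \<le> (\<Sum>x\<in>carrier G. (cmod (f x))\<^sup>2)"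
    if "finite T" "T \<subseteq> Irr G" for T
  proof (rule orthogonal_kernels_form(2)[OF finite_carrier that(1)])
    fix C C' x y assume "C \<in> T" "C' \<in> T" and xy: "x \<in> carrier G" "y \<in> carrier G"
    then have C: "C \<in> Irr G" "C' \<in> Irr G" using that(2) by auto
    show "cnj (K C x y) = K C y x" by (rule herm[OF C(1) xy])
    show "(\<Sum>w\<in>carrier G. K C x w * K C' w y) = (if C = C' then K C x y else 0)" by (rule orth[OF C xy])
  qed
qed

lemma sum_indicator:
  assumes "A \<subseteq> carrier G"
  shows "(\<Sum>x\<in>carrier G. if x \<in> A then \<phi> x else (0 :: 'd :: comm_monoid_add)) = (\<Sum>x\<in>A. \<phi> x)"
  using assms finite_carrier by (simp add: sum.If_cases Int_absorb1)

lemma indicator_form: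
  fixes k :: "'a \<Rightarrow> 'a \<Rightarrow> complex"
  assumes "A \<subseteq> carrier G"
  shows "(\<Sum>x\<in>carrier G. \<Sum>y\<in>carrier G. cnj (if x \<in> A then 1 else 0) * k x y * (if y \<in> A then 1 else 0)) = (\<Sum>x\<in>A. \<Sum>y\<in>A. k x y)"
    "(\<Sum>x\<in>carrier G. (cmod (if x \<in> A then 1 else 0))\<^sup>2) = real (card A)"
proof -
  have "(\<Sum>x\<in>carrier G. \<Sum>y\<in>carrier G. cnj (if x \<in> A then 1 else 0) * k x y * (if y \<in> A then 1 else 0))
    = (\<Sum>x\<in>carrier G. if x \<in> A then (\<Sum>y\<in>carrier G. if y \<in> A then k x y else 0) else 0)"
    by (intro sum.cong refl) (auto intro!: sum.cong)
  then show "(\<Sum>x\<in>carrier G. \<Sum>y\<in>carrier G. cnj (if x \<in> A then 1 else 0) * k x y * (if y \<in> A then 1 else 0)) = (\<Sum>x\<in>A. \<Sum>y\<in>A. k x y)"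
    by (simp only: sum_indicator[OF assms])
  have "(\<Sum>x\<in>carrier G. (cmod (if x \<in> A then 1 else 0))\<^sup>2) = (\<Sum>x\<in>carrier G. if x \<in> A then 1 else 0)"
    by (intro sum.cong refl) auto
  then show "(\<Sum>x\<in>carrier G. (cmod (if x \<in> A then 1 else 0))\<^sup>2) = real (card A)"
    by (simp only: sum_indicator[OF assms]) simp
qed

text \<open>Evaluate the kernels at the indicator of \<open>H\<close>. Translation within
  \<open>H\<close> collapses the double sum to \<open>card H\<close> times the character sum. The
  trivial subgroup gives \<open>dim_square_sum\<close>.\<close>

lemma subgroup_character_sum:
  assumes H: "subgroup H G"
  shows "\<And>C. C \<in> Irr G \<Longrightarrow> \<exists>r\<ge>0. (\<Sum>h\<in>H. irr_char C h) = of_real r"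
    and "\<And>T. finite T \<Longrightarrow> T \<subseteq> Irr G \<Longrightarrow> (\<Sum>C\<in>T. real (irr_dim C) * Re (\<Sum>h\<in>H. irr_char C h)) \<le> Coset.order G"
proof -
  have HG: "H \<subseteq> carrier G" using H by (rule subgroup.subset)
  have finH: "finite H" using HG finite_carrier by (rule finite_subset)
  have cH: "0 < card H" using finH subgroup.one_closed[OF H] by (auto simp: card_gt_0_iff)
  have form: "(\<Sum>x\<in>H. \<Sum>y\<in>H. of_nat (irr_dim C) / of_nat (Coset.order G) * irr_char C (inv x \<otimes> y))
    = of_real (real (card H) * real (irr_dim C) / real (Coset.order G)) * (\<Sum>h\<in>H. irr_char C h)" for C
  proof -
    have "(\<Sum>y\<in>H. irr_char C (inv x \<otimes> y)) = (\<Sum>h\<in>H. irr_char C h)" if x: "x \<in> H" for x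
      using x HG subgroup.m_closed[OF H] subgroup.m_inv_closed[OF H]
      by (intro sum.reindex_bij_witness[of _ "\<lambda>y. x \<otimes> y" "\<lambda>y. inv x \<otimes> y"]) (auto simp: m_assoc[symmetric] subset_eq)
    then have "(\<Sum>x\<in>H. \<Sum>y\<in>H. of_nat (irr_dim C) / of_nat (Coset.order G) * irr_char C (inv x \<otimes> y))
      = (\<Sum>x\<in>H. of_nat (irr_dim C) / of_nat (Coset.order G) * (\<Sum>h\<in>H. irr_char C h))"
      unfolding sum_distrib_left[symmetric] by simp
    then show ?thesis by simp
  qed
  have pos: "0 < real (card H) * real (irr_dim C) / real (Coset.order G)" if "C \<in> Irr G" for C
    using cH order_pos irr_dim_pos[OF that] by simp
  show "\<exists>r\<ge>0. (\<Sum>h\<in>H. irr_char C h) = of_real r" if C: "C \<in> Irr G" for C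
  proof -
    obtain r where "0 \<le> r" and
      "of_real (real (card H) * real (irr_dim C) / real (Coset.order G)) * (\<Sum>h\<in>H. irr_char C h) = of_real r"
      using character_kernels(1)[OF C, of "\<lambda>x. if x \<in> H then 1 else 0"] unfolding indicator_form(1)[OF HG] form by blast
    moreover define q where "q = real (card H) * real (irr_dim C) / real (Coset.order G)"
    ultimately have "of_real q * (\<Sum>h\<in>H. irr_char C h) = of_real r" "0 < q" "0 \<le> r" using pos[OF C] by simp_all
    then show ?thesis by (intro exI[of _ "r / q"]) (simp add: nonzero_eq_divide_eq mult.commute)
  qed
  show "(\<Sum>C\<in>T. real (irr_dim C) * Re (\<Sum>h\<in>H. irr_char C h)) \<le> Coset.order G" if T: "finite T" "T \<subseteq> Irr G" for T
  proof -
    have "(\<Sum>C\<in>T. Re (of_real (real (card H) * real (irr_dim C) / real (Coset.order G)) * (\<Sum>h\<in>H. irr_char C h))) \<le> real (card H)"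
      using character_kernels(2)[OF T, of "\<lambda>x. if x \<in> H then 1 else 0"]
      unfolding indicator_form[OF HG] form .
    moreover have "(\<Sum>C\<in>T. Re (of_real (real (card H) * real (irr_dim C) / real (Coset.order G)) * (\<Sum>h\<in>H. irr_char C h)))
      = real (card H) / real (Coset.order G) * (\<Sum>C\<in>T. real (irr_dim C) * Re (\<Sum>h\<in>H. irr_char C h))"
      unfolding sum_distrib_left[of "real (card H) / real (Coset.order G)"]
    proof (rule sum.cong[OF refl])
      fix C
      have "Re (of_real q * w) = q * Re w" for q w by simp
      then show "Re (of_real (real (card H) * real (irr_dim C) / real (Coset.order G)) * (\<Sum>h\<in>H. irr_char C h))
        = real (card H) / real (Coset.order G) * (real (irr_dim C) * Re (\<Sum>h\<in>H. irr_char C h))"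
        by (simp only: times_divide_eq_left mult.assoc)
    qed
    ultimately have "real (card H) / real (Coset.order G) * (\<Sum>C\<in>T. real (irr_dim C) * Re (\<Sum>h\<in>H. irr_char C h))
      \<le> real (card H) / real (Coset.order G) * real (Coset.order G)"
      using order_pos by simp
    then show ?thesis by (rule mult_left_le_imp_le) (use cH order_pos in simp)
  qed
qed

lemma dim_square_sum:
  assumes "finite T" "T \<subseteq> Irr G"
  shows "(\<Sum>C\<in>T. (real (irr_dim C))\<^sup>2) \<le> Coset.order G"
proof -
  have "(\<Sum>C\<in>T. (real (irr_dim C))\<^sup>2) = (\<Sum>C\<in>T. real (irr_dim C) * Re (\<Sum>h\<in>{\<one>}. irr_char C h))"
    using assms(2) by (intro sum.cong refl) (auto simp: irr_char_one power2_eq_square)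
  then show ?thesis using subgroup_character_sum(2)[OF triv_subgroup assms] by simp
qed

definition conj_class :: "'a \<Rightarrow> 'a set" where
  "conj_class h = (\<lambda>g. g \<otimes> h \<otimes> inv g) ` carrier G"

lemma class_character_sum:
  assumes h: "h \<in> carrier G" and T: "finite T" "T \<subseteq> Irr G"
  shows "(\<Sum>C\<in>T. (cmod (irr_char C h))\<^sup>2) * card (conj_class h) \<le> Coset.order G"
proof -
  \<comment> \<open>kernel of the projection to the line spanned by the character, whose squared norm is the group order\<close>
  define K where "K C x y = irr_char C x * cnj (irr_char C y) / of_nat (Coset.order G)" for C and x y :: 'a
  let ?S = "conj_class h"
  have S: "?S \<subseteq> carrier G" using h by (auto simp: conj_class_def)
  have finS: "finite ?S" using finite_carrier by (simp add: conj_class_def)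
  have S0: "0 < card ?S" using finS one_closed by (auto simp: card_gt_0_iff conj_class_def)
  have o: "of_nat (Coset.order G) \<noteq> (0::complex)" using order_pos by simp
  have orth: "(\<Sum>y\<in>carrier G. K C x y * K C' y z) = (if C = C' then K C x z else 0)"
    if C: "C \<in> T" "C' \<in> T" for C C' x z
  proof -
    have C': "C \<in> Irr G" "C' \<in> Irr G" using C T(2) by auto
    \<comment> \<open>This is the convolution identity at the identity element; there the value of
      the character cancels the dimension.\<close>
    have "(\<Sum>y\<in>carrier G. cnj (irr_char C y) * irr_char C' y) = (\<Sum>y\<in>carrier G. irr_char C' (\<one> \<otimes> y) * irr_char C (inv y \<otimes> \<one>))"
      by (intro sum.cong refl) (simp add: irr_char_inv[OF C'(1)] mult.commute)
    also have "\<dots> = (if C = C' then of_nat (Coset.order G) else 0)"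
      using character_convolution[OF C'(2,1) one_closed one_closed] irr_dim_pos[OF C'(1)] irr_dim_pos[OF C'(2)]
        irr_char_one[OF C'(2)] by (auto split: if_splits)
    finally have s: "(\<Sum>y\<in>carrier G. cnj (irr_char C y) * irr_char C' y) = (if C = C' then of_nat (Coset.order G) else 0)" .
    have "(\<Sum>y\<in>carrier G. K C x y * K C' y z) = irr_char C x * cnj (irr_char C' z) / (of_nat (Coset.order G) * of_nat (Coset.order G)) *
       (\<Sum>y\<in>carrier G. cnj (irr_char C y) * irr_char C' y)"
      unfolding sum_distrib_left by (intro sum.cong refl) (simp add: K_def)
    then show ?thesis unfolding s using o by (simp add: K_def)
  qed
  have const: "irr_char C x = irr_char C h" if "C \<in> T" "x \<in> ?S" for C x
    using that T(2) irr_char_conj h by (auto simp: conj_class_def)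
  have "(\<Sum>C\<in>T. Re (\<Sum>x\<in>?S. \<Sum>y\<in>?S. K C x y)) \<le> real (card ?S)"
    using orthogonal_kernels_form(2)[OF finite_carrier T(1), of K "\<lambda>x. if x \<in> ?S then 1 else 0"] orth
    unfolding indicator_form[OF S] by (simp add: K_def mult.commute)
  also have "(\<Sum>C\<in>T. Re (\<Sum>x\<in>?S. \<Sum>y\<in>?S. K C x y)) = (\<Sum>C\<in>T. (real (card ?S))\<^sup>2 * (cmod (irr_char C h))\<^sup>2 / real (Coset.order G))"
  proof (rule sum.cong[OF refl])
    fix C assume C: "C \<in> T"
    have "(\<Sum>x\<in>?S. \<Sum>y\<in>?S. K C x y) = (\<Sum>x\<in>?S. \<Sum>y\<in>?S. irr_char C h * cnj (irr_char C h) / of_nat (Coset.order G))"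
      by (intro sum.cong refl) (simp add: K_def const[OF C])
    also have "\<dots> = of_real ((real (card ?S))\<^sup>2 * (cmod (irr_char C h))\<^sup>2 / real (Coset.order G))"
      by (simp add: complex_norm_square[symmetric] power2_eq_square del: of_real_power)
    finally show "Re (\<Sum>x\<in>?S. \<Sum>y\<in>?S. K C x y) = (real (card ?S))\<^sup>2 * (cmod (irr_char C h))\<^sup>2 / real (Coset.order G)"
      by (simp only: Re_complex_of_real)
  qed
  also have "\<dots> = (\<Sum>C\<in>T. (cmod (irr_char C h))\<^sup>2) * card ?S * (card ?S / real (Coset.order G))"
    unfolding sum_distrib_right by (intro sum.cong refl) (simp add: power2_eq_square)
  finally have "(\<Sum>C\<in>T. (cmod (irr_char C h))\<^sup>2) * card ?S * (card ?S / real (Coset.order G)) \<le> real (Coset.order G) * (card ?S / real (Coset.order G))"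
    using order_pos by simp
  then show ?thesis by (rule mult_right_le_imp_le) (use S0 order_pos in simp)
qed

text \<open>Character sums over \<open>H\<close> are nonnegative reals, so leaving out the identity
  changes them by the dimension at most. In \<open>theoremC\<close> this bounds \<open>c\<close>
  from below when the minimal degree is small.\<close>

lemma D_sub_le_2:
  assumes H: "subgroup H G"
  shows "D_sub G H \<le> 2"
proof (cases "finite (Irr G)")
  case False
  \<comment> \<open>the sum over an infinite set is \<open>0\<close>\<close>
  then show ?thesis by (simp add: D_sub_def)
next
  case fin: True
  have finH: "finite H" using subgroup.subset[OF H] finite_carrier by (rule finite_subset)
  have "(\<Sum>C\<in>Irr G. real (irr_dim C) * cmod (\<Sum>h\<in>H - {\<one>}. irr_char C h))
    \<le> (\<Sum>C\<in>Irr G. real (irr_dim C) * Re (\<Sum>h\<in>H. irr_char C h) + (real (irr_dim C))\<^sup>2)"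
  proof (rule sum_mono)
    fix C assume C: "C \<in> Irr G"
    obtain r where r: "0 \<le> r" "(\<Sum>h\<in>H. irr_char C h) = of_real r" using subgroup_character_sum(1)[OF H C] by blast
    have "(\<Sum>h\<in>H - {\<one>}. irr_char C h) = of_real r - of_nat (irr_dim C)"
      using finH subgroup.one_closed[OF H] by (simp add: sum_diff1 r(2) irr_char_one[OF C])
    then have "cmod (\<Sum>h\<in>H - {\<one>}. irr_char C h) \<le> r + real (irr_dim C)"
      using norm_triangle_ineq4[of "of_real r :: complex" "of_nat (irr_dim C)"] r(1) by simp
    then have "real (irr_dim C) * cmod (\<Sum>h\<in>H - {\<one>}. irr_char C h) \<le> real (irr_dim C) * (r + real (irr_dim C))"
      by (rule mult_left_mono) simp
    then show "real (irr_dim C) * cmod (\<Sum>h\<in>H - {\<one>}. irr_char C h) \<le> real (irr_dim C) * Re (\<Sum>h\<in>H. irr_char C h) + (real (irr_dim C))\<^sup>2"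
      by (simp add: r(2) distrib_left power2_eq_square)
  qed
  also have "\<dots> \<le> 2 * real (Coset.order G)"
    using subgroup_character_sum(2)[OF H fin subset_refl] dim_square_sum[OF fin subset_refl] by (simp add: sum.distrib)
  finally show ?thesis using order_pos by (simp add: D_sub_def field_simps)
qed

lemma D_sub_le_class_sum:
  assumes H: "subgroup H G"
  shows "D_sub G H \<le> (\<Sum>h\<in>H - {\<one>}. 1 / sqrt (card (conj_class h)))"
proof (cases "finite (Irr G)")
  case False
  then show ?thesis by (simp add: D_sub_def sum_nonneg)
next
  case fin: True
  have each: "(\<Sum>C\<in>Irr G. real (irr_dim C) * cmod (irr_char C h)) \<le> real (Coset.order G) * (1 / sqrt (card (conj_class h)))"
    if "h \<in> H - {\<one>}" for h
  proof -
    have h: "h \<in> carrier G" using that subgroup.subset[OF H] by blast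
    define t where "t = sqrt (card (conj_class h))"
    have "finite (conj_class h)" using finite_carrier by (simp add: conj_class_def)
    then have "0 < card (conj_class h)" using one_closed by (auto simp: card_gt_0_iff conj_class_def)
    then have t: "0 < t" "t * t = card (conj_class h)" by (simp_all add: t_def)
    \<comment> \<open>A weighted form of the Cauchy-Schwarz inequality. With \<open>t\<close> the
      square root of the class size, both resulting sums are at most
      \<open>Coset.order G / t\<close>.\<close>
    have amgm: "2 * (x * y) \<le> x\<^sup>2 / t + t * y\<^sup>2" for x y :: real
    proof -
      have "0 \<le> (x - t * y)\<^sup>2 / t" using t(1) by simp
      also have "\<dots> = x\<^sup>2 / t - 2 * (x * y) + t * y\<^sup>2" using t(1) by (simp add: field_simps power2_eq_square)
      finally show ?thesis by simp
    qed
    have "2 * (\<Sum>C\<in>Irr G. real (irr_dim C) * cmod (irr_char C h)) \<le> (\<Sum>C\<in>Irr G. (real (irr_dim C))\<^sup>2 / t + t * (cmod (irr_char C h))\<^sup>2)"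
      unfolding sum_distrib_left by (intro sum_mono amgm)
    also have "\<dots> = (\<Sum>C\<in>Irr G. (real (irr_dim C))\<^sup>2) / t + (\<Sum>C\<in>Irr G. (cmod (irr_char C h))\<^sup>2) * card (conj_class h) / t"
      unfolding sum.distrib sum_divide_distrib[symmetric] sum_distrib_left[symmetric] using t by (simp add: t(2)[symmetric])
    also have "\<dots> \<le> real (Coset.order G) / t + real (Coset.order G) / t"
      using t(1) by (intro add_mono divide_right_mono dim_square_sum class_character_sum h fin) auto
    finally show ?thesis by (simp add: t_def)
  qed
  have "(\<Sum>C\<in>Irr G. real (irr_dim C) * cmod (\<Sum>h\<in>H - {\<one>}. irr_char C h))
    \<le> (\<Sum>C\<in>Irr G. \<Sum>h\<in>H - {\<one>}. real (irr_dim C) * cmod (irr_char C h))"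
    unfolding sum_distrib_left[symmetric] by (intro sum_mono mult_left_mono norm_sum) simp
  also have "\<dots> = (\<Sum>h\<in>H - {\<one>}. \<Sum>C\<in>Irr G. real (irr_dim C) * cmod (irr_char C h))" by (rule sum.swap)
  also have "\<dots> \<le> (\<Sum>h\<in>H - {\<one>}. real (Coset.order G) * (1 / sqrt (card (conj_class h))))" by (intro sum_mono each)
  finally have "(\<Sum>C\<in>Irr G. real (irr_dim C) * cmod (\<Sum>h\<in>H - {\<one>}. irr_char C h))
    \<le> real (Coset.order G) * (\<Sum>h\<in>H - {\<one>}. 1 / sqrt (card (conj_class h)))"
    by (simp only: sum_distrib_left)
  then show ?thesis unfolding D_sub_def using order_pos by (simp add: field_simps)
qed

end

subsection \<open>Conjugacy classes of the symmetric group\<close>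


text \<open>A permutation that commutes with \<open>h\<close> preserves the support. On each cycle
  it is determined by the image of the base point, and off the support it is an arbitrary
  permutation.\<close>

lemma (in finite_perm) card_centralizer:
  assumes k: "card (perm_supp h) = k" and c: "card (base ` perm_supp h) = c"
  shows "card {g. g permutes \<Omega> \<and> g \<circ> h = h \<circ> g} \<le> k ^ c * fact (card \<Omega> - k)"
proof -
  let ?S = "perm_supp h"
  let ?C = "{g. g permutes \<Omega> \<and> g \<circ> h = h \<circ> g}"
  let ?T = "(base ` ?S \<rightarrow>\<^sub>E ?S) \<times> {p. p permutes \<Omega> - ?S}"
  define enc where "enc g = (restrict g (base ` ?S), \<lambda>x. if x \<in> \<Omega> - ?S then g x else x)" for g :: "nat \<Rightarrow> nat"
  have S\<Omega>: "?S \<subseteq> \<Omega>" using perm by (auto simp: perm_supp_def permutes_def)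
  have finS: "finite ?S" using S\<Omega> fin by (rule finite_subset)
  have comm: "g (h x) = h (g x)" if "g \<in> ?C" for g x using that by (auto dest: fun_cong[of _ _ x])
  have inj_g: "g x = g y \<longleftrightarrow> x = y" if "g \<in> ?C" for g x y
    using that permutes_inj[of g \<Omega>] by (auto dest: injD)
  have supp: "g x \<in> ?S \<longleftrightarrow> x \<in> ?S" if "g \<in> ?C" for g x
    using comm[OF that, of x, symmetric] inj_g[OF that] by (simp add: perm_supp_def)
  have \<Omega>g: "g x \<in> \<Omega> \<longleftrightarrow> x \<in> \<Omega>" if "g \<in> ?C" for g x using that permutes_in_image by fastforce
  have "inj_on enc ?C"
  proof (rule inj_onI)
    fix g g' assume g: "g \<in> ?C" and g': "g' \<in> ?C" and e: "enc g = enc g'"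
    have e1: "restrict g (base ` ?S) = restrict g' (base ` ?S)"
      and e2: "(\<lambda>x. if x \<in> \<Omega> - ?S then g x else x) = (\<lambda>x. if x \<in> \<Omega> - ?S then g' x else x)"
      using e by (simp_all add: enc_def)
    show "g = g'"
    proof
      fix x
      consider "x \<in> ?S" | "x \<in> \<Omega> - ?S" | "x \<notin> \<Omega>" by blast
      then show "g x = g' x"
      proof cases
        case 1
        have pow: "f ((h ^^ a) y) = (h ^^ a) (f y)" if "f \<in> ?C" for f a y
          by (induction a) (simp_all add: comm[OF that])
        have "restrict g (base ` ?S) (base x) = restrict g' (base ` ?S) (base x)" by (simp only: e1)
        then have "g (base x) = g' (base x)" using 1 by simp
        then have "g ((h ^^ cpos x) (base x)) = g' ((h ^^ cpos x) (base x))"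
          by (simp only: pow[OF g] pow[OF g'])
        then show ?thesis by (simp only: cpos(1))
      next
        case 2
        then show ?thesis using fun_cong[OF e2, of x] by simp
      next
        case 3
        have p: "g permutes \<Omega>" "g' permutes \<Omega>" using g g' by simp_all
        show ?thesis using permutes_not_in[OF p(1) 3] permutes_not_in[OF p(2) 3] by simp
      qed
    qed
  qed
  moreover have "enc ` ?C \<subseteq> ?T"
  proof
    fix y assume "y \<in> enc ` ?C"
    then obtain g where y: "y = enc g" and g: "g \<in> ?C" by (rule imageE)
    have "base x \<in> ?S" if "x \<in> ?S" for x by (rule subsetD[OF cyc_supp[OF that] base_in])
    then have "restrict g (base ` ?S) \<in> base ` ?S \<rightarrow>\<^sub>E ?S"
      by (intro restrict_PiE[THEN iffD2] PiE_I) (auto simp: supp[OF g])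
    moreover have "(\<lambda>x. if x \<in> \<Omega> - ?S then g x else x) permutes \<Omega> - ?S"
    proof (rule bij_imp_permutes)
      have "g ` (\<Omega> - ?S) = \<Omega> - ?S"
      proof (rule card_subset_eq)
        show "g ` (\<Omega> - ?S) \<subseteq> \<Omega> - ?S" using supp[OF g] \<Omega>g[OF g] by auto
        show "card (g ` (\<Omega> - ?S)) = card (\<Omega> - ?S)"
          by (rule card_image) (auto simp: inj_on_def inj_g[OF g])
      qed (use fin in simp)
      then have "bij_betw g (\<Omega> - ?S) (\<Omega> - ?S)" by (simp add: bij_betw_def inj_on_def inj_g[OF g])
      then show "bij_betw (\<lambda>x. if x \<in> \<Omega> - ?S then g x else x) (\<Omega> - ?S) (\<Omega> - ?S)"
        by (rule bij_betw_cong[THEN iffD1, rotated]) simp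
    qed auto
    ultimately show "y \<in> ?T" by (simp add: y enc_def)
  qed
  moreover have "finite ?T"
    using finS fin by (intro finite_cartesian_product finite_PiE finite_permutations) auto
  ultimately have "card ?C \<le> card ?T" by (rule card_inj_on_le)
  also have "card ?T = k ^ c * fact (card \<Omega> - k)"
    using finS fin S\<Omega> k c
    by (simp add: card_cartesian_product card_funcsetE card_permutations[OF refl] card_Diff_subset)
  finally show ?thesis .
qed

text \<open>Combine \<open>(n / k) ^ k \<le> (n choose k)\<close> with
  \<open>k ^ k \<le> k! * exp k\<close>.\<close>

lemma fact_ratio_le_exp:
  assumes "k \<le> n" "0 < k"
  shows "fact (n - k) * real n ^ k \<le> fact n * exp (real k)"
proof -
  have "real n ^ k = (real n / real k) ^ k * real k ^ k" using assms by (simp add: power_divide)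
  also have "\<dots> \<le> real (n choose k) * (fact k * exp (real k))"
    using binomial_ge_n_over_k_pow_k[OF assms(1), where 'a = real] power_le_fact_exp[of "real k" k]
    by (intro mult_mono) auto
  finally have "fact (n - k) * real n ^ k \<le> fact (n - k) * (real (n choose k) * (fact k * exp (real k)))"
    by (intro mult_left_mono) auto
  also have "\<dots> = fact n * exp (real k)"
  proof -
    have "real (fact k * fact (n - k) * (n choose k)) = real (fact n)"
      by (simp only: binomial_fact_lemma[OF assms(1)])
    then have "fact k * fact (n - k) * real (n choose k) = fact n" by simp
    then show ?thesis by (simp only: mult_ac flip: \<open>_ = fact n\<close>)
  qed
  finally show ?thesis .
qed

interpretation sym: finite_group "sym_group n" for n
  by (intro finite_group.intro sym_group_is_group finite_group_axioms.intro)
    (simp add: sym_group_def finite_permutations)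

text \<open>The half of orbit-stabiliser that is needed: each fibre of the map from \<open>g\<close>
  to the conjugate of \<open>h\<close> under \<open>g\<close> embeds into the centraliser by a left
  translation.\<close>

lemma card_conj_class_sym:
  assumes h: "h permutes {1..n}" and k: "card (perm_supp h) = k"
    and c: "card (finite_perm.base h ` perm_supp h) = c"
  shows "fact n \<le> card (sym.conj_class n h) * (k ^ c * fact (n - k))"
proof -
  interpret finite_perm "{1..n}" h by unfold_locales (use h in auto)
  let ?G = "{g. g permutes {1..n}}"
  let ?C = "{g. g permutes {1..n} \<and> g \<circ> h = h \<circ> g}"
  have finG: "finite ?G" by (rule finite_permutations) simp
  have cl: "sym.conj_class n h = (\<lambda>g. g \<circ> h \<circ> inv' g) ` ?G"
  proof -
    have "carrier (sym_group n) = ?G" by (simp add: sym_group_def)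
    moreover have "g \<otimes>\<^bsub>sym_group n\<^esub> h \<otimes>\<^bsub>sym_group n\<^esub> inv\<^bsub>sym_group n\<^esub> g = g \<circ> h \<circ> inv' g"
      if "g \<in> carrier (sym_group n)" for g
      using sym_group_inv_equality[OF that] by (simp only: sym_group_mult)
    ultimately show ?thesis unfolding sym.conj_class_def by (metis (no_types, lifting) image_cong)
  qed
  have fibre: "card {g \<in> ?G. g \<circ> h \<circ> inv' g = u} \<le> card ?C" if u: "u \<in> sym.conj_class n h" for u
  proof -
    obtain g0 where g0: "g0 permutes {1..n}" "u = g0 \<circ> h \<circ> inv' g0" using u unfolding cl by blast
    have "(\<circ>) (inv' g0) ` {g \<in> ?G. g \<circ> h \<circ> inv' g = u} \<subseteq> ?C"
    proof
      fix f assume "f \<in> (\<circ>) (inv' g0) ` {g \<in> ?G. g \<circ> h \<circ> inv' g = u}"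
      then obtain g where g: "g permutes {1..n}" "g \<circ> h \<circ> inv' g = u" "f = inv' g0 \<circ> g" by blast
      have "g (h x) = g0 (h (inv' g0 (g x)))" for x
      proof -
        have "(g \<circ> h \<circ> inv' g) (g x) = (g0 \<circ> h \<circ> inv' g0) (g x)" by (simp only: g(2) g0(2))
        then show ?thesis using permutes_inverses(2)[OF g(1)] by simp
      qed
      then have "f \<circ> h = h \<circ> f" using permutes_inverses(2)[OF g0(1)] by (simp add: fun_eq_iff g(3))
      moreover have "f permutes {1..n}" unfolding g(3) by (intro permutes_compose permutes_inv g g0)
      ultimately show "f \<in> ?C" by blast
    qed
    moreover have "inj_on ((\<circ>) (inv' g0)) {g \<in> ?G. g \<circ> h \<circ> inv' g = u}"
    proof (rule inj_onI)
      fix f f' :: "nat \<Rightarrow> nat" assume e: "inv' g0 \<circ> f = inv' g0 \<circ> f'"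
      have "g0 (inv' g0 (f x)) = g0 (inv' g0 (f' x))" for x using fun_cong[OF e, of x] by simp
      then show "f = f'" using permutes_inverses(1)[OF g0(1)] by (simp add: fun_eq_iff)
    qed
    ultimately show ?thesis by (intro card_inj_on_le[of "(\<circ>) (inv' g0)"]) (use finG in auto)
  qed
  have "?G = (\<Union>u\<in>sym.conj_class n h. {g \<in> ?G. g \<circ> h \<circ> inv' g = u})" unfolding cl by auto
  then have "card ?G \<le> (\<Sum>u\<in>sym.conj_class n h. card {g \<in> ?G. g \<circ> h \<circ> inv' g = u})"
    using card_UN_le[of "sym.conj_class n h" "\<lambda>u. {g \<in> ?G. g \<circ> h \<circ> inv' g = u}"] finG unfolding cl by simp
  also have "\<dots> \<le> card (sym.conj_class n h) * card ?C"
    using sum_bounded_above[OF fibre] by simp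
  also have "\<dots> \<le> card (sym.conj_class n h) * (k ^ c * fact (n - k))"
    using card_centralizer[OF k c] by (intro mult_left_mono) auto
  finally show ?thesis using card_permutations[of "{1..n}" n] by simp
qed

lemma inverse_sqrt_conj_class:
  assumes h: "h permutes {1..n}" and k: "card (perm_supp h) = k" "0 < k"
    and c: "card (finite_perm.base h ` perm_supp h) = c"
  shows "1 / sqrt (card (sym.conj_class n h)) \<le> exp (k / 2 - k / 2 * ln n + c / 2 * ln k)"
proof -
  have "perm_supp h \<subseteq> {1..n}" using h by (auto simp: perm_supp_def permutes_def)
  then have kn: "k \<le> n" using k(1) card_mono[of "{1..n}" "perm_supp h"] by simp
  have n: "0 < n" using kn k(2) by simp
  let ?N = "real (card (sym.conj_class n h))"
  have "real (fact n) \<le> real (card (sym.conj_class n h) * (k ^ c * fact (n - k)))"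
    by (rule of_nat_mono[OF card_conj_class_sym[OF h k(1) c]])
  then have 1: "fact n \<le> ?N * (real k ^ c * fact (n - k))" by simp
  have "fact n * real n ^ k \<le> ?N * real k ^ c * (fact (n - k) * real n ^ k)"
    using mult_right_mono[OF 1, of "real n ^ k"] by (simp add: mult_ac)
  also have "\<dots> \<le> ?N * real k ^ c * (fact n * exp (real k))"
    by (rule mult_left_mono[OF fact_ratio_le_exp[OF kn k(2)]]) simp
  finally have "fact n * real n ^ k \<le> fact n * (?N * (real k ^ c * exp (real k)))" by (simp add: mult_ac)
  then have 2: "real n ^ k \<le> ?N * (real k ^ c * exp (real k))" by simp
  have N: "0 < ?N"
  proof (rule ccontr)
    assume "\<not> 0 < ?N"
    then have "real n ^ k \<le> 0" using 2 by simp
    then show False using n by (simp add: not_less[symmetric])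
  qed
  define x where "x = exp (k / 2 - k / 2 * ln n + c / 2 * ln k)"
  have "x * x = exp (real k - real k * ln n + real c * ln k)"
    unfolding x_def exp_add[symmetric] by (rule arg_cong[of _ _ exp]) (simp add: field_simps)
  also have "\<dots> = exp (real k) / real n ^ k * real k ^ c"
    using n k(2) by (simp add: exp_add exp_diff exp_of_nat_mult)
  finally have "real k ^ c * exp (real k) = real n ^ k * (x * x)" using n by simp
  then have "real n ^ k \<le> ?N * (real n ^ k * (x * x))" using 2 by (simp only:)
  also have "\<dots> = real n ^ k * (?N * (x * x))" by (rule mult.left_commute)
  finally have "1 \<le> ?N * (x * x)" using n by simp
  then have "sqrt 1 \<le> sqrt (?N * (x * x))" by (rule real_sqrt_le_mono)
  then have "1 \<le> sqrt ?N * x" by (simp add: real_sqrt_mult x_def)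
  then show ?thesis using N unfolding x_def[symmetric] by (simp add: pos_divide_le_eq mult.commute)
qed

section \<open>Subgroups of the symmetric group and the conclusion\<close>

lemma perm_group_sym_group:
  assumes H: "subgroup H (sym_group n)"
  shows "perm_group {1..n} H"
proof
  have HG: "H \<subseteq> carrier (sym_group n)" using H by (rule subgroup.subset)
  show "finite {1..n}" by simp
  show p: "h permutes {1..n}" if "h \<in> H" for h using HG that by (auto simp: sym_group_carrier)
  show "id \<in> H" using subgroup.one_closed[OF H] by (simp add: sym_group_one)
  show "g \<circ> h \<in> H" if "g \<in> H" "h \<in> H" for g h
    using subgroup.m_closed[OF H that] by (simp add: sym_group_mult)
  show "inv' h \<in> H" if "h \<in> H" for h
    using subgroup.m_inv_closed[OF H that] sym_group_inv_equality[of h n] HG that by auto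
qed

lemma min_degree_le:
  assumes H: "subgroup H (sym_group n)"
  shows "perm_group.min_deg H (min_degree H)"
    and "H \<noteq> {\<one>\<^bsub>sym_group n\<^esub>} \<Longrightarrow> \<exists>h\<in>H. h \<noteq> id \<and> min_degree H = card (perm_supp h)"
proof -
  interpret perm_group "{1..n}" H by (rule perm_group_sym_group[OF H])
  let ?D = "{card (perm_supp h) | h. h \<in> H \<and> h \<noteq> id}"
  have "?D = (card \<circ> perm_supp) ` {h \<in> H. h \<noteq> id}" by auto
  then have fin: "finite ?D" using finite_H by simp
  then show "min_deg (min_degree H)" by (auto simp: min_deg_def min_degree_def intro!: Min_le)
  assume "H \<noteq> {\<one>\<^bsub>sym_group n\<^esub>}"
  then have "?D \<noteq> {}" using id_in by (auto simp: sym_group_one)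
  then have "min_degree H \<in> ?D" unfolding min_degree_def by (rule Min_in[OF fin])
  then show "\<exists>h\<in>H. h \<noteq> id \<and> min_degree H = card (perm_supp h)" by blast
qed

lemma D_sub_sym_le:
  "\<exists>m\<^sub>0>0. \<forall>n H. 0 < n \<longrightarrow> subgroup H (sym_group n) \<longrightarrow> m\<^sub>0 \<le> min_degree H \<longrightarrow>
     D_sub (sym_group n) H \<le> real n powr (2 - min_degree H / 40)"
proof -
  obtain m\<^sub>0 where m0: "0 < m\<^sub>0" and weight: "\<And>\<Omega> H m k c. perm_group \<Omega> H \<Longrightarrow> perm_group.min_deg H m \<Longrightarrow> m\<^sub>0 \<le> m \<Longrightarrow> m \<le> k \<Longrightarrow> k \<le> card \<Omega> \<Longrightarrow>
     real (card {h \<in> H. card (perm_supp h) = k \<and> card (finite_perm.base h ` perm_supp h) = c})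
       * exp (k / 2 - k / 2 * ln (card \<Omega>) + c / 2 * ln k) \<le> exp (- (m / 40 * ln (card \<Omega>)))"
    using class_weight_bound by blast
  show ?thesis
  proof (intro exI[of _ m\<^sub>0] conjI m0 allI impI)
    fix n H assume n: "0 < n" and H: "subgroup H (sym_group n)" and m: "m\<^sub>0 \<le> min_degree H"
    interpret perm_group "{1..n}" H by (rule perm_group_sym_group[OF H])
    define m' where "m' = min_degree H"
    have md: "min_deg m'" unfolding m'_def by (rule min_degree_le(1)[OF H])
    define N where "N k c = {h \<in> H. card (perm_supp h) = k \<and> card (finite_perm.base h ` perm_supp h) = c}" for k c
    define w where "w h = 1 / sqrt (card (sym.conj_class n h))" for h
    \<comment> \<open>Both coordinates are at least 1, so there are at most \<open>n\<^sup>2\<close>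
      pairs; this gives the 2 in the exponent.\<close>
    define I where "I = {(k, c). m' \<le> k \<and> k \<le> n \<and> 1 \<le> c \<and> c \<le> n}"
    have I: "I \<subseteq> {1..n} \<times> {1..n}" using m m0 by (auto simp: I_def m'_def)
    have finI: "finite I" using I by (rule finite_subset) simp
    have "H - {id} \<subseteq> (\<Union>(k, c)\<in>I. N k c)"
    proof
      fix h assume h: "h \<in> H - {id}"
      then have mk: "m' \<le> card (perm_supp h)" using md by (auto simp: min_deg_def)
      have kn: "card (perm_supp h) \<le> n" using card_mono[OF _ supp_subset, of h] h by simp
      have fs: "finite (perm_supp h)" using finite_supp h by blast
      have "0 < card (perm_supp h)" using mk m m0 by (simp add: m'_def)
      then have "perm_supp h \<noteq> {}" by auto
      then have "1 \<le> card (finite_perm.base h ` perm_supp h)" using fs by (simp add: Suc_le_eq card_gt_0_iff)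
      moreover have "card (finite_perm.base h ` perm_supp h) \<le> n" using card_image_le[OF fs] kn le_trans by blast
      ultimately have "(card (perm_supp h), card (finite_perm.base h ` perm_supp h)) \<in> I" using mk kn by (simp add: I_def)
      moreover have "h \<in> N (card (perm_supp h)) (card (finite_perm.base h ` perm_supp h))" using h by (simp add: N_def)
      ultimately show "h \<in> (\<Union>(k, c)\<in>I. N k c)" by blast
    qed
    moreover have finN: "finite (N k c)" for k c using finite_H by (simp add: N_def)
    ultimately have "(\<Sum>h\<in>H - {id}. w h) \<le> (\<Sum>h\<in>(\<Union>(k, c)\<in>I. N k c). w h)"
      using finI by (intro sum_mono2) (auto simp: w_def)
    also have "\<dots> = (\<Sum>h\<in>(\<Union>i\<in>I. N (fst i) (snd i)). w h)" by (simp add: case_prod_beta)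
    also have "\<dots> = (\<Sum>i\<in>I. \<Sum>h\<in>N (fst i) (snd i). w h)"
      by (rule sum.UNION_disjoint[OF finI]) (use finN in \<open>auto simp: N_def\<close>)
    also have "\<dots> \<le> (\<Sum>i\<in>I. exp (- (m' / 40 * ln n)))"
    proof (rule sum_mono)
      fix i assume "i \<in> I"
      then obtain k c where i: "i = (k, c)" "m' \<le> k" "k \<le> n" by (auto simp: I_def)
      have k0: "0 < k" using i m m0 by (simp add: m'_def)
      have "(\<Sum>h\<in>N k c. w h) \<le> real (card (N k c)) * exp (k / 2 - k / 2 * ln n + c / 2 * ln k)"
        unfolding w_def
        by (intro sum_bounded_above inverse_sqrt_conj_class) (use permutes k0 in \<open>auto simp: N_def\<close>)
      also have "\<dots> \<le> exp (- (m' / 40 * ln n))"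
        using weight[OF perm_group_axioms md, of k c] m i(2,3) by (simp add: N_def m'_def)
      finally show "(\<Sum>h\<in>N (fst i) (snd i). w h) \<le> exp (- (m' / 40 * ln n))" by (simp add: i(1))
    qed
    also have "\<dots> = real (card I) * exp (- (m' / 40 * ln n))" by simp
    also have "\<dots> \<le> (real n)\<^sup>2 * exp (- (m' / 40 * ln n))"
    proof (rule mult_right_mono)
      have "card I \<le> card ({1..n} \<times> {1..n})" by (rule card_mono[OF _ I]) simp
      also have "\<dots> = n\<^sup>2" by (simp add: card_cartesian_product power2_eq_square)
      finally have "real (card I) \<le> real (n\<^sup>2)" by (rule of_nat_mono)
      then show "real (card I) \<le> (real n)\<^sup>2" by simp
    qed simp
    also have "\<dots> = real n powr 2 * real n powr (- (m' / 40))"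
      using n by (simp add: powr_numeral) (simp add: powr_def)
    also have "\<dots> = real n powr (2 - min_degree H / 40)" unfolding powr_add[symmetric] by (simp add: m'_def)
    finally show "D_sub (sym_group n) H \<le> real n powr (2 - min_degree H / 40)"
      using sym.D_sub_le_class_sum[OF H] unfolding w_def sym_group_one by linarith
  qed
qed

theorem theoremC:
  shows "(\<exists>a b :: real. a > 0 \<and> b > 0 \<and>
            (\<forall>n \<ge> 2. \<forall>H. \<forall>c :: real.
               subgroup H (sym_group n) \<longrightarrow> H \<noteq> {\<one>\<^bsub>sym_group n\<^esub>} \<longrightarrow>
               D_sub (sym_group n) H \<ge> real n powr (- c) \<longrightarrow>
               real (min_degree H) \<le> a * c + b)) \<and>
         (\<forall>F. distinguishable F \<longrightarrow> (\<forall>(n, H)\<in>F. H \<noteq> {\<one>\<^bsub>sym_group n\<^esub>}) \<longrightarrow>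
            (\<exists>B. \<forall>(n, H)\<in>F. min_degree H \<le> B))"
proof -
  obtain m\<^sub>0 where m0: "0 < m\<^sub>0" and D: "\<And>n H. 0 < n \<Longrightarrow> subgroup H (sym_group n) \<Longrightarrow> m\<^sub>0 \<le> min_degree H \<Longrightarrow>
     D_sub (sym_group n) H \<le> real n powr (2 - min_degree H / 40)"
    using D_sub_sym_le by blast
  have bound: "real (min_degree H) \<le> 40 * c + (real m\<^sub>0 + 80)"
    if n: "2 \<le> n" and H: "subgroup H (sym_group n)" and c: "real n powr (- c) \<le> D_sub (sym_group n) H" for n H c
  proof (cases "m\<^sub>0 \<le> min_degree H")
    case True
    have "real n powr (- c) \<le> real n powr (2 - min_degree H / 40)"
      using order_trans[OF c D[OF _ H True]] n by simp
    then have "- c \<le> 2 - min_degree H / 40" using n by simp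
    then show ?thesis by simp
  next
    case False
    \<comment> \<open>Here \<open>c\<close> may be negative. From
      \<open>D_sub (sym_group n) H \<le> 2 \<le> n\<close> it follows that \<open>c\<close> is at
      least -1, so \<open>40 * c + 80\<close> is nonnegative and \<open>m\<^sub>0\<close>
      suffices.\<close>
    have "D_sub (sym_group n) H \<le> 2" by (rule sym.D_sub_le_2[OF H])
    also have "2 \<le> real n powr 1" using n by simp
    finally have "real n powr (- c) \<le> real n powr 1" using c by linarith
    moreover have "1 < real n" using n by simp
    ultimately have "- c \<le> 1" by (simp only: powr_le_cancel_iff)
    then show ?thesis using False by linarith
  qed
  show ?thesis
  proof (intro conjI allI impI)
    show "\<exists>a b :: real. a > 0 \<and> b > 0 \<and>
            (\<forall>n \<ge> 2. \<forall>H. \<forall>c :: real.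
               subgroup H (sym_group n) \<longrightarrow> H \<noteq> {\<one>\<^bsub>sym_group n\<^esub>} \<longrightarrow>
               D_sub (sym_group n) H \<ge> real n powr (- c) \<longrightarrow>
               real (min_degree H) \<le> a * c + b)"
      by (rule exI[of _ 40], rule exI[of _ "real m\<^sub>0 + 80"]) (use bound in auto)
  next
    fix F assume F: "distinguishable F" and ne: "\<forall>(n, H)\<in>F. H \<noteq> {\<one>\<^bsub>sym_group n\<^esub>}"
    then obtain c where sub: "\<forall>(n, H)\<in>F. subgroup H (sym_group n)"
      and c: "\<forall>(n, H)\<in>F. D_sub (sym_group n) H \<ge> real n powr (- c)"
      unfolding distinguishable_def subgroup_family_def by blast
    have "min_degree H \<le> nat \<lceil>40 * c + (real m\<^sub>0 + 80)\<rceil>" if nH: "(n, H) \<in> F" for n H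
    proof -
      have H: "subgroup H (sym_group n)" using sub nH by blast
      have H1: "H \<noteq> {id}" using ne nH by (auto simp: sym_group_one)
      obtain h where h: "h \<in> H" "h \<noteq> id" using H1 subgroup.one_closed[OF H] by (auto simp: sym_group_one)
      have p: "h permutes {1..n}" using subgroup.subset[OF H] h(1) by (auto simp: sym_group_carrier)
      \<comment> \<open>A nonidentity permutation moves two points, so the first part applies to
        every member of the family.\<close>
      have "2 \<le> n"
      proof (rule ccontr)
        assume "\<not> 2 \<le> n"
        then have "{1..n} \<subseteq> {1}" by auto
        then have "h permutes {1}" by (rule permutes_subset[OF p])
        then show False using h(2) by simp
      qed
      moreover have "real n powr (- c) \<le> D_sub (sym_group n) H" using c nH by blast
      ultimately have "real (min_degree H) \<le> 40 * c + (real m\<^sub>0 + 80)" using H by (intro bound)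
      then show ?thesis by linarith
    qed
    then show "\<exists>B. \<forall>(n, H)\<in>F. min_degree H \<le> B" by blast
  qed
qed

end
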